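(* Let $p\in[1,+\infty)$ and let $F\in\Omega^2_{p,\mathbb{Z}}(B)$. Then there exists a sequence $\{F_k\}_{k\in\mathbb{N}}\subset\Omega^2_{p,R}(B)$ such that $\|F_k-F\|_{L^p(B)}\to 0$ as $k\to+\infty$.
   Context: $B$ is the open unit ball in $\mathbb{R}^3$; $C=(-1/2,1/2)^3$ is the open unit cube centred at the origin and $C_r(x_0):=rC+x_0$. $\Omega^2_{L^p}(B)$ is the set of $2$-forms on $B$ whose coefficients belong to $L^p(B)$. Restriction to cubes. Let $\|x\|_*:=\max_j|x_j|$ and, for $x_0\in B$, $n_{x_0}(x):=\|x-x_0\|_*$ (a Lipschitz function whose level sets are boundaries of cubes centred at $x_0$). For $F\in\Omega^2_{L^p}(B)$, by Fubini's theorem, for a.e. $r$ with $C_r(x_0)\Subset B$ one sets $i^*_{\partial C_r(x_0)}F:=\star(F\wedge dn_{x_0})|_{\partial C_r(x_0)}\,\mathrm{vol}_{\partial C_r(x_0)}$, where $\star$ is the Hodge star of Euclidean $\mathbb{R}^3$; for smooth $F$ this is the usual pullback of $F$ to $\partial C_r(x_0)$. Equivalently, $\int_{\partial C_r(x_0)}i^*_{\partial C_r(x_0)}F=\int_{\partial C_r(x_0)}X\cdot\nu_{\partial C_r(x_0)}\,d\mathcal{H}^2$, where $\nu$ is the outward unit normal and $X=(F_{23},-F_{13},F_{12})$ is the vector field corresponding to $F=F_{12}dx^1\wedge dx^2+F_{13}dx^1\wedge dx^3+F_{23}dx^2\wedge dx^3$. $\Omega^2_{p,\mathbb{Z}}(B)$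 is the set of all $F\in\Omega^2_{L^p}(B)$ such that for every $x_0\in B$ one has $\frac{1}{2\pi}\int_{\partial C_r(x_0)}i^*_{\partial C_r(x_0)}F\in\mathbb{Z}$ for $\mathcal{L}^1$-a.e. Lebesgue point $r$ of the function $F_{x_0}(r):=\frac{1}{2\pi}\int_{\partial C_r(x_0)}i^*_{\partial C_r(x_0)}F$, $r\in\big(0,\frac{1}{\sqrt3}\mathrm{dist}(x_0,\partial B)\big)$. $\Omega^2_{p,R}(B)$ is the set of all $F\in\Omega^2_{L^p}(B)$ for which there are finitely many points $x_1,\dots,x_m\in B$ and integers $h_1,\dots,h_m\in\mathbb{Z}$ such that $F\in C^\infty(B\setminus\{x_1,\dots,x_m\})$ and $dF=\big(\sum_{j=1}^m2\pi h_j\delta_{x_j}\big)dx^1\wedge dx^2\wedge dx^3$ in $\mathcal{D}'(B)$. *)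

theory Defs
  imports "HOL-Analysis.Analysis"
begin

abbreviation unit_ball3 :: "(real^3) set" where
  "unit_ball3 \<equiv> ball 0 1"

text \<open>A 1-form is a covector field, a 2-form a field of alternating bilinear maps on
  \<open>\<real>\<^sup>3\<close>; only the values on the ball matter.\<close>

type_synonym covector = "real^3 \<Rightarrow> real"
type_synonym bivector_map = "real^3 \<Rightarrow> real^3 \<Rightarrow> real"
type_synonym form2 = "real^3 \<Rightarrow> bivector_map"

definition alternating2 :: "bivector_map \<Rightarrow> bool" where
  "alternating2 \<omega> \<longleftrightarrow> bilinear \<omega> \<and> (\<forall>v. \<omega> v v = 0)"

definition cf :: "form2 \<Rightarrow> 3 \<Rightarrow> 3 \<Rightarrow> real^3 \<Rightarrow> real" where
  "cf F i j x = F x (axis i 1) (axis j 1)"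

definition wedge21 :: "bivector_map \<Rightarrow> covector \<Rightarrow> real^3 \<Rightarrow> real^3 \<Rightarrow> real^3 \<Rightarrow> real" where
  "wedge21 \<omega> \<alpha> u v w = \<omega> u v * \<alpha> w + \<omega> v w * \<alpha> u + \<omega> w u * \<alpha> v"

definition hodge3 :: "(real^3 \<Rightarrow> real^3 \<Rightarrow> real^3 \<Rightarrow> real) \<Rightarrow> real" where
  "hodge3 \<eta> = \<eta> (axis 1 1) (axis 2 1) (axis 3 1)"

text \<open>The differential of a function at a point, and smoothness of functions on an open
  set \<open>S\<close>: all iterated partial derivatives exist and are continuous.\<close>

abbreviation dif :: "(real^3 \<Rightarrow> real) \<Rightarrow> real^3 \<Rightarrow> covector" where
  "dif f x \<equiv> frechet_derivative f (at x)"

primrec Ck_on :: "nat \<Rightarrow> (real^3) set \<Rightarrow> (real^3 \<Rightarrow> real) \<Rightarrow> bool" where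
  "Ck_on 0 S f \<longleftrightarrow> continuous_on S f"
| "Ck_on (Suc k) S f \<longleftrightarrow>
     (\<forall>x\<in>S. f differentiable (at x)) \<and> (\<forall>i. Ck_on k S (\<lambda>x. dif f x (axis i 1)))"

definition Cinf_on :: "(real^3) set \<Rightarrow> (real^3 \<Rightarrow> real) \<Rightarrow> bool" where
  "Cinf_on S f \<longleftrightarrow> (\<forall>k. Ck_on k S f)"

definition test_functions :: "(real^3) set \<Rightarrow> (real^3 \<Rightarrow> real) set" where
  "test_functions S = {\<phi>. Cinf_on UNIV \<phi> \<and>
      compact (closure {x. \<phi> x \<noteq> 0}) \<and> closure {x. \<phi> x \<noteq> 0} \<subseteq> S}"

definition norm2 :: "bivector_map \<Rightarrow> real" where
  "norm2 \<omega> = sqrt ((\<omega> (axis 1 1) (axis 2 1))\<^sup>2 + (\<omega> (axis 1 1) (axis 3 1))\<^sup>2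
                + (\<omega> (axis 2 1) (axis 3 1))\<^sup>2)"

definition Omega2_Lp :: "real \<Rightarrow> form2 set" where
  "Omega2_Lp p = {F. (\<forall>x\<in>unit_ball3. alternating2 (F x)) \<and>
     (\<forall>i j. cf F i j \<in> borel_measurable (lebesgue_on unit_ball3) \<and>
            integrable (lebesgue_on unit_ball3) (\<lambda>x. \<bar>cf F i j x\<bar> powr p))}"

definition Lp_norm2 :: "real \<Rightarrow> form2 \<Rightarrow> real" where
  "Lp_norm2 p F = (LINT x|lebesgue_on unit_ball3. norm2 (F x) powr p) powr (1 / p)"

text \<open>Integration over \<open>\<partial>C\<^sub>r(x\<^sub>0)\<close> with respect to its area form. The face with outward
  normal \<open>s e\<^sub>j\<close> (\<open>s = \<plusminus>1\<close>) is parametrised isometrically by an open square of side \<open>r\<close>.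
  Addition in the index type \<open>3\<close> is cyclic, so \<open>j, j + 1, j + 2\<close> are the three
  coordinate indices. The edges, a null set, are omitted.\<close>

definition face_pt :: "real \<Rightarrow> real^3 \<Rightarrow> 3 \<Rightarrow> real \<Rightarrow> real \<times> real \<Rightarrow> real^3" where
  "face_pt r x0 j s q =
     x0 + axis j (s * r / 2) + axis (j + 1) (fst q) + axis (j + 2) (snd q)"

definition cube_surface_integral :: "real \<Rightarrow> real^3 \<Rightarrow> (real^3 \<Rightarrow> real) \<Rightarrow> real" where
  "cube_surface_integral r x0 g =
     (\<Sum>j\<in>UNIV. \<Sum>s\<in>{-1, 1}.
        set_lebesgue_integral lebesgue ({-r/2<..<r/2} \<times> {-r/2<..<r/2}) (\<lambda>q. g (face_pt r x0 j s q)))"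

text \<open>The density of \<open>i\<^sup>*F\<close> on \<open>\<partial>C\<^sub>r(x\<^sub>0)\<close> with respect to the area form,
  \<open>\<star>(F \<and> dn)\<close> with \<open>n(x) = \<parallel>x - x\<^sub>0\<parallel>\<^sub>*\<close>; the max norm is \<^const>\<open>infnorm\<close>.
  The function \<open>n\<close> is differentiable on the open faces.\<close>

definition restr_density :: "form2 \<Rightarrow> real^3 \<Rightarrow> real^3 \<Rightarrow> real" where
  "restr_density F x0 x = hodge3 (wedge21 (F x) (dif (\<lambda>y. infnorm (y - x0)) x))"

definition cube_flux :: "form2 \<Rightarrow> real^3 \<Rightarrow> real \<Rightarrow> real" where
  "cube_flux F x0 r = 1 / (2 * pi) * cube_surface_integral r x0 (restr_density F x0)"

definition lebesgue_point :: "(real \<Rightarrow> real) \<Rightarrow> real \<Rightarrow> bool" where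
  "lebesgue_point f r \<longleftrightarrow>
     (\<exists>e>0. set_integrable lebesgue {r-e..r+e} f) \<and>
     ((\<lambda>e. 1 / (2 * e) * set_lebesgue_integral lebesgue {r-e..r+e} (\<lambda>t. \<bar>f t - f r\<bar>))
        \<longlongrightarrow> 0) (at_right 0)"

definition Omega2_Z :: "real \<Rightarrow> form2 set" where
  "Omega2_Z p = {F \<in> Omega2_Lp p. \<forall>x0\<in>unit_ball3. AE r in lebesgue.
      r \<in> {0<..<1 / sqrt 3 * infdist x0 (frontier unit_ball3)} \<longrightarrow>
      lebesgue_point (cube_flux F x0) r \<longrightarrow> cube_flux F x0 r \<in> \<int>}"

text \<open>The distributional exterior derivative of \<open>F\<close>, as the coefficient of
  \<open>dx\<^sup>1 \<and> dx\<^sup>2 \<and> dx\<^sup>3\<close> tested against \<open>\<phi>\<close>. As \<open>d(\<phi>F) = d\<phi> \<and> F + \<phi> dF\<close> and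
  \<open>d\<phi> \<and> F = F \<and> d\<phi>\<close>, it is minus the integral of \<open>F \<and> d\<phi>\<close>.\<close>

definition dist_d :: "form2 \<Rightarrow> (real^3 \<Rightarrow> real) \<Rightarrow> real" where
  "dist_d F \<phi> = - (LINT x|lebesgue_on unit_ball3. hodge3 (wedge21 (F x) (dif \<phi> x)))"

definition Omega2_R :: "real \<Rightarrow> form2 set" where
  "Omega2_R p = {F \<in> Omega2_Lp p. \<exists>(m::nat) (x :: nat \<Rightarrow> real^3) (h :: nat \<Rightarrow> int).
      (\<forall>j\<in>{1..m}. x j \<in> unit_ball3) \<and>
      (\<forall>i j. Cinf_on (unit_ball3 - x ` {1..m}) (cf F i j)) \<and>
      (\<forall>\<phi>\<in>test_functions unit_ball3.
         dist_d F \<phi> = (\<Sum>j=1..m. 2 * pi * of_int (h j) * \<phi> (x j)))}"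

end

theory Submission
  imports Defs
begin

text \<open>
  A 2-form \<open>F\<close> is treated through the vector field \<open>X = (F\<^sub>2\<^sub>3, F\<^sub>3\<^sub>1, F\<^sub>1\<^sub>2)\<close>: restriction
  to the boundary of a cube becomes the normal component of \<open>X\<close>, and \<open>dF\<close> becomes the
  divergence of \<open>X\<close>. Forms in \<open>Omega2_R p\<close> are then fields that are smooth away from finitely
  many points and whose divergence is a sum of point charges \<open>2 \<pi> h \<delta>\<close>.

  The charges are created as follows. Cut space into cubes of half side \<open>r\<close>. On the cube \<open>Q\<close>
  with centre \<open>c\<close>, replace \<open>X\<close> by the constant \<open>X c\<close> plus the field that is radial about \<open>c\<close>,
  homogeneous of degree \<open>-2\<close>, and has on \<open>\<partial>Q\<close> the normal component of \<open>X - X c\<close>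
  (\<open>cube_field\<close>). The constant field has no divergence and the radial field has divergence only
  at its centre, so the new field has the normal component of \<open>X\<close> on \<open>\<partial>Q\<close> and, inside \<open>Q\<close>,
  the divergence \<open>(flux of X through \<partial>Q) \<delta>\<^sub>c\<close> (\<open>cube_divergence\<close>). The contributions of
  a face to its two neighbouring cubes cancel (\<open>grid_telescope\<close>), and if the fluxes lie in
  \<open>2 \<pi> \<int>\<close> the result is a field with the required charges (\<open>grid_field\<close>).

  The new field is close to \<open>X\<close>. A radial field of degree \<open>-2\<close> in dimension three is locally
  \<open>p\<close>-integrable exactly for \<open>p < 3/2\<close>, and then the error on \<open>Q\<close> is at most
  \<open>C (\<integral>\<^sub>Q |X - X c|\<^sup>p + r \<integral>\<^sub>\<partial>\<^sub>Q |X - X c|\<^sup>p)\<close> (\<open>cube_field_energy\<close>). Averaged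
  over the position of the grid, the sum of these quantities over all cubes is bounded by the largest
  \<open>\<parallel>X(\<cdot> + w) - X\<parallel>\<^sub>p\<^sup>p\<close> with \<open>|w| \<le> 2 r\<close> (\<open>cube_energy_average\<close>), which tends to
  \<open>0\<close> with \<open>r\<close>. So some grid is good for the error (\<open>grid_selection\<close>). Because the centre
  value is subtracted before extending, cubes with and without flux need not be told apart.

  For \<open>p \<ge> 3/2\<close> a point charge is not \<open>p\<close>-integrable, and indeed there are no charges. A flux of
  modulus at least \<open>2 \<pi>\<close> through \<open>\<partial>Q\<close> forces
  \<open>r \<integral>\<^sub>\<partial>\<^sub>Q |X - X c|\<^sup>3\<^sup>/\<^sup>2\<close> to be bounded below independently of \<open>r\<close>
  (\<open>outflow_le_energy\<close>), while on a good grid the sum of these quantities is small. Hence all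
  fluxes vanish on fine good grids, the approximants are divergence free, they converge to \<open>X\<close> in
  \<open>L\<^sup>1\<close>, and \<open>X\<close> itself is divergence free (\<open>point_charge_approximation\<close>).

  It remains to make the approximants smooth. Subtracting from a charged field the fields
  \<open>x / |x|\<^sup>3\<close> of its charges leaves a divergence free field, which is mollified; the subtracted
  fields, smooth off the charges, are then added again (\<open>smooth_charged_approximation\<close>). All this
  happens on slightly smaller balls, and a dilation brings the result back to the unit ball
  (\<open>charged_field_approximation\<close>).

  The hypothesis speaks about a fixed centre and almost every side length, whereas a grid needs one
  side length and many centres. As almost every point is a Lebesgue point, the flux is
  quantised for every centre and almost every side; by Fubini's theorem, for almost every side it is
  quantised for almost every centre, and a grid in generic position has only such centres
  (\<open>integral_flux_small\<close>).
\<close>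

section \<open>Coordinates adapted to the faces of a cube\<close>

abbreviation Lp_int :: "real \<Rightarrow> ('a::euclidean_space \<Rightarrow> 'b::real_normed_vector) \<Rightarrow> ennreal" where
  "Lp_int p f \<equiv> \<integral>\<^sup>+x. ennreal (norm (f x) powr p) \<partial>lborel"

abbreviation Lp_int_on :: "'a::euclidean_space set \<Rightarrow> real \<Rightarrow> ('a \<Rightarrow> 'b::real_normed_vector) \<Rightarrow> ennreal" where
  "Lp_int_on A p f \<equiv> \<integral>\<^sup>+x. indicator A x * ennreal (norm (f x) powr p) \<partial>lborel"

text \<open>Squares and cubes are half open, so that the cubes of a grid partition space.\<close>

abbreviation "face r \<equiv> {-r..<r} \<times> {-r..<r::real}"

abbreviation face_int :: "real \<Rightarrow> (real \<times> real \<Rightarrow> real) \<Rightarrow> real" where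
  "face_int r f \<equiv> \<integral>u. indicator (face r) u * f u \<partial>lborel"

abbreviation face_sum :: "(3 \<Rightarrow> real \<Rightarrow> 'a::comm_monoid_add) \<Rightarrow> 'a" where
  "face_sum f \<equiv> \<Sum>j\<in>UNIV. \<Sum>s\<in>{-1, 1}. f j s"

abbreviation pairing :: "(real^3 \<Rightarrow> real^3) \<Rightarrow> (real^3 \<Rightarrow> real^3) \<Rightarrow> real" where
  "pairing V G \<equiv> \<integral>x. V x \<bullet> G x \<partial>lborel"

abbreviation integrable_pairing :: "(real^3 \<Rightarrow> real^3) \<Rightarrow> (real^3 \<Rightarrow> real^3) \<Rightarrow> bool" where
  "integrable_pairing V G \<equiv> integrable lborel (\<lambda>x. V x \<bullet> G x)"

lemma cyclic_distinct: fixes j :: 3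
  shows "j + 1 \<noteq> j" "j + 2 \<noteq> j" "j + 1 \<noteq> j + 2" "j \<noteq> j + 1" "j \<noteq> j + 2" "j + 2 \<noteq> j + 1"
  by simp_all

lemma UNIV_cyclic: fixes j :: 3 shows "UNIV = {j, j + 1, j + 2}"
proof -
  have "card {j, j+1, j+2} = CARD(3)" using cyclic_distinct[of j] by simp
  then show ?thesis by (metis card_subset_eq finite subset_UNIV)
qed

lemma all_cyclic: fixes j :: 3 shows "(\<forall>i. P i) \<longleftrightarrow> P j \<and> P (j + 1) \<and> P (j + 2)"
  using UNIV_cyclic[of j] by (metis UNIV_I insertE singletonD)

lemma sum_cyclic: fixes j :: 3 and f :: "3 \<Rightarrow> 'a::comm_monoid_add"
  shows "(\<Sum>i\<in>UNIV. f i) = f j + (f (j + 1) + f (j + 2))"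
  by (subst UNIV_cyclic[of j]) (simp add: cyclic_distinct)

lemma prod_cyclic: fixes j :: 3 and f :: "3 \<Rightarrow> 'a::comm_monoid_mult"
  shows "(\<Prod>i\<in>UNIV. f i) = f j * (f (j + 1) * f (j + 2))"
  by (subst UNIV_cyclic[of j]) (simp add: cyclic_distinct)

text \<open>The face of outward normal \<open>s e\<^sub>j\<close> of the cube of half side \<open>r\<close> about the origin is
  \<open>fpt j (s * r)\<close> applied to a square; with the height \<open>z\<close> as a third variable the same
  coordinates serve for cubes and pyramids.\<close>

definition fpt :: "3 \<Rightarrow> real \<Rightarrow> real \<times> real \<Rightarrow> real^3" where
  "fpt j z q = axis j z + axis (j + 1) (fst q) + axis (j + 2) (snd q)"

lemma fpt_nth [simp]:
  "fpt j z q $ j = z" "fpt j z q $ (j + 1) = fst q" "fpt j z q $ (j + 2) = snd q"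
  by (auto simp: fpt_def axis_def cyclic_distinct)

lemma fpt_cases: "x = fpt j (x $ j) (x $ (j + 1), x $ (j + 2))"
  by (simp add: vec_eq_iff all_cyclic[of _ j])

lemma scaleR_fpt: "t *\<^sub>R fpt j z q = fpt j (t * z) (t *\<^sub>R q)"
  by (simp add: vec_eq_iff all_cyclic[of _ j])

lemma continuous_on_axis [continuous_intros]:
  fixes f :: "'a::topological_space \<Rightarrow> real"
  assumes "continuous_on S f" shows "continuous_on S (\<lambda>x. axis i (f x) :: real^'n)"
proof -
  have eq: "(\<lambda>x. axis i (f x) :: real^'n) = (\<lambda>x. f x *\<^sub>R axis i 1)"
    by (auto simp: vec_eq_iff axis_def)
  show ?thesis unfolding eq using assms by (intro continuous_intros)
qed

lemma continuous_on_fpt [continuous_intros]: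
  assumes "continuous_on S f" "continuous_on S g"
  shows "continuous_on S (\<lambda>x. fpt j (f x) (g x))"
  unfolding fpt_def by (intro continuous_intros assms)

lemma borel_measurable_fpt [measurable (raw)]:
  assumes "f \<in> borel_measurable M" "g \<in> borel_measurable M"
  shows "(\<lambda>x. fpt j (f x) (g x)) \<in> borel_measurable M"
proof -
  have "continuous_on UNIV (\<lambda>p. fpt j (fst p) (snd p))"
    by (intro continuous_intros)
  then have "(\<lambda>p. fpt j (fst p) (snd p)) \<in> borel_measurable borel"
    by (rule borel_measurable_continuous_onI)
  from measurable_compose[OF borel_measurable_Pair[OF assms] this]
  show ?thesis by simp
qed

lemma prod_Basis_real3: "(\<Prod>b\<in>Basis. (x::real^3) \<bullet> b) = (\<Prod>i\<in>UNIV. x $ i)"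
proof -
  have B: "(Basis :: (real^3) set) = (\<lambda>i. axis i 1) ` UNIV"
    by (auto simp: Basis_vec_def)
  show ?thesis unfolding B
    by (subst prod.reindex) (auto simp: inj_on_def axis_eq_axis inner_axis)
qed

text \<open>A permutation of the coordinates, possibly with a reflection, preserves volume. Fubini's theorem
  over cubes and pyramids rests on this.\<close>

lemma lborel_fpt:
  assumes s: "s \<in> {-1, 1::real}"
  shows "distr (lborel :: (real \<times> real \<times> real) measure) borel (\<lambda>p. fpt j (s * fst p) (snd p)) = lborel"
proof (rule lborel_eqI[symmetric])
  fix l u :: "real^3" assume lu: "\<And>b. b \<in> Basis \<Longrightarrow> l \<bullet> b \<le> u \<bullet> b"
  have lu': "l $ i \<le> u $ i" for i
    using lu[of "axis i 1"] by (auto simp: inner_axis axis_in_Basis_iff)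
  define a where "a = (if s = 1 then l $ j else - (u $ j))"
  define b where "b = (if s = 1 then u $ j else - (l $ j))"
  have ab: "b - a = (u - l) $ j" using s by (auto simp: a_def b_def)
  have eq: "(\<lambda>p. fpt j (s * fst p) (snd p)) -` box l u
      = ({a<..<b} \<times> ({l $ (j + 1)<..<u $ (j + 1)} \<times> {l $ (j + 2)<..<u $ (j + 2)}))"
  proof (intro set_eqI)
    fix p :: "real \<times> real \<times> real"
    obtain z q w where p: "p = (z, q, w)" by (metis prod.exhaust)
    have "fpt j (s * z) (q, w) \<in> box l u \<longleftrightarrow> 
       l $ j < s * z \<and> s * z < u $ j \<and> l $ (j + 1) < q \<and> q < u $ (j + 1) \<and> l $ (j + 2) < w \<and> w < u $ (j + 2)"
      unfolding mem_box_cart all_cyclic[of _ j] by auto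
    also have "\<dots> \<longleftrightarrow> p \<in> ({a<..<b} \<times> ({l $ (j + 1)<..<u $ (j + 1)} \<times> {l $ (j + 2)<..<u $ (j + 2)}))"
      using s unfolding p by (auto simp: a_def b_def)
    finally show "p \<in> (\<lambda>p. fpt j (s * fst p) (snd p)) -` box l u \<longleftrightarrow> p \<in> ({a<..<b} \<times> ({l $ (j + 1)<..<u $ (j + 1)} \<times> {l $ (j + 2)<..<u $ (j + 2)}))"
      by (simp add: p)
  qed
  have "emeasure (distr lborel borel (\<lambda>p. fpt j (s * fst p) (snd p))) (box l u) 
     = emeasure lborel (({a<..<b} \<times> ({l $ (j + 1)<..<u $ (j + 1)} \<times> {l $ (j + 2)<..<u $ (j + 2)})))"
  proof (subst emeasure_distr)
    have "continuous_on UNIV (\<lambda>p :: real \<times> real \<times> real. fpt j (s * fst p) (snd p))"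
      by (intro continuous_intros)
    then show "(\<lambda>p :: real \<times> real \<times> real. fpt j (s * fst p) (snd p)) \<in> lborel \<rightarrow>\<^sub>M borel"
      by (simp only: measurable_lborel2 borel_measurable_continuous_onI)
  qed (simp_all only: eq space_lborel Int_UNIV_right, simp_all)
  also have "\<dots> = ennreal ((b - a) * ((u - l) $ (j + 1) * (u - l) $ (j + 2)))"
  proof -
    have 0: "0 \<le> b - a" unfolding ab using lu'[of j] by simp
    have "emeasure lborel (({a<..<b} \<times> ({l $ (j + 1)<..<u $ (j + 1)} \<times> {l $ (j + 2)<..<u $ (j + 2)})))
       = emeasure (lborel \<Otimes>\<^sub>M lborel) ({a<..<b} \<times> ({l $ (j + 1)<..<u $ (j + 1)} \<times> {l $ (j + 2)<..<u $ (j + 2)}))"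
      unfolding lborel_prod ..
    also have "\<dots> = emeasure lborel {a<..<b} * emeasure (lborel \<Otimes>\<^sub>M lborel) ({l $ (j + 1)<..<u $ (j + 1)} \<times> {l $ (j + 2)<..<u $ (j + 2)})"
      unfolding lborel_prod[where ?'a = real and ?'b = real]
      by (rule lborel.emeasure_pair_measure_Times) (auto simp: borel_Times)
    also have "emeasure (lborel \<Otimes>\<^sub>M lborel) ({l $ (j + 1)<..<u $ (j + 1)} \<times> {l $ (j + 2)<..<u $ (j + 2)}) = emeasure lborel {l $ (j + 1)<..<u $ (j + 1)} * emeasure lborel {l $ (j + 2)<..<u $ (j + 2)}"
      by (rule lborel.emeasure_pair_measure_Times) auto
    finally show ?thesis using 0 lu' by (simp add: ennreal_mult[symmetric])
  qed
  also have "\<dots> = ennreal (\<Prod>b\<in>Basis. (u - l) \<bullet> b)"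
    unfolding prod_Basis_real3 prod_cyclic[of _ j] ab by simp
  finally show "emeasure (distr lborel borel (\<lambda>p. fpt j (s * fst p) (snd p))) (box l u) = ennreal (\<Prod>b\<in>Basis. (u - l) \<bullet> b)" .
qed simp

lemma borel_rectangle [measurable]: "{a..<b} \<times> {c..<d} \<in> sets (borel :: (real \<times> real) measure)"
  by (auto intro!: borel_Times)

lemma nn_integral_translate:
  fixes f :: "'a::euclidean_space \<Rightarrow> ennreal"
  assumes [measurable]: "f \<in> borel_measurable borel"
  shows "(\<integral>\<^sup>+x. f (c + x) \<partial>lborel) = (\<integral>\<^sup>+x. f x \<partial>lborel)"
  by (subst (2) lborel_distr_plus[of c, symmetric]) (simp add: nn_integral_distr)

lemma nn_integral_scale:
  fixes f :: "'a::euclidean_space \<Rightarrow> ennreal"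
  assumes [measurable]: "f \<in> borel_measurable borel" and "a \<noteq> 0"
  shows "(\<integral>\<^sup>+x. f x \<partial>lborel) = ennreal (\<bar>a\<bar> ^ DIM('a)) * (\<integral>\<^sup>+x. f (a *\<^sub>R x) \<partial>lborel)"
  by (subst lborel_affine[OF assms(2), of 0])
     (simp add: nn_integral_density nn_integral_distr nn_integral_cmult ennreal_power)

lemma fst_snd_borel [measurable]: 
  "fst \<in> borel_measurable (borel :: (real \<times> real \<times> real) measure)"
  "snd \<in> borel_measurable (borel :: (real \<times> real \<times> real) measure)"
  "fst \<in> borel_measurable (borel :: (real \<times> real) measure)"
  "snd \<in> borel_measurable (borel :: (real \<times> real) measure)"
  by (auto intro!: borel_measurable_continuous_onI continuous_intros)

lemma nn_integral_fpt:
  assumes f [measurable]: "f \<in> borel_measurable borel" and s: "s \<in> {-1, 1}"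
  shows "(\<integral>\<^sup>+x. f x \<partial>lborel) = (\<integral>\<^sup>+z. \<integral>\<^sup>+q. f (c + fpt j (s * z) q) \<partial>lborel \<partial>lborel)"
proof -
  have "(\<integral>\<^sup>+x. f x \<partial>lborel) = (\<integral>\<^sup>+x. f (c + x) \<partial>lborel)"
    by (simp add: nn_integral_translate)
  also have "\<dots> = (\<integral>\<^sup>+p. f (c + fpt j (s * fst p) (snd p)) \<partial>lborel)"
    by (subst lborel_fpt[OF s, of j, symmetric], subst nn_integral_distr) auto
  also have "\<dots> = (\<integral>\<^sup>+p. f (c + fpt j (s * fst p) (snd p)) \<partial>(lborel \<Otimes>\<^sub>M lborel))"
    unfolding lborel_prod ..
  also have "\<dots> = (\<integral>\<^sup>+z. \<integral>\<^sup>+q. f (c + fpt j (s * z) q) \<partial>lborel \<partial>lborel)"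
    by (subst lborel.nn_integral_fst[symmetric]) auto
  finally show ?thesis .
qed

text \<open>The pyramid with apex \<open>c\<close> over the face of outward normal \<open>s e\<^sub>j\<close> of the cube of half
  side \<open>r\<close> about \<open>c\<close>.\<close>

definition cone :: "real \<Rightarrow> real^3 \<Rightarrow> 3 \<Rightarrow> real \<Rightarrow> (real^3) set" where
  "cone r c j s = {x. 0 < s * (x - c) $ j \<and> s * (x - c) $ j < r \<and>
     ((x - c) $ (j + 1), (x - c) $ (j + 2)) \<in> face (s * (x - c) $ j)}"

lemma borel_nth [measurable]: "(\<lambda>x::real^3. x $ j) \<in> borel_measurable borel"
  by (auto intro!: borel_measurable_continuous_onI continuous_intros)

lemma cone_borel [measurable]: "cone r c j s \<in> sets borel"
proof -
  have "cone r c j s = {x\<in>space borel. 0 < s * (x - c) $ j \<and> s * (x - c) $ j < r \<and>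
     - (s * (x - c) $ j) \<le> (x - c) $ (j + 1) \<and> (x - c) $ (j + 1) < s * (x - c) $ j \<and>
     - (s * (x - c) $ j) \<le> (x - c) $ (j + 2) \<and> (x - c) $ (j + 2) < s * (x - c) $ j}"
    by (auto simp: cone_def)
  also have "\<dots> \<in> sets borel" by measurable
  finally show ?thesis .
qed

lemma cone_fpt:
  assumes s: "s \<in> {-1, 1}"
  shows "c + fpt j (s * z) q \<in> cone r c j s \<longleftrightarrow> 0 < z \<and> z < r \<and> q \<in> face z"
  using s by (cases q) (auto simp: cone_def)

section \<open>The radial extension from one face\<close>

text \<open>Polar coordinates for a pyramid: the slice at height \<open>t r\<close> is the face scaled by \<open>t\<close>, whence
  the Jacobian \<open>r t\<^sup>2\<close>. First the height and then the two face variables are rescaled.\<close>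

lemma nn_integral_cone:
  assumes f [measurable]: "f \<in> borel_measurable borel" and s: "s \<in> {-1, 1}" and r: "r > 0"
  shows "(\<integral>\<^sup>+x. indicator (cone r c j s) x * f x \<partial>lborel) =
    (\<integral>\<^sup>+t. \<integral>\<^sup>+u. ennreal (r * t\<^sup>2) * indicator ({0<..<1} \<times> face r) (t, u) * f (c + t *\<^sub>R fpt j (s * r) u) \<partial>lborel \<partial>lborel)"
proof -
  have "(\<integral>\<^sup>+x. indicator (cone r c j s) x * f x \<partial>lborel)
    = (\<integral>\<^sup>+z. \<integral>\<^sup>+q. indicator (cone r c j s) (c + fpt j (s * z) q) * f (c + fpt j (s * z) q) \<partial>lborel \<partial>lborel)"
    by (rule nn_integral_fpt[OF _ s]) measurable
  also have "\<dots> = ennreal \<bar>r\<bar> * (\<integral>\<^sup>+t. \<integral>\<^sup>+q. indicator (cone r c j s) (c + fpt j (s * (0 + r * t)) q) * f (c + fpt j (s * (0 + r * t)) q) \<partial>lborel \<partial>lborel)"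
    by (rule nn_integral_real_affine, measurable) (use r in simp)
  also have "\<dots> = (\<integral>\<^sup>+t. ennreal r * \<integral>\<^sup>+q. indicator (cone r c j s) (c + fpt j (s * (r * t)) q) * f (c + fpt j (s * (r * t)) q) \<partial>lborel \<partial>lborel)"
    using r by (subst nn_integral_cmult) auto
  also have "\<dots> = (\<integral>\<^sup>+t. \<integral>\<^sup>+u. ennreal (r * t\<^sup>2) * indicator ({0<..<1} \<times> face r) (t, u) * f (c + t *\<^sub>R fpt j (s * r) u) \<partial>lborel \<partial>lborel)"
  proof (intro nn_integral_cong)
    fix t :: real
    show "ennreal r * (\<integral>\<^sup>+q. indicator (cone r c j s) (c + fpt j (s * (r * t)) q) * f (c + fpt j (s * (r * t)) q) \<partial>lborel)
      = (\<integral>\<^sup>+u. ennreal (r * t\<^sup>2) * indicator ({0<..<1} \<times> face r) (t, u) * f (c + t *\<^sub>R fpt j (s * r) u) \<partial>lborel)"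
    proof (cases "0 < t \<and> t < 1")
      case False
      then have "\<not> (0 < r * t \<and> r * t < r)" using r by (simp add: zero_less_mult_iff)
      then have "indicator (cone r c j s) (c + fpt j (s * (r * t)) q) = (0::ennreal)" for q
        by (auto simp: cone_fpt[OF s] indicator_def)
      moreover have "indicator ({0<..<1} \<times> face r) (t, u) = (0::ennreal)" for u
        using False by (auto simp: indicator_def)
      ultimately show ?thesis by simp
    next
      case True
      have "(\<integral>\<^sup>+q. indicator (cone r c j s) (c + fpt j (s * (r * t)) q) * f (c + fpt j (s * (r * t)) q) \<partial>lborel)
        = ennreal (\<bar>t\<bar> ^ DIM(real \<times> real)) * (\<integral>\<^sup>+u. indicator (cone r c j s) (c + fpt j (s * (r * t)) (t *\<^sub>R u)) * f (c + fpt j (s * (r * t)) (t *\<^sub>R u)) \<partial>lborel)"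
        by (rule nn_integral_scale, measurable) (use True in simp)
      also have "\<dots> = ennreal (t\<^sup>2) * (\<integral>\<^sup>+u. indicator (face r) u * f (c + t *\<^sub>R fpt j (s * r) u) \<partial>lborel)"
      proof -
        have "indicator (cone r c j s) (c + fpt j (s * (r * t)) (t *\<^sub>R u)) = (indicator (face r) u :: ennreal)" for u
        proof -
          have m: "- (r * t) \<le> t * y \<longleftrightarrow> - r \<le> y" "t * y < r * t \<longleftrightarrow> y < r" for y
          proof -
            have "- (r * t) = t * (- r)" "r * t = t * r" by simp_all
            then show "- (r * t) \<le> t * y \<longleftrightarrow> - r \<le> y" "t * y < r * t \<longleftrightarrow> y < r" 
              using True by (simp_all only: mult_le_cancel_left_pos mult_less_cancel_left_pos)
          qed
          show ?thesis using True r by (cases u) (simp add: indicator_def cone_fpt[OF s] m)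
        qed
        then show ?thesis by (simp add: scaleR_fpt mult_ac power2_eq_square)
      qed
      finally show ?thesis using True r 
        by (simp add: indicator_times mult.assoc[symmetric] ennreal_mult[symmetric] nn_integral_cmult)
          (simp add: mult.assoc nn_integral_cmult)
    qed
  qed
  finally show ?thesis .
qed

text \<open>The field that is radial about \<open>c\<close>, homogeneous of degree \<open>-2\<close>, and has outward normal
  component \<open>b\<close> on the face; its value along a ray is given by \<open>cone_field_ray\<close>.\<close>

definition cone_field :: "real \<Rightarrow> real^3 \<Rightarrow> 3 \<Rightarrow> real \<Rightarrow> (real \<times> real \<Rightarrow> real) \<Rightarrow> real^3 \<Rightarrow> real^3" where
  "cone_field r c j s b x = (let d = s * (x - c) $ j in
     indicator (cone r c j s) x *\<^sub>R
     ((b ((r / d) *\<^sub>R ((x - c) $ (j + 1), (x - c) $ (j + 2))) * r\<^sup>2 / d ^ 3) *\<^sub>R (x - c)))"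

lemma cone_field_borel [measurable]:
  assumes [measurable]: "b \<in> borel_measurable borel"
  shows "cone_field r c j s b \<in> borel_measurable borel"
  unfolding cone_field_def Let_def by measurable

lemma cone_field_ray:
  assumes s: "s \<in> {-1, 1}" and r: "r > 0" and t: "0 < t" "t < 1" and u: "u \<in> face r"
  shows "cone_field r c j s b (c + t *\<^sub>R fpt j (s * r) u) = (b u / (r * t\<^sup>2)) *\<^sub>R fpt j (s * r) u"
proof -
  have ss: "s * (s * x) = x" for x using s by auto
  have mem: "c + fpt j (s * (t * r)) (t *\<^sub>R u) \<in> cone r c j s"
  proof -
    have "- (t * r) \<le> t * y \<longleftrightarrow> - r \<le> y" "t * y < t * r \<longleftrightarrow> y < r" for y
      using t mult_le_cancel_left_pos[of t "-r" y] by simp_all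
    then show ?thesis unfolding cone_fpt[OF s] using t r u by (cases u) auto
  qed
  have eq: "t *\<^sub>R fpt j (s * r) u = fpt j (s * (t * r)) (t *\<^sub>R u)"
    by (simp add: scaleR_fpt mult_ac)
  have "cone_field r c j s b (c + t *\<^sub>R fpt j (s * r) u) = (b ((r / (t * r)) *\<^sub>R t *\<^sub>R u) * r\<^sup>2 / (t * r) ^ 3) *\<^sub>R t *\<^sub>R fpt j (s * r) u"
    using mem unfolding cone_field_def eq Let_def by (cases u) (simp add: ss)
  also have "\<dots> = (b u / (r * t\<^sup>2)) *\<^sub>R fpt j (s * r) u"
    using t r by (simp add: field_simps power2_eq_square power3_eq_cube)
  finally show ?thesis .
qed

lemma norm_fpt_le:
  assumes "\<bar>z\<bar> \<le> r" "q \<in> face r"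
  shows "norm (fpt j z q) \<le> 2 * r"
proof -
  have "norm (fpt j z q) ^ 2 = z\<^sup>2 + (fst q)\<^sup>2 + (snd q)\<^sup>2"
    unfolding power2_norm_eq_inner inner_vec_def sum_cyclic[of _ j] by (simp add: power2_eq_square)
  also have "\<dots> \<le> r\<^sup>2 + r\<^sup>2 + r\<^sup>2"
  proof -
    have r: "0 \<le> r" using assms(1) by linarith
    have "\<bar>fst q\<bar> \<le> r" "\<bar>snd q\<bar> \<le> r" using assms(2) by (cases q, auto)+
    with assms(1) r show ?thesis by (intro add_mono) (auto intro!: abs_le_square_iff[THEN iffD1])
  qed
  also have "\<dots> \<le> (2 * r)\<^sup>2" by (simp add: power2_eq_square)
  finally have "(norm (fpt j z q))\<^sup>2 \<le> (2 * r)\<^sup>2" .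
  moreover have "0 \<le> 2 * r" using assms(1) by linarith
  ultimately show ?thesis by (rule power2_le_imp_le)
qed

lemma nn_integral_powr_unit:
  assumes a: "a > -1"
  shows "(\<integral>\<^sup>+t. ennreal (t powr a) * indicator {0<..<1} t \<partial>lborel) = ennreal (1 / (a + 1))"
proof -
  have "((\<lambda>t. t powr a) has_integral (1 powr (a + 1) / (a + 1))) {0..1}"
    using has_integral_powr_from_0[OF a, of 1] by simp
  then have "((\<lambda>t. t powr a) has_integral (1 / (a + 1))) {0<..<1}"
    using has_integral_Icc_iff_Ioo[of "\<lambda>t. t powr a" "1 / (a + 1)" 0 1] by simp
  then have "((\<lambda>t. (t powr a) * indicator {0<..<1} t) has_integral (1 / (a + 1))) UNIV"
    by (subst (asm) has_integral_restrict_UNIV[symmetric]) (simp add: indicator_def of_bool_def if_distrib cong: if_cong)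
  then have "(\<integral>\<^sup>+t. ennreal ((t powr a) * indicator {0<..<1} t) \<partial>lborel) = ennreal (1 / (a + 1))"
    by (intro nn_integral_has_integral_lborel) auto
  then show ?thesis by (simp add: ennreal_mult' ennreal_indicator)
qed

text \<open>In polar coordinates the integrand is at most \<open>(2 |b|)\<^sup>p t\<close> to the power \<open>-2 p\<close>, and with the
  Jacobian \<open>t\<^sup>2\<close> this is integrable at the apex because \<open>2 - 2 p > -1\<close>. This is where the
  exponent \<open>3/2\<close> comes from.\<close>

lemma cone_energy:
  assumes p: "1 \<le> p" "p < 3/2" and s: "s \<in> {-1, 1}" and r: "r > 0"
    and b [measurable]: "b \<in> borel_measurable borel"
  shows "(Lp_int p (\<lambda>x. cone_field r c j s b x))
     \<le> ennreal (r * 2 powr p / (3 - 2 * p)) * (\<integral>\<^sup>+u. ennreal (\<bar>b u\<bar> powr p) * indicator (face r) u \<partial>lborel)"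
proof -
  have "(Lp_int p (\<lambda>x. cone_field r c j s b x)) =
    (Lp_int_on (cone r c j s) p (\<lambda>x. cone_field r c j s b x))"
    by (intro nn_integral_cong) (auto simp: cone_field_def Let_def indicator_def)
  also have "\<dots> = (\<integral>\<^sup>+t. \<integral>\<^sup>+u. ennreal (r * t\<^sup>2) * indicator ({0<..<1} \<times> face r) (t, u) * ennreal (norm (cone_field r c j s b (c + t *\<^sub>R fpt j (s * r) u)) powr p) \<partial>lborel \<partial>lborel)"
    by (rule nn_integral_cone[OF _ s r]) measurable
  also have "\<dots> \<le> (\<integral>\<^sup>+t. \<integral>\<^sup>+u. (ennreal (r * 2 powr p) * (ennreal (t powr (2 - 2 * p)) * indicator {0<..<1} t)) * (ennreal (\<bar>b u\<bar> powr p) * indicator (face r) u) \<partial>lborel \<partial>lborel)"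
  proof (intro nn_integral_mono)
    fix t :: real and u :: "real \<times> real"
    show "ennreal (r * t\<^sup>2) * indicator ({0<..<1} \<times> face r) (t, u) * ennreal (norm (cone_field r c j s b (c + t *\<^sub>R fpt j (s * r) u)) powr p)
      \<le> (ennreal (r * 2 powr p) * (ennreal (t powr (2 - 2 * p)) * indicator {0<..<1} t)) * (ennreal (\<bar>b u\<bar> powr p) * indicator (face r) u)"
    proof (cases "t \<in> {0<..<1} \<and> u \<in> face r")
      case True
      then have t: "0 < t" "t < 1" and u: "u \<in> face r" by auto
      have "norm (cone_field r c j s b (c + t *\<^sub>R fpt j (s * r) u)) = \<bar>b u\<bar> / (r * t\<^sup>2) * norm (fpt j (s * r) u)"
        unfolding cone_field_ray[OF s r t u] using r by simp
      also have "\<dots> \<le> \<bar>b u\<bar> / (r * t\<^sup>2) * (2 * r)"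
        using r s u by (intro mult_left_mono norm_fpt_le) auto
      also have "\<dots> = 2 * \<bar>b u\<bar> * (t powr (-2))"
        using r t by (simp add: powr_minus powr_numeral field_simps)
      finally have "norm (cone_field r c j s b (c + t *\<^sub>R fpt j (s * r) u)) powr p \<le> (2 * \<bar>b u\<bar> * (t powr (-2))) powr p"
        using p by (intro powr_mono2) auto
      also have "\<dots> = 2 powr p * \<bar>b u\<bar> powr p * t powr (-2 * p)"
        using t by (simp add: powr_mult powr_powr)
      finally have "(r * t\<^sup>2) * norm (cone_field r c j s b (c + t *\<^sub>R fpt j (s * r) u)) powr p \<le> (r * t\<^sup>2) * (2 powr p * \<bar>b u\<bar> powr p * t powr (-2 * p))"
        using r by (intro mult_left_mono) auto
      also have "\<dots> = r * 2 powr p * t powr (2 - 2 * p) * \<bar>b u\<bar> powr p"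
      proof -
        have "t powr (2 - 2 * p) = t\<^sup>2 * t powr (-2 * p)"
          using t powr_add[of t 2 "-2*p"] by (simp add: powr_numeral)
        then show ?thesis by simp
      qed
      finally show ?thesis using True r
        by (simp add: ennreal_mult[symmetric])
    qed (auto simp: indicator_def)
  qed
  also have "\<dots> = (\<integral>\<^sup>+t. (ennreal (r * 2 powr p) * (ennreal (t powr (2 - 2 * p)) * indicator {0<..<1} t)) * (\<integral>\<^sup>+u. ennreal (\<bar>b u\<bar> powr p) * indicator (face r) u \<partial>lborel) \<partial>lborel)"
    by (intro nn_integral_cong nn_integral_cmult) (auto simp: borel_Times)
  also have "\<dots> = ennreal (r * 2 powr p) * ennreal (1 / (2 - 2 * p + 1)) * (\<integral>\<^sup>+u. ennreal (\<bar>b u\<bar> powr p) * indicator (face r) u \<partial>lborel)"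
    using p by (simp add: nn_integral_multc nn_integral_cmult nn_integral_powr_unit)
  also have "ennreal (r * 2 powr p) * ennreal (1 / (2 - 2 * p + 1)) = ennreal (r * 2 powr p / (3 - 2 * p))"
    using p r by (subst ennreal_mult[symmetric]) (auto intro!: arg_cong[where f = ennreal])
  finally show ?thesis .
qed

text \<open>Test functions of class \<open>C\<^sup>1\<close>, given together with their gradient.\<close>

definition has_gradient :: "(real^3 \<Rightarrow> real) \<Rightarrow> (real^3 \<Rightarrow> real^3) \<Rightarrow> bool" where
  "has_gradient \<phi> G \<longleftrightarrow> (\<forall>x. (\<phi> has_derivative (\<lambda>h. G x \<bullet> h)) (at x)) \<and> continuous_on UNIV G"

lemma has_gradient_continuous: "has_gradient \<phi> G \<Longrightarrow> continuous_on UNIV \<phi>"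
  unfolding has_gradient_def
  by (meson continuous_at_imp_continuous_on has_derivative_continuous)

lemma has_gradient_borel: assumes "has_gradient \<phi> G"
  shows "\<phi> \<in> borel_measurable borel" "G \<in> borel_measurable borel"
  using assms has_gradient_continuous[OF assms]
  by (auto simp: has_gradient_def intro: borel_measurable_continuous_onI)

lemma has_gradient_ray:
  assumes "has_gradient \<phi> G"
  shows "((\<lambda>t. \<phi> (c + t *\<^sub>R y)) has_real_derivative (y \<bullet> G (c + t *\<^sub>R y))) (at t within S)"
proof -
  have d: "(\<phi> has_derivative (\<lambda>h. G (c + t *\<^sub>R y) \<bullet> h)) (at (c + t *\<^sub>R y))"
    using assms by (auto simp: has_gradient_def)
  have "((\<lambda>t. c + t *\<^sub>R y) has_derivative (\<lambda>h. h *\<^sub>R y)) (at t within S)"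
    by (auto intro!: derivative_eq_intros)
  from diff_chain_within[OF this has_derivative_at_withinI[OF d]]
  show ?thesis
    by (simp only: has_field_derivative_def o_def inner_commute[of y] inner_scaleR_right mult_commute_abs)
qed

lemma has_gradient_FTC:
  assumes "has_gradient \<phi> G" and "a \<le> b"
  shows "(\<integral>t. indicator {a..b} t * (y \<bullet> G (c + t *\<^sub>R y)) \<partial>lborel) = \<phi> (c + b *\<^sub>R y) - \<phi> (c + a *\<^sub>R y)"
    and "integrable lborel (\<lambda>t. indicator {a..b} t * (y \<bullet> G (c + t *\<^sub>R y)))"
proof -
  have c: "continuous_on {a..b} (\<lambda>t. y \<bullet> G (c + t *\<^sub>R y))"
    using assms(1) unfolding has_gradient_def
    by (auto intro!: continuous_intros intro: continuous_on_compose2[of UNIV G])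
  have "integral\<^sup>L lborel (\<lambda>t. indicator {a..b} t *\<^sub>R (y \<bullet> G (c + t *\<^sub>R y))) = \<phi> (c + b *\<^sub>R y) - \<phi> (c + a *\<^sub>R y)"
    by (rule integral_FTC_atLeastAtMost[OF assms(2) _ c])
      (use has_gradient_ray[OF assms(1)] in \<open>auto simp: has_real_derivative_iff_has_vector_derivative\<close>)
  then show "(\<integral>t. indicator {a..b} t * (y \<bullet> G (c + t *\<^sub>R y)) \<partial>lborel) = \<phi> (c + b *\<^sub>R y) - \<phi> (c + a *\<^sub>R y)"
    by simp
  have "set_integrable lborel {a..b} (\<lambda>t. y \<bullet> G (c + t *\<^sub>R y))"
    by (rule borel_integrable_atLeastAtMost') (rule c)
  then show "integrable lborel (\<lambda>t. indicator {a..b} t * (y \<bullet> G (c + t *\<^sub>R y)))"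
    by (simp add: set_integrable_def)
qed

text \<open>The polar coordinate formula as an equality of measures, which carries it over to integrals of
  functions of both signs.\<close>

lemma cone_measure:
  assumes s: "s \<in> {-1, 1}" and r: "r > 0"
  shows "density lborel (\<lambda>x. ennreal (indicator (cone r c j s) x)) =
    distr (density (lborel \<Otimes>\<^sub>M lborel) (\<lambda>p. ennreal (r * (fst p)\<^sup>2 * indicator ({0<..<1} \<times> face r) p))) borel
      (\<lambda>p. c + fst p *\<^sub>R fpt j (s * r) (snd p))" (is "?L = distr (density ?M ?w) borel ?T")
proof (rule measure_eqI)
  show "sets ?L = sets (distr (density ?M ?w) borel ?T)" by simp
  fix A assume "A \<in> sets ?L"
  then have A [measurable]: "A \<in> sets borel" by simp
  have sets_eq: "sets (lborel \<Otimes>\<^sub>M lborel :: (real \<times> real \<times> real) measure) = sets borel"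
    by (simp only: lborel_prod sets_lborel)
  have [measurable]: "{0<..<1} \<times> face r \<in> sets (borel :: (real \<times> real \<times> real) measure)"
    by (auto intro!: borel_Times)
  have w [measurable]: "?w \<in> borel_measurable ?M" 
    unfolding measurable_cong_sets[OF sets_eq refl] by measurable
  have T [measurable]: "?T \<in> measurable ?M borel"
    unfolding measurable_cong_sets[OF sets_eq refl] by measurable
  have "emeasure ?L A = (\<integral>\<^sup>+x. indicator (cone r c j s) x * indicator A x \<partial>lborel)"
    by (simp add: emeasure_density ennreal_indicator)
  also have "\<dots> = (\<integral>\<^sup>+t. \<integral>\<^sup>+u. ennreal (r * t\<^sup>2) * indicator ({0<..<1} \<times> face r) (t, u) * indicator A (c + t *\<^sub>R fpt j (s * r) u) \<partial>lborel \<partial>lborel)"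
    by (rule nn_integral_cone[OF _ s r]) measurable
  also have "\<dots> = (\<integral>\<^sup>+t. \<integral>\<^sup>+u. (\<lambda>p. ?w p * indicator A (?T p)) (t, u) \<partial>lborel \<partial>lborel)"
    using r by (intro nn_integral_cong) (auto simp: indicator_def)
  also have "\<dots> = (\<integral>\<^sup>+p. ?w p * indicator A (?T p) \<partial>?M)"
    by (rule lborel.nn_integral_fst) measurable
  also have "\<dots> = (\<integral>\<^sup>+p. ?w p * indicator (?T -` A \<inter> space ?M) p \<partial>?M)"
    by (intro nn_integral_cong) (auto simp: indicator_def)
  also have "\<dots> = emeasure (density ?M ?w) (?T -` A \<inter> space ?M)"
    by (rule emeasure_density[symmetric]) measurable
  also have "\<dots> = emeasure (distr (density ?M ?w) borel ?T) A"
    by (subst emeasure_distr) auto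
  finally show "emeasure ?L A = emeasure (distr (density ?M ?w) borel ?T) A" .
qed

text \<open>The Jacobian \<open>t\<^sup>2\<close> cancels the factor \<open>t\<close> to the power \<open>-2\<close> of the field, so that along each
  ray the derivative of \<open>t \<mapsto> \<phi> (c + t Y)\<close> is integrated. This leaves the face and the apex
  as the only places where the field has divergence.\<close>

lemma cone_divergence:
  assumes s: "s \<in> {-1, 1}" and r: "r > 0"
    and b [measurable]: "b \<in> borel_measurable borel"
    and bi: "integrable lborel (\<lambda>u. indicator (face r) u * b u)"
    and g: "has_gradient \<phi> G"
  shows "integrable lborel (\<lambda>x. cone_field r c j s b x \<bullet> G x)"
    and "(\<integral>x. cone_field r c j s b x \<bullet> G x \<partial>lborel) =
      (\<integral>u. indicator (face r) u * b u * (\<phi> (c + fpt j (s * r) u) - \<phi> c) \<partial>lborel)"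
proof -
  let ?M = "lborel \<Otimes>\<^sub>M lborel :: (real \<times> real \<times> real) measure"
  let ?T = "\<lambda>p. c + fst p *\<^sub>R fpt j (s * r) (snd p)"
  let ?w = "\<lambda>p. r * (fst p)\<^sup>2 * indicator ({0<..<1} \<times> face r) p"
  let ?h = "\<lambda>x. cone_field r c j s b x \<bullet> G x"
  let ?k = "\<lambda>p. indicator ({0<..<1} \<times> face r) p * (b (snd p) * (fpt j (s * r) (snd p) \<bullet> G (?T p)))"
  note [measurable] = has_gradient_borel[OF g]
  have sets_eq: "sets ?M = sets borel" by (simp only: lborel_prod sets_lborel)
  have R [measurable]: "{0<..<1} \<times> face r \<in> sets (borel :: (real \<times> real \<times> real) measure)"
    by (auto intro!: borel_Times)
  have w [measurable]: "?w \<in> borel_measurable ?M" 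
    unfolding measurable_cong_sets[OF sets_eq refl] by measurable
  have T [measurable]: "?T \<in> measurable ?M borel"
    unfolding measurable_cong_sets[OF sets_eq refl] by measurable
  have k: "?k \<in> borel_measurable ?M"
    unfolding measurable_cong_sets[OF sets_eq refl] by measurable
  have h [measurable]: "?h \<in> borel_measurable borel" by measurable
  then have h': "?h \<in> borel_measurable lborel" by simp
  have wk: "?w p *\<^sub>R ?h (?T p) = ?k p" for p
  proof (cases "p \<in> {0<..<1} \<times> face r")
    case True
    then have "0 < fst p" "fst p < 1" "snd p \<in> face r" by auto
    then show ?thesis using r True by (simp add: cone_field_ray[OF s r])
  qed simp
  have ind: "?h x = indicator (cone r c j s) x *\<^sub>R ?h x" for x
    by (auto simp: cone_field_def Let_def indicator_def)
  have "bounded (G ` cball c (2 * r))"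
    using g by (auto simp: has_gradient_def intro!: compact_imp_bounded compact_continuous_image intro: continuous_on_subset)
  then obtain B where B: "\<And>x. x \<in> cball c (2 * r) \<Longrightarrow> norm (G x) \<le> B"
    by (auto simp: bounded_iff simp del: mem_cball)
  have B0: "B \<ge> 0" using order_trans[OF norm_ge_zero B[of c]] r by simp
  have bnd: "norm (?k p) \<le> indicator {0<..<1} (fst p) * (2 * r * B * \<bar>indicator (face r) (snd p) * b (snd p)\<bar>)" for p
  proof (cases "p \<in> {0<..<1} \<times> face r")
    case True
    then have p: "0 < fst p" "fst p < 1" "snd p \<in> face r" by auto
    have Y: "norm (fpt j (s * r) (snd p)) \<le> 2 * r" using s r p by (intro norm_fpt_le) auto
    have "norm (fst p *\<^sub>R fpt j (s * r) (snd p)) \<le> 1 * (2 * r)"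
      using p Y unfolding norm_scaleR by (intro mult_mono) auto
    then have "norm (G (?T p)) \<le> B" by (intro B) (simp add: dist_norm)
    then have "\<bar>fpt j (s * r) (snd p) \<bullet> G (?T p)\<bar> \<le> (2 * r) * B"
      using Y B0 r by (intro order_trans[OF Cauchy_Schwarz_ineq2] mult_mono) auto
    then show ?thesis using True p
      by (simp add: abs_mult mult.commute[of _ "\<bar>b (snd p)\<bar>"] mult_left_mono)
  qed (use B0 r in simp)
  have ik: "integrable ?M ?k"
  proof (rule integrableI_bounded[OF k])
    have "(\<integral>\<^sup>+p. norm (?k p) \<partial>?M) \<le> (\<integral>\<^sup>+p. ennreal (indicator {0<..<1} (fst p) * (2 * r * B * \<bar>indicator (face r) (snd p) * b (snd p)\<bar>)) \<partial>?M)"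
      using bnd by (intro nn_integral_mono ennreal_leI) 
    also have "\<dots> = (\<integral>\<^sup>+t. \<integral>\<^sup>+u. ennreal (indicator {0<..<1::real} t * (2 * r * B * \<bar>indicator (face r) u * b u\<bar>)) \<partial>lborel \<partial>lborel)"
      by (subst lborel.nn_integral_fst[symmetric]) auto
    also have "\<dots> = (\<integral>\<^sup>+t. indicator {0<..<1::real} t * (\<integral>\<^sup>+u. ennreal (2 * r * B) * ennreal (norm (indicator (face r) u * b u)) \<partial>lborel) \<partial>lborel)"
      using B0 r by (intro nn_integral_cong) (auto simp: indicator_def ennreal_mult' split: if_splits)
    also have "\<dots> = (\<integral>\<^sup>+u. ennreal (2 * r * B) * ennreal (norm (indicator (face r) u * b u)) \<partial>lborel)"
      by (subst nn_integral_multc) (auto simp: nn_integral_indicator)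
    also have "\<dots> = ennreal (2 * r * B) * (\<integral>\<^sup>+u. ennreal (norm (indicator (face r) u * b u)) \<partial>lborel)"
      by (rule nn_integral_cmult) measurable
    also have "\<dots> < \<infinity>"
      using bi unfolding integrable_iff_bounded by (auto simp: ennreal_mult_less_top)
    finally show "(\<integral>\<^sup>+p. norm (?k p) \<partial>?M) < \<infinity>" .
  qed
  have r0: "AE p in ?M. 0 \<le> ?w p" using r by (auto simp: indicator_def)
  have c0: "AE x in lborel. 0 \<le> (indicator (cone r c j s) x :: real)" by auto
  have "integrable (density ?M (\<lambda>p. ennreal (?w p))) (\<lambda>p. ?h (?T p))"
    by (subst integrable_density[OF _ w r0]) (simp_all only: wk ik, measurable)
  then have "integrable (density lborel (\<lambda>x. ennreal (indicator (cone r c j s) x))) ?h"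
    unfolding cone_measure[OF s r] by (subst integrable_distr_eq) auto
  then show "integrable lborel ?h"
    by (subst (asm) integrable_density[OF h' _ c0]) (simp_all only: ind[symmetric], measurable)
  have "integral\<^sup>L lborel ?h = integral\<^sup>L (density lborel (\<lambda>x. ennreal (indicator (cone r c j s) x))) ?h"
    by (subst integral_density[OF h' _ c0]) (simp_all only: ind[symmetric], measurable)
  also have "\<dots> = integral\<^sup>L (density ?M (\<lambda>p. ennreal (?w p))) (\<lambda>p. ?h (?T p))"
    unfolding cone_measure[OF s r] by (subst integral_distr) auto
  also have "\<dots> = integral\<^sup>L ?M ?k"
    by (subst integral_density[OF _ w r0]) (simp_all only: wk, measurable)
  also have "\<dots> = (\<integral>u. \<integral>t. ?k (t, u) \<partial>lborel \<partial>lborel)"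
    using lborel_pair.integral_snd[of "\<lambda>t u. ?k (t, u)"] ik by (simp add: case_prod_beta')
  also have "\<dots> = (\<integral>u. indicator (face r) u * b u * (\<phi> (c + fpt j (s * r) u) - \<phi> c) \<partial>lborel)"
  proof (intro Bochner_Integration.integral_cong refl)
    fix u :: "real \<times> real"
    let ?Y = "fpt j (s * r) u"
    have "(\<integral>t. ?k (t, u) \<partial>lborel) = (\<integral>t. (indicator (face r) u * b u) * (indicator {0<..<1} t * (?Y \<bullet> G (c + t *\<^sub>R ?Y))) \<partial>lborel)"
      by (intro Bochner_Integration.integral_cong refl) (auto simp: indicator_def)
    also have "\<dots> = (indicator (face r) u * b u) * (\<integral>t. indicator {0<..<1} t * (?Y \<bullet> G (c + t *\<^sub>R ?Y)) \<partial>lborel)"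
      by simp
    also have "(\<integral>t. indicator {0<..<1} t * (?Y \<bullet> G (c + t *\<^sub>R ?Y)) \<partial>lborel) = (\<integral>t. indicator {0..1} t * (?Y \<bullet> G (c + t *\<^sub>R ?Y)) \<partial>lborel)"
    proof (rule integral_cong_AE)
      show "AE t in lborel. indicator {0<..<1} t * (?Y \<bullet> G (c + t *\<^sub>R ?Y)) = indicator {0..1} t * (?Y \<bullet> G (c + t *\<^sub>R ?Y))"
        using AE_lborel_singleton[of "0::real"] AE_lborel_singleton[of "1::real"]
        by eventually_elim (auto simp: indicator_def)
    qed measurable
    also have "\<dots> = \<phi> (c + ?Y) - \<phi> c"
      using has_gradient_FTC(1)[OF g, of 0 1 ?Y c] by simp
    finally show "(\<integral>t. ?k (t, u) \<partial>lborel) = indicator (face r) u * b u * (\<phi> (c + fpt j (s * r) u) - \<phi> c)" .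
  qed
  finally show "integral\<^sup>L lborel ?h = (\<integral>u. indicator (face r) u * b u * (\<phi> (c + fpt j (s * r) u) - \<phi> c) \<partial>lborel)" .
qed

section \<open>The radial extension over a cube\<close>

definition halfcube :: "real \<Rightarrow> real^3 \<Rightarrow> (real^3) set" where
  "halfcube r c = {x. \<forall>i. - r \<le> (x - c) $ i \<and> (x - c) $ i < r}"

text \<open>On each face the normal component of \<open>X - X c\<close> is extended radially; the constant \<open>X c\<close> makes
  up for the subtraction. The field vanishes outside the cube, so that fields of different cubes of a
  grid may be added.\<close>

definition cube_field :: "real \<Rightarrow> (real^3 \<Rightarrow> real^3) \<Rightarrow> real^3 \<Rightarrow> real^3 \<Rightarrow> real^3" where
  "cube_field r X c x = indicator (halfcube r c) x *\<^sub>R X c +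
     (face_sum (\<lambda>j s. cone_field r c j s (\<lambda>u. s * (X (c + fpt j (s * r) u) $ j - X c $ j)) x))"

definition cube_outflow :: "real \<Rightarrow> (real^3 \<Rightarrow> real^3) \<Rightarrow> real^3 \<Rightarrow> real" where
  "cube_outflow r X c = (face_sum (\<lambda>j s. s * (face_int r (\<lambda>u. X (c + fpt j (s * r) u) $ j))))"

lemma borel_fpt_shift [measurable]: "(\<lambda>u. c + fpt j z u) \<in> borel_measurable (borel :: (real \<times> real) measure)"
  by measurable

lemma halfcube_borel [measurable]: "halfcube r c \<in> sets borel"
proof -
  have "halfcube r c = {x\<in>space borel. \<forall>i\<in>(UNIV::3 set). - r \<le> (x - c) $ i \<and> (x - c) $ i < r}"
    by (auto simp: halfcube_def)
  also have "\<dots> \<in> sets borel" by measurable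
  finally show ?thesis .
qed

lemma halfcube_fpt: "c + fpt j z u \<in> halfcube r c \<longleftrightarrow> - r \<le> z \<and> z < r \<and> u \<in> face r"
  unfolding halfcube_def all_cyclic[of _ j] mem_Collect_eq by (cases u) auto

lemma halfcube_subset: "box (c - (\<chi> i. r)) (c + (\<chi> i. r)) \<subseteq> halfcube r c" "halfcube r c \<subseteq> cbox (c - (\<chi> i. r)) (c + (\<chi> i. r))"
  by (auto simp: halfcube_def mem_box_cart) (smt (verit))+

lemma cone_subset_halfcube: "s \<in> {-1, 1} \<Longrightarrow> cone r c j s \<subseteq> halfcube r c"
proof
  fix x assume s: "s \<in> {-1, 1}" and x: "x \<in> cone r c j s"
  show "x \<in> halfcube r c"
    using s x unfolding halfcube_def all_cyclic[of _ j] mem_Collect_eq cone_def by auto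
qed

lemma cube_field_borel [measurable]:
  assumes [measurable]: "X \<in> borel_measurable borel"
  shows "cube_field r X c \<in> borel_measurable borel"
  unfolding cube_field_def by measurable

lemma cube_field_outside: "x \<notin> halfcube r c \<Longrightarrow> cube_field r X c x = 0"
  using cone_subset_halfcube[of _ r c] 
  by (auto simp: cube_field_def cone_field_def Let_def indicator_def sum_cyclic[of _ 1])

lemma integral_fpt:
  assumes f: "integrable lborel f"
  shows "(\<integral>x. f x \<partial>lborel) = (\<integral>u. \<integral>z. f (c + fpt j z u) \<partial>lborel \<partial>lborel :: real)"
proof -
  let ?M = "lborel \<Otimes>\<^sub>M lborel :: (real \<times> real \<times> real) measure"
  let ?T = "\<lambda>p. c + fpt j (fst p) (snd p)"
  have f' [measurable]: "f \<in> borel_measurable borel" using f by simp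
  have sets_eq: "sets ?M = sets borel" by (simp only: lborel_prod sets_lborel)
  have T [measurable]: "?T \<in> measurable ?M borel"
    unfolding measurable_cong_sets[OF sets_eq refl] by measurable
  have L: "lborel = distr ?M borel ?T"
  proof -
    have "(lborel :: (real^3) measure) = distr lborel borel ((+) c)"
      by (rule lborel_distr_plus[symmetric])
    also have "\<dots> = distr (distr ?M borel (\<lambda>p. fpt j (1 * fst p) (snd p))) borel ((+) c)"
      by (subst lborel_fpt[of 1 j, symmetric]) (simp_all only: lborel_prod insert_iff simp_thms)
    also have "\<dots> = distr ?M borel (((+) c) \<circ> (\<lambda>p. fpt j (1 * fst p) (snd p)))"
      by (rule distr_distr) (simp, unfold measurable_cong_sets[OF sets_eq refl], measurable)
    finally show ?thesis by (simp add: o_def)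
  qed
  have i: "integrable ?M (\<lambda>p. f (?T p))"
    using f by (subst (asm) L, subst (asm) integrable_distr_eq) auto
  have "(\<integral>x. f x \<partial>lborel) = (\<integral>p. f (?T p) \<partial>?M)"
    by (subst L, subst integral_distr) auto
  also have "\<dots> = (\<integral>u. \<integral>z. f (c + fpt j z u) \<partial>lborel \<partial>lborel)"
    using lborel_pair.integral_snd[of "\<lambda>z u. f (?T (z, u))"] i by (simp add: case_prod_beta')
  finally show ?thesis .
qed

lemma integrable_indicator_mult_continuous:
  fixes f :: "'a::euclidean_space \<Rightarrow> real"
  assumes [measurable]: "A \<in> sets borel" and A: "bounded A" and f: "continuous_on UNIV f"
  shows "integrable lborel (\<lambda>x. indicator A x * f x)"
proof -
  have [measurable]: "f \<in> borel_measurable borel" using f by (rule borel_measurable_continuous_onI)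
  obtain a where "A \<subseteq> cbox (-a) a" using A bounded_subset_cbox_symmetric by blast
  then show ?thesis
    by (intro Bochner_Integration.integrable_bound[OF borel_integrable_compact[of "cbox (-a) a" f]])
       (auto simp: indicator_def intro: continuous_on_subset[OF f])
qed

lemma bounded_face: "bounded (face r)"
  by (intro bounded_Times) (auto intro: bounded_subset[of "{-r..r}"])

lemma bounded_halfcube: "bounded (halfcube r c)"
  using halfcube_subset(2) bounded_cbox bounded_subset by blast

lemma has_gradient_nth_continuous:
  "has_gradient \<phi> G \<Longrightarrow> continuous_on UNIV (\<lambda>x. G x $ j)"
  unfolding has_gradient_def by (auto intro!: continuous_intros)

lemma continuous_on_face:
  assumes "continuous_on UNIV \<phi>" shows "continuous_on UNIV (\<lambda>u. \<phi> (c + fpt j z u) :: real)"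
  by (rule continuous_on_compose2[OF assms]) (auto intro!: continuous_intros)

text \<open>The divergence theorem for a constant field, one coordinate direction at a time.\<close>

lemma halfcube_divergence_coord:
  assumes g: "has_gradient \<phi> G" and r: "r > 0"
  shows "(\<integral>x. indicator (halfcube r c) x * G x $ j \<partial>lborel) =
    (\<Sum>s\<in>{-1, 1}. s * (face_int r (\<lambda>u. \<phi> (c + fpt j (s * r) u))))"
proof -
  note [measurable] = has_gradient_borel[OF g]
  note c\<phi> = has_gradient_continuous[OF g]
  have "(\<integral>x. indicator (halfcube r c) x * G x $ j \<partial>lborel) = 
    (\<integral>u. \<integral>z. indicator (halfcube r c) (c + fpt j z u) * G (c + fpt j z u) $ j \<partial>lborel \<partial>lborel)"
    by (rule integral_fpt) (intro integrable_indicator_mult_continuous has_gradient_nth_continuous[OF g] bounded_halfcube halfcube_borel)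
  also have "\<dots> = (\<integral>u. indicator (face r) u * \<phi> (c + fpt j r u) - indicator (face r) u * \<phi> (c + fpt j (-r) u) \<partial>lborel)"
  proof (intro Bochner_Integration.integral_cong refl)
    fix u :: "real \<times> real"
    let ?Y = "axis j 1 :: real^3"
    have eq: "c + fpt j 0 u + z *\<^sub>R ?Y = c + fpt j z u" for z
      by (simp add: vec_eq_iff all_cyclic[of _ j]) (simp add: axis_def)
    have "(\<integral>z. indicator (halfcube r c) (c + fpt j z u) * G (c + fpt j z u) $ j \<partial>lborel)
       = (\<integral>z. indicator (face r) u * (indicator {-r..r} z * (?Y \<bullet> G (c + fpt j 0 u + z *\<^sub>R ?Y))) \<partial>lborel)"
    proof (rule integral_cong_AE)
      show "AE z in lborel. indicator (halfcube r c) (c + fpt j z u) * G (c + fpt j z u) $ j = indicator (face r) u * (indicator {-r..r} z * (?Y \<bullet> G (c + fpt j 0 u + z *\<^sub>R ?Y)))"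
        using AE_lborel_singleton[of r] unfolding eq
        by eventually_elim (auto simp: indicator_def halfcube_fpt inner_axis inner_commute[of "axis j 1"])
    qed measurable
    also have "\<dots> = indicator (face r) u * (\<integral>z. indicator {-r..r} z * (?Y \<bullet> G (c + fpt j 0 u + z *\<^sub>R ?Y)) \<partial>lborel)"
      by simp
    also have "\<dots> = indicator (face r) u * (\<phi> (c + fpt j r u) - \<phi> (c + fpt j (-r) u))"
      using has_gradient_FTC(1)[OF g, of "-r" r ?Y "c + fpt j 0 u"] r unfolding eq by simp
    finally show "(\<integral>z. indicator (halfcube r c) (c + fpt j z u) * G (c + fpt j z u) $ j \<partial>lborel) = indicator (face r) u * \<phi> (c + fpt j r u) - indicator (face r) u * \<phi> (c + fpt j (-r) u)"
      by (simp add: right_diff_distrib)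
  qed
  also have "\<dots> = (face_int r (\<lambda>u. \<phi> (c + fpt j r u))) - (face_int r (\<lambda>u. \<phi> (c + fpt j (-r) u)))"
    by (intro Bochner_Integration.integral_diff integrable_indicator_mult_continuous continuous_on_face c\<phi> bounded_face borel_rectangle)
  finally show ?thesis by simp
qed

lemma integrable_mult_continuous_face:
  assumes i: "integrable lborel (\<lambda>u. indicator (face r) u * h u)" and \<phi>: "continuous_on UNIV \<phi>"
  shows "integrable lborel (\<lambda>u. indicator (face r) u * (h u * (\<phi> (u :: real \<times> real) :: real)))"
proof -
  have [measurable]: "\<phi> \<in> borel_measurable borel" using \<phi> by (rule borel_measurable_continuous_onI)
  note [measurable] = borel_measurable_integrable[OF i]
  obtain a where a: "face r \<subseteq> cbox (-a) a" using bounded_face bounded_subset_cbox_symmetric by blast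
  have "bounded (\<phi> ` cbox (-a) a)"
    by (intro compact_imp_bounded compact_continuous_image continuous_on_subset[OF \<phi>]) auto
  then obtain B where B: "\<And>x. x \<in> cbox (-a) a \<Longrightarrow> \<bar>\<phi> x\<bar> \<le> B"
    unfolding bounded_iff by fastforce
  have "integrable lborel (\<lambda>u. (indicator (face r) u * h u) * \<phi> u)"
  proof (rule Bochner_Integration.integrable_bound[OF integrable_mult_left[OF i, of B]])
    show "AE x in lborel. norm ((indicator (face r) x * h x) * \<phi> x) \<le> norm ((indicator (face r) x * h x) * B)"
    proof (intro AE_I2)
      fix u :: "real \<times> real"
      have "indicator (face r) u * \<bar>\<phi> u\<bar> \<le> \<bar>B\<bar>"
        using B[of u] a by (auto simp: indicator_def)
      then show "norm ((indicator (face r) u * h u) * \<phi> u) \<le> norm ((indicator (face r) u * h u) * B)"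
        using mult_left_mono[OF \<open>indicator (face r) u * \<bar>\<phi> u\<bar> \<le> \<bar>B\<bar>\<close>, of "\<bar>h u\<bar>"]
        by (auto simp: abs_mult indicator_def)
    qed
  qed measurable
  then show ?thesis by (simp add: mult.assoc)
qed

text \<open>Adding the contributions of the constant field and of the six pyramids: the terms with \<open>X c\<close>
  cancel on the boundary, and at the centre they cancel between opposite faces.\<close>

lemma cube_divergence:
  assumes r: "r > 0" and X [measurable]: "X \<in> borel_measurable borel"
    and i: "\<And>j s. s \<in> {-1, 1} \<Longrightarrow> integrable lborel (\<lambda>u. indicator (face r) u * X (c + fpt j (s * r) u) $ j)"
    and g: "has_gradient \<phi> G"
  shows "integrable lborel (\<lambda>x. cube_field r X c x \<bullet> G x)"
    and "(\<integral>x. cube_field r X c x \<bullet> G x \<partial>lborel) =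
      (face_sum (\<lambda>j s. s * (face_int r (\<lambda>u. X (c + fpt j (s * r) u) $ j * \<phi> (c + fpt j (s * r) u)))))
       - \<phi> c * cube_outflow r X c"
proof -
  note [measurable] = has_gradient_borel[OF g]
  note c\<phi> = has_gradient_continuous[OF g]
  let ?b = "\<lambda>j s u. s * (X (c + fpt j (s * r) u) $ j - X c $ j)"
  have one: "integrable lborel (\<lambda>u. indicator (face r) u * (k::real))" for k
    by (intro integrable_indicator_mult_continuous) (auto intro: bounded_face)
  have phi: "integrable lborel (\<lambda>u. indicator (face r) u * \<phi> (c + fpt j z u))" for j z
    by (intro integrable_indicator_mult_continuous continuous_on_face c\<phi> bounded_face) auto
  have ib: "integrable lborel (\<lambda>u. indicator (face r) u * ?b j s u)" if "s \<in> {-1, 1}" for j s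
  proof -
    have "integrable lborel (\<lambda>u. s * (indicator (face r) u * X (c + fpt j (s * r) u) $ j) - indicator (face r) u * (s * X c $ j))"
      by (intro Bochner_Integration.integrable_diff integrable_mult_right i that one)
    then show ?thesis by (simp add: algebra_simps)
  qed
  have ip: "integrable lborel (\<lambda>u. indicator (face r) u * (X (c + fpt j (s * r) u) $ j * \<phi> (c + fpt j (s * r) u)))" 
    if "s \<in> {-1, 1}" for j s
    by (intro integrable_mult_continuous_face i that continuous_on_face c\<phi>)
  have const_i: "integrable lborel (\<lambda>x. indicator (halfcube r c) x * G x $ j)" for j
    by (intro integrable_indicator_mult_continuous has_gradient_nth_continuous[OF g] bounded_halfcube halfcube_borel)
  have const_eq: "indicator (halfcube r c) x *\<^sub>R X c \<bullet> G x = (\<Sum>j\<in>UNIV. X c $ j * (indicator (halfcube r c) x * G x $ j))" for x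
    by (simp add: inner_vec_def sum_distrib_left mult_ac)
  have ci: "integrable lborel (\<lambda>x. indicator (halfcube r c) x *\<^sub>R X c \<bullet> G x)"
    unfolding const_eq by (intro Bochner_Integration.integrable_sum integrable_mult_right const_i)
  have eq: "cube_field r X c x \<bullet> G x = indicator (halfcube r c) x *\<^sub>R X c \<bullet> G x +
      (face_sum (\<lambda>j s. cone_field r c j s (?b j s) x \<bullet> G x))" for x
    unfolding cube_field_def inner_add_left inner_sum_left ..
  have co: "integrable lborel (\<lambda>x. cone_field r c j s (?b j s) x \<bullet> G x)" if "s \<in> {-1, 1}" for j s
    by (rule cone_divergence(1)[OF that r _ ib[OF that] g]) measurable
  have S: "integrable lborel (\<lambda>x. \<Sum>j\<in>UNIV. \<Sum>s\<in>{-1, 1}. cone_field r c j s (?b j s) x \<bullet> G x)"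
    by (intro Bochner_Integration.integrable_sum co)
  show "integrable lborel (\<lambda>x. cube_field r X c x \<bullet> G x)"
    unfolding eq by (intro Bochner_Integration.integrable_add ci S)
  define P where "P j s = (face_int r (\<lambda>u. X (c + fpt j (s * r) u) $ j * \<phi> (c + fpt j (s * r) u)))" for j s
  define Q where "Q j s = (face_int r (\<lambda>u. \<phi> (c + fpt j (s * r) u)))" for j s
  define R where "R j s = (face_int r (\<lambda>u. X (c + fpt j (s * r) u) $ j))" for j s
  define A where "A = (\<integral>u. indicator (face r) u * (1::real) \<partial>(lborel :: (real \<times> real) measure))"
  have cone: "(\<integral>x. cone_field r c j s (?b j s) x \<bullet> G x \<partial>lborel) = s * P j s - s * X c $ j * Q j s - \<phi> c * (s * R j s) + \<phi> c * s * X c $ j * A"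
    if s: "s \<in> {-1, 1}" for j s
  proof -
    have "(\<integral>x. cone_field r c j s (?b j s) x \<bullet> G x \<partial>lborel) = (\<integral>u. indicator (face r) u * ?b j s u * (\<phi> (c + fpt j (s * r) u) - \<phi> c) \<partial>lborel)"
      by (rule cone_divergence(2)[OF s r _ ib[OF s] g]) measurable
    also have "\<dots> = (\<integral>u. s * (indicator (face r) u * (X (c + fpt j (s * r) u) $ j * \<phi> (c + fpt j (s * r) u)))
        - s * X c $ j * (indicator (face r) u * \<phi> (c + fpt j (s * r) u)) - \<phi> c * s * (indicator (face r) u * X (c + fpt j (s * r) u) $ j)
        + \<phi> c * s * X c $ j * (indicator (face r) u * 1) \<partial>lborel)"
      by (intro Bochner_Integration.integral_cong refl) (simp add: algebra_simps)
    also have "\<dots> = s * P j s - s * X c $ j * Q j s - \<phi> c * s * R j s + \<phi> c * s * X c $ j * A"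
      unfolding P_def Q_def R_def A_def using ip[OF s] phi i[OF s] one[of 1]
      by (simp del: mult_1_right)
    finally show ?thesis by simp
  qed
  have "(\<integral>x. cube_field r X c x \<bullet> G x \<partial>lborel) = (\<integral>x. indicator (halfcube r c) x *\<^sub>R X c \<bullet> G x \<partial>lborel) +
     (face_sum (\<lambda>j s. (\<integral>x. cone_field r c j s (?b j s) x \<bullet> G x \<partial>lborel)))"
    unfolding eq Bochner_Integration.integral_add[OF ci S]
    by (subst Bochner_Integration.integral_sum, intro Bochner_Integration.integrable_sum co, assumption)
       (subst Bochner_Integration.integral_sum, intro co, auto)
  also have "(\<integral>x. indicator (halfcube r c) x *\<^sub>R X c \<bullet> G x \<partial>lborel) = (\<Sum>j\<in>UNIV. X c $ j * (\<Sum>s\<in>{-1, 1}. s * Q j s))"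
    unfolding const_eq by (subst Bochner_Integration.integral_sum)
      (auto simp only: integral_mult_right_zero halfcube_divergence_coord[OF g r] Q_def intro!: integrable_mult_right const_i)
  also have "(face_sum (\<lambda>j s. (\<integral>x. cone_field r c j s (?b j s) x \<bullet> G x \<partial>lborel))) = 
     (face_sum (\<lambda>j s. s * P j s - s * X c $ j * Q j s - \<phi> c * (s * R j s) + \<phi> c * s * X c $ j * A))"
    by (intro sum.cong refl cone)
  finally show "(\<integral>x. cube_field r X c x \<bullet> G x \<partial>lborel) =
      (face_sum (\<lambda>j s. s * (face_int r (\<lambda>u. X (c + fpt j (s * r) u) $ j * \<phi> (c + fpt j (s * r) u)))))
       - \<phi> c * cube_outflow r X c"
    unfolding cube_outflow_def P_def[symmetric] R_def[symmetric]
    by (simp add: sum_cyclic[of _ 1] algebra_simps)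
qed

section \<open>The error on a cube and its average over the position of the cube\<close>

lemma sum_powr_le:
  fixes a :: "'i \<Rightarrow> real"
  assumes I: "finite I" and p: "0 \<le> p" and a: "\<And>i. i \<in> I \<Longrightarrow> 0 \<le> a i"
  shows "(\<Sum>i\<in>I. a i) powr p \<le> real (card I) powr p * (\<Sum>i\<in>I. a i powr p)"
proof (cases "I = {}")
  case False
  define M where "M = Max (a ` I)"
  have M: "a i \<le> M" if "i \<in> I" for i using that I by (simp add: M_def)
  have "M \<in> a ` I" unfolding M_def using I False by (intro Max_in) auto
  then obtain k where k: "k \<in> I" "M = a k" by blast
  have "(\<Sum>i\<in>I. a i) powr p \<le> (real (card I) * M) powr p"
    using M a p by (intro powr_mono2 sum_bounded_above sum_nonneg) auto
  also have "\<dots> = real (card I) powr p * a k powr p"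
    using a k by (simp add: powr_mult)
  also have "\<dots> \<le> real (card I) powr p * (\<Sum>i\<in>I. a i powr p)"
    using k I by (intro mult_left_mono member_le_sum) auto
  finally show ?thesis .
qed simp

lemma norm_add_powr_le:
  fixes x y :: "'a::real_normed_vector"
  assumes p: "0 \<le> p"
  shows "norm (x + y) powr p \<le> 2 powr p * (norm x powr p + norm y powr p)"
proof -
  have "norm (x + y) powr p \<le> (norm x + norm y) powr p"
    using p by (intro powr_mono2 norm_triangle_ineq) auto
  also have "\<dots> \<le> 2 powr p * (norm x powr p + norm y powr p)"
    using sum_powr_le[of "{False, True}" p "\<lambda>i. if i then norm x else norm y"] p by (simp add: add.commute)
  finally show ?thesis .
qed

lemma nn_integral_combination_sum:
  fixes a b :: ennreal
  assumes [measurable]: "f \<in> borel_measurable M" "\<And>i. V i \<in> borel_measurable M"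
  shows "(\<integral>\<^sup>+x. a * f x + b * (\<Sum>i\<in>I. V i x) \<partial>M) = a * (\<integral>\<^sup>+x. f x \<partial>M) + b * (\<Sum>i\<in>I. \<integral>\<^sup>+x. V i x \<partial>M)"
  by (simp add: nn_integral_add nn_integral_cmult nn_integral_sum)

text \<open>The boundary term carries the factor \<open>r\<close> because then it scales like the volume term.\<close>

definition cube_energy :: "(real \<Rightarrow> real) \<Rightarrow> real \<Rightarrow> (real^3 \<Rightarrow> real^3) \<Rightarrow> real^3 \<Rightarrow> ennreal" where
  "cube_energy \<Phi> r X c = (\<integral>\<^sup>+w. indicator (halfcube r 0) w * ennreal (\<Phi> (norm (X (c + w) - X c))) \<partial>lborel) +
     ennreal r * (face_sum (\<lambda>j s. \<integral>\<^sup>+u. indicator (face r) u * ennreal (\<Phi> (norm (X (c + fpt j (s * r) u) - X c))) \<partial>lborel))"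

lemma halfcube_translate: "c + w \<in> halfcube r c \<longleftrightarrow> w \<in> halfcube r 0"
  by (simp add: halfcube_def)

text \<open>On the cube the error is the sum of \<open>X c - X\<close> and of six radial fields, which \<open>cone_energy\<close>
  estimates by their values on the faces.\<close>

lemma cube_field_energy:
  assumes p: "1 \<le> p" "p < 3/2"
  shows "\<exists>C>0. \<forall>r>0. \<forall>c X. X \<in> borel_measurable borel \<longrightarrow>
    (Lp_int_on (halfcube r c) p (\<lambda>x. cube_field r X c x - X x))
      \<le> ennreal C * cube_energy (\<lambda>t. t powr p) r X c"
proof -
  define K where "K = 2 powr p / (3 - 2 * p)"
  have K0: "K > 0" using p by (simp add: K_def)
  define C where "C = 2 powr p * (1 + 6 powr p * K)"
  have C0: "C > 0" using K0 by (auto simp: C_def intro!: mult_pos_pos add_pos_nonneg)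
  have "(Lp_int_on (halfcube r c) p (\<lambda>x. cube_field r X c x - X x))
      \<le> ennreal C * cube_energy (\<lambda>t. t powr p) r X c" if r: "r > 0" and X [measurable]: "X \<in> borel_measurable borel" for r c X
  proof -
    let ?J = "UNIV \<times> {-1, 1} :: (3 \<times> real) set"
    let ?b = "\<lambda>j s u. s * (X (c + fpt j (s * r) u) $ j - X c $ j)"
    let ?V = "\<lambda>i x. cone_field r c (fst i) (snd i) (?b (fst i) (snd i)) x"
    have point: "indicator (halfcube r c) x * ennreal (norm (cube_field r X c x - X x) powr p)
       \<le> ennreal (2 powr p) * (indicator (halfcube r c) x * ennreal (norm (X x - X c) powr p)) + 
         ennreal (2 powr p * 6 powr p) * (\<Sum>i\<in>?J. ennreal (norm (?V i x) powr p))" for x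
    proof (cases "x \<in> halfcube r c")
      case True
      have eq: "cube_field r X c x - X x = (\<Sum>i\<in>?J. ?V i x) + (X c - X x)"
        using True by (simp only: cube_field_def sum.cartesian_product case_prod_beta' indicator_simps scaleR_one) simp
      have "norm (\<Sum>i\<in>?J. ?V i x) powr p \<le> (\<Sum>i\<in>?J. norm (?V i x)) powr p"
        using p by (intro powr_mono2 norm_sum) auto
      also have "\<dots> \<le> 6 powr p * (\<Sum>i\<in>?J. norm (?V i x) powr p)"
        using sum_powr_le[of ?J p "\<lambda>i. norm (?V i x)"] p by (simp add: card_cartesian_product)
      finally have 1: "norm (\<Sum>i\<in>?J. ?V i x) powr p \<le> 6 powr p * (\<Sum>i\<in>?J. norm (?V i x) powr p)" .
      have "norm (cube_field r X c x - X x) powr p \<le> 2 powr p * (norm (\<Sum>i\<in>?J. ?V i x) powr p + norm (X c - X x) powr p)"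
        unfolding eq using p by (intro norm_add_powr_le) auto
      also have "\<dots> \<le> 2 powr p * (6 powr p * (\<Sum>i\<in>?J. norm (?V i x) powr p) + norm (X c - X x) powr p)"
        using 1 by (intro mult_left_mono add_mono) auto
      also have "\<dots> = 2 powr p * norm (X x - X c) powr p + 2 powr p * 6 powr p * (\<Sum>i\<in>?J. norm (?V i x) powr p)"
        by (simp add: algebra_simps norm_minus_commute)
      finally have "ennreal (norm (cube_field r X c x - X x) powr p) \<le> ennreal (2 powr p * norm (X x - X c) powr p + 2 powr p * 6 powr p * (\<Sum>i\<in>?J. norm (?V i x) powr p))"
        by (rule ennreal_leI)
      also have "\<dots> = ennreal (2 powr p) * ennreal (norm (X x - X c) powr p) + ennreal (2 powr p * 6 powr p) * (\<Sum>i\<in>?J. ennreal (norm (?V i x) powr p))"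
        by (subst ennreal_plus) (auto simp: ennreal_mult' sum_nonneg simp flip: sum_ennreal)
      finally show ?thesis using True by simp
    qed simp
    have cone: "(Lp_int p (\<lambda>x. ?V (j, s) x))
       \<le> ennreal K * (ennreal r * (Lp_int_on (face r) p (\<lambda>u. X (c + fpt j (s * r) u) - X c)))"
      if s: "s \<in> {-1, 1}" for j s
    proof -
      have "(Lp_int p (\<lambda>x. ?V (j, s) x)) \<le> ennreal (r * 2 powr p / (3 - 2 * p)) * (\<integral>\<^sup>+u. ennreal (\<bar>?b j s u\<bar> powr p) * indicator (face r) u \<partial>lborel)"
        unfolding fst_conv snd_conv by (rule cone_energy[OF p s r]) measurable
      also have "(\<integral>\<^sup>+u. ennreal (\<bar>?b j s u\<bar> powr p) * indicator (face r) u \<partial>lborel) \<le> (Lp_int_on (face r) p (\<lambda>u. X (c + fpt j (s * r) u) - X c))"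
      proof (intro nn_integral_mono)
        fix u
        have "\<bar>?b j s u\<bar> \<le> norm (X (c + fpt j (s * r) u) - X c)"
          using s component_le_norm_cart[of "X (c + fpt j (s * r) u) - X c" j] by (auto simp: abs_mult)
        then show "ennreal (\<bar>?b j s u\<bar> powr p) * indicator (face r) u \<le> indicator (face r) u * ennreal (norm (X (c + fpt j (s * r) u) - X c) powr p)"
          using p by (auto simp: indicator_def intro!: ennreal_leI powr_mono2)
      qed
      also have "ennreal (r * 2 powr p / (3 - 2 * p)) = ennreal K * ennreal r"
        using r K0 by (subst ennreal_mult[symmetric]) (auto simp: K_def mult_ac)
      finally show ?thesis by (simp add: mult.assoc mult_left_mono)
    qed
    have cone': "(Lp_int p (\<lambda>x. ?V i x))
       \<le> ennreal K * (ennreal r * (Lp_int_on (face r) p (\<lambda>u. X (c + fpt (fst i) (snd i * r) u) - X c)))"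
      if "i \<in> ?J" for i
      using that cone[of "snd i" "fst i"] by (simp only: mem_Times_iff fst_conv snd_conv)
    have "(Lp_int_on (halfcube r c) p (\<lambda>x. cube_field r X c x - X x))
      \<le> (\<integral>\<^sup>+x. ennreal (2 powr p) * (indicator (halfcube r c) x * ennreal (norm (X x - X c) powr p)) + 
         ennreal (2 powr p * 6 powr p) * (\<Sum>i\<in>?J. ennreal (norm (?V i x) powr p)) \<partial>lborel)"
      by (intro nn_integral_mono point)
    also have "\<dots> = ennreal (2 powr p) * (Lp_int_on (halfcube r c) p (\<lambda>x. X x - X c)) + 
         ennreal (2 powr p * 6 powr p) * (\<Sum>i\<in>?J. \<integral>\<^sup>+x. ennreal (norm (?V i x) powr p) \<partial>lborel)"
      by (rule nn_integral_combination_sum) measurable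
    also have "\<dots> \<le> ennreal (2 powr p) * (Lp_int_on (halfcube r c) p (\<lambda>x. X x - X c)) + 
         ennreal (2 powr p * 6 powr p) * (\<Sum>i\<in>?J. ennreal K * (ennreal r * (Lp_int_on (face r) p (\<lambda>u. X (c + fpt (fst i) (snd i * r) u) - X c))))"
      by (intro add_mono mult_left_mono sum_mono order_refl cone' zero_le)
    also have "(Lp_int_on (halfcube r c) p (\<lambda>x. X x - X c)) = (Lp_int_on (halfcube r 0) p (\<lambda>w. X (c + w) - X c))"
      by (subst nn_integral_translate[of _ c, symmetric], measurable) (simp add: indicator_def halfcube_translate)
    also have "(\<Sum>i\<in>?J. ennreal K * (ennreal r * (Lp_int_on (face r) p (\<lambda>u. X (c + fpt (fst i) (snd i * r) u) - X c))))
       = ennreal K * (ennreal r * (face_sum (\<lambda>j s. \<integral>\<^sup>+u. indicator (face r) u * ennreal (norm (X (c + fpt j (s * r) u) - X c) powr p) \<partial>lborel)))"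
      by (simp only: sum_distrib_left[symmetric] sum.cartesian_product case_prod_beta')
    also have "ennreal (2 powr p) * (Lp_int_on (halfcube r 0) p (\<lambda>w. X (c + w) - X c)) + ennreal (2 powr p * 6 powr p) * \<dots>
       \<le> ennreal C * cube_energy (\<lambda>t. t powr p) r X c"
    proof -
      have "ennreal (2 powr p) \<le> ennreal C" using K0 by (intro ennreal_leI) (simp add: C_def)
      moreover have "ennreal (2 powr p * 6 powr p) * ennreal K \<le> ennreal C"
        using K0 by (subst ennreal_mult[symmetric]) (auto simp: C_def algebra_simps intro!: ennreal_leI)
      ultimately show ?thesis unfolding cube_energy_def
        by (auto simp: distrib_left mult.assoc[symmetric] intro!: add_mono mult_right_mono)
    qed
    finally show ?thesis .
  qed
  with C0 show ?thesis by blast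
qed

lemma norm_halfcube0: "w \<in> halfcube r 0 \<Longrightarrow> norm w \<le> 2 * r"
  using norm_fpt_le[of "w $ 1" r "(w $ 2, w $ 3)" 1] fpt_cases[of w 1]
  by (simp add: halfcube_def) (smt (verit))

lemma emeasure_halfcube:
  assumes r: "r > 0"
  shows "emeasure lborel (halfcube r c) = ennreal (8 * r ^ 3)"
proof -
  let ?v = "\<chi> i. r :: real^3"
  have le: "(c - ?v) \<bullet> b \<le> (c + ?v) \<bullet> b" if "b \<in> Basis" for b
    using that r by (auto simp: Basis_vec_def inner_axis)
  have pr: "(\<Prod>b\<in>Basis. ((c + ?v) - (c - ?v)) \<bullet> b) = 8 * r ^ 3"
    unfolding prod_Basis_real3 prod_cyclic[of _ 1] by (simp add: power3_eq_cube)
  have "emeasure lborel (halfcube r c) \<le> emeasure lborel (cbox (c - ?v) (c + ?v))"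
    by (intro emeasure_mono halfcube_subset) auto
  also have "\<dots> = ennreal (8 * r ^ 3)" using le pr by (subst emeasure_lborel_cbox) auto
  finally have 1: "emeasure lborel (halfcube r c) \<le> ennreal (8 * r ^ 3)" .
  have "ennreal (8 * r ^ 3) = emeasure lborel (box (c - ?v) (c + ?v))"
    using le pr by (subst emeasure_lborel_box) auto
  also have "\<dots> \<le> emeasure lborel (halfcube r c)"
    by (intro emeasure_mono halfcube_subset) auto
  finally show ?thesis using 1 by (rule antisym[rotated])
qed

lemma emeasure_face: "r > 0 \<Longrightarrow> emeasure lborel (face r) = ennreal (4 * r\<^sup>2)"
  unfolding lborel_prod[symmetric] 
  by (subst lborel.emeasure_pair_measure_Times) (auto simp: ennreal_mult[symmetric] power2_eq_square)

lemma cube_energy_borel [measurable]: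
  assumes [measurable]: "X \<in> borel_measurable borel" "\<Phi> \<in> borel_measurable borel"
  shows "cube_energy \<Phi> r X \<in> borel_measurable borel"
proof -
  have "(\<lambda>c. \<integral>\<^sup>+w. indicator (halfcube r 0) w * ennreal (\<Phi> (norm (X (c + w) - X c))) \<partial>lborel) \<in> borel_measurable lborel"
    by (rule lborel.borel_measurable_nn_integral) measurable
  moreover have "(\<lambda>c. \<integral>\<^sup>+u. indicator (face r) u * ennreal (\<Phi> (norm (X (c + fpt j (s * r) u) - X c))) \<partial>lborel) \<in> borel_measurable lborel" for j s
    by (rule lborel.borel_measurable_nn_integral) measurable
  ultimately show ?thesis
    unfolding cube_energy_def[abs_def] by simp
qed

text \<open>Every point that enters \<open>cube_energy\<close> has the form \<open>c + w\<close> with \<open>|w| \<le> 2 r\<close>. Integrating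
  over \<open>c\<close> first, each \<open>w\<close> contributes at most \<open>m\<close>; the cube has volume \<open>8 r\<^sup>3\<close> and the six
  faces, weighted by \<open>r\<close>, count for \<open>24 r\<^sup>3\<close>.\<close>

lemma cube_energy_average:
  assumes X [measurable]: "X \<in> borel_measurable borel" and \<Phi> [measurable]: "\<Phi> \<in> borel_measurable borel" and r: "r > 0"
    and m: "\<And>w. norm w \<le> 2 * r \<Longrightarrow> (\<integral>\<^sup>+x. ennreal (\<Phi> (norm (X (x + w) - X x))) \<partial>lborel) \<le> m"
  shows "(\<integral>\<^sup>+c. cube_energy \<Phi> r X c \<partial>lborel) \<le> ennreal (32 * r ^ 3) * m"
proof -
  have 1: "(\<integral>\<^sup>+c. \<integral>\<^sup>+w. indicator A w * ennreal (\<Phi> (norm (X (c + T w) - X c))) \<partial>lborel \<partial>lborel) \<le> m * emeasure lborel A"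
    if A [measurable]: "A \<in> sets borel" and T [measurable]: "T \<in> borel_measurable borel" and w: "\<And>w. w \<in> A \<Longrightarrow> norm (T w) \<le> 2 * r" 
    for A :: "'b::euclidean_space set" and T
  proof -
    have "(\<integral>\<^sup>+c. \<integral>\<^sup>+w. indicator A w * ennreal (\<Phi> (norm (X (c + T w) - X c))) \<partial>lborel \<partial>lborel)
      = (\<integral>\<^sup>+w. \<integral>\<^sup>+c. indicator A w * ennreal (\<Phi> (norm (X (c + T w) - X c))) \<partial>lborel \<partial>lborel)"
      by (rule lborel_pair.Fubini') measurable
    also have "\<dots> \<le> (\<integral>\<^sup>+w. m * indicator A w \<partial>lborel)"
      using w m by (intro nn_integral_mono) (auto simp: indicator_def)
    finally show ?thesis by (simp add: nn_integral_cmult)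
  qed
  have 2: "(\<integral>\<^sup>+c. \<integral>\<^sup>+w. indicator (halfcube r 0) w * ennreal (\<Phi> (norm (X (c + w) - X c))) \<partial>lborel \<partial>lborel) \<le> m * ennreal (8 * r ^ 3)"
    using 1[of "halfcube r 0" "\<lambda>w. w"] norm_halfcube0 emeasure_halfcube[OF r] by simp
  have 3: "(\<integral>\<^sup>+c. \<integral>\<^sup>+u. indicator (face r) u * ennreal (\<Phi> (norm (X (c + fpt j (s * r) u) - X c))) \<partial>lborel \<partial>lborel) \<le> m * ennreal (4 * r\<^sup>2)"
    if s: "s \<in> {-1, 1}" for j s
    using 1[of "face r" "\<lambda>u. fpt j (s * r) u"] norm_fpt_le[of "s * r" r _ j] emeasure_face[OF r] s r by auto
  have M1 [measurable]: "(\<lambda>c. \<integral>\<^sup>+w. indicator (halfcube r 0) w * ennreal (\<Phi> (norm (X (c + w) - X c))) \<partial>lborel) \<in> borel_measurable borel"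
    using lborel.borel_measurable_nn_integral[of "\<lambda>c w. indicator (halfcube r 0) w * ennreal (\<Phi> (norm (X (c + w) - X c)))" lborel] by simp
  have M2 [measurable]: "(\<lambda>c. \<integral>\<^sup>+u. indicator (face r) u * ennreal (\<Phi> (norm (X (c + fpt j (s * r) u) - X c))) \<partial>lborel) \<in> borel_measurable borel" for j s
    using lborel.borel_measurable_nn_integral[of "\<lambda>c u. indicator (face r) u * ennreal (\<Phi> (norm (X (c + fpt j (s * r) u) - X c)))" lborel] by simp
  have "(\<integral>\<^sup>+c. cube_energy \<Phi> r X c \<partial>lborel) = 
     (\<integral>\<^sup>+c. \<integral>\<^sup>+w. indicator (halfcube r 0) w * ennreal (\<Phi> (norm (X (c + w) - X c))) \<partial>lborel \<partial>lborel) +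
     ennreal r * (face_sum (\<lambda>j s. \<integral>\<^sup>+c. \<integral>\<^sup>+u. indicator (face r) u * ennreal (\<Phi> (norm (X (c + fpt j (s * r) u) - X c))) \<partial>lborel \<partial>lborel))"
    unfolding cube_energy_def
    by (subst nn_integral_add, simp, simp, subst nn_integral_cmult, simp, subst nn_integral_sum, simp, subst nn_integral_sum, simp, simp)
  also have "\<dots> \<le> m * ennreal (8 * r ^ 3) + ennreal r * (\<Sum>j\<in>(UNIV::3 set). \<Sum>s\<in>{-1, 1::real}. m * ennreal (4 * r\<^sup>2))"
    using r by (intro add_mono mult_left_mono sum_mono 2 3) auto
  also have "\<dots> = m * (ennreal (8 * r ^ 3) + ennreal r * (6 * ennreal (4 * r\<^sup>2)))"
    by (simp add: distrib_left mult_ac)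
  also have "ennreal (8 * r ^ 3) + ennreal r * (6 * ennreal (4 * r\<^sup>2)) = ennreal (32 * r ^ 3)"
  proof -
    have "ennreal r * (6 * ennreal (4 * r\<^sup>2)) = ennreal (r * (6 * (4 * r\<^sup>2)))"
      using r by (subst ennreal_mult) (auto simp: ennreal_mult)
    then show ?thesis using r by (simp add: ennreal_plus[symmetric] power2_eq_square power3_eq_cube del: ennreal_plus)
  qed
  finally show ?thesis by (simp add: mult.commute)
qed

section \<open>Translations and dilations in the spaces of p-integrable fields\<close>

text \<open>Truncation makes \<open>X\<close> bounded. A bounded measurable function is almost everywhere a limit of
  continuous functions, and after projection onto the ball of the truncation these converge dominatedly.\<close>

lemma Lp_continuous_approximation:
  fixes X :: "'a::euclidean_space \<Rightarrow> 'b::euclidean_space"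
  assumes X [measurable]: "X \<in> borel_measurable borel" and p: "p > 0"
    and Xp: "(Lp_int p X) < \<infinity>"
    and D [measurable]: "D \<in> sets borel" and Df: "emeasure lborel D < \<infinity>" and \<delta>: "\<delta> > 0"
  shows "\<exists>g. continuous_on UNIV g \<and> (Lp_int_on D p (\<lambda>x. X x - g x)) \<le> ennreal \<delta>"
proof -
  define \<delta>1 where "\<delta>1 = \<delta> / (2 * 2 powr p)"
  have \<delta>1: "\<delta>1 > 0" using \<delta> by (simp add: \<delta>1_def)
  have "(\<lambda>k. \<integral>\<^sup>+x. indicator {x. norm (X x) > real k} x * ennreal (norm (X x) powr p) \<partial>lborel) \<longlonglongrightarrow> (\<integral>\<^sup>+x. 0 \<partial>(lborel :: 'a measure))"
  proof (rule nn_integral_dominated_convergence[where w = "\<lambda>x. ennreal (norm (X x) powr p)"])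
    show "AE x in lborel. (\<lambda>k. indicator {x. norm (X x) > real k} x * ennreal (norm (X x) powr p)) \<longlonglongrightarrow> 0"
    proof (intro AE_I2)
      fix x
      have "eventually (\<lambda>k. norm (X x) \<le> real k) sequentially"
        by (meson eventually_sequentiallyI nle_le of_nat_mono order_trans real_arch_simple)
      then have "eventually (\<lambda>k. indicator {x. norm (X x) > real k} x * ennreal (norm (X x) powr p) = 0) sequentially"
        by eventually_elim auto
      then show "(\<lambda>k. indicator {x. norm (X x) > real k} x * ennreal (norm (X x) powr p)) \<longlonglongrightarrow> 0"
        by (rule tendsto_eventually)
    qed
  qed (use Xp in \<open>auto simp: indicator_def\<close>)
  then have "(\<lambda>k. \<integral>\<^sup>+x. indicator {x. norm (X x) > real k} x * ennreal (norm (X x) powr p) \<partial>lborel) \<longlonglongrightarrow> 0" by simp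
  from order_tendstoD(2)[OF this, of "ennreal \<delta>1"] \<delta>1
  have "eventually (\<lambda>k. (\<integral>\<^sup>+x. indicator {x. norm (X x) > real k} x * ennreal (norm (X x) powr p) \<partial>lborel) < ennreal \<delta>1) sequentially" 
    by simp
  then obtain k where k: "(\<integral>\<^sup>+x. indicator {x. norm (X x) > real k} x * ennreal (norm (X x) powr p) \<partial>lborel) < ennreal \<delta>1"
    using eventually_happens trivial_limit_sequentially by blast
  define M where "M = real k + 1"
  define Y where "Y x = (if norm (X x) \<le> real k then X x else 0)" for x
  have Y [measurable]: "Y \<in> borel_measurable borel" unfolding Y_def by measurable
  have Yb: "norm (Y x) \<le> M" for x by (auto simp: Y_def M_def)
  have "Y \<in> borel_measurable lebesgue" by (rule measurable_completion) simp
  then have "Y measurable_on UNIV" by (rule lebesgue_measurable_imp_measurable_on) simp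
  then obtain N g where N: "negligible N" and g: "\<And>n. continuous_on UNIV (g n)" and lim: "\<And>x. x \<notin> N \<Longrightarrow> (\<lambda>n. g n x) \<longlonglongrightarrow> Y x"
    unfolding measurable_on_def by auto
  define h where "h n x = closest_point (cball 0 M) (g n x)" for n x
  have cl: "continuous_on UNIV (closest_point (cball (0::'b) M))"
    by (intro continuous_on_closest_point) (auto simp: M_def)
  have hc: "continuous_on UNIV (h n)" for n
    unfolding h_def by (rule continuous_on_compose2[OF cl g]) auto
  have hm [measurable]: "h n \<in> borel_measurable borel" for n by (intro borel_measurable_continuous_onI hc)
  have hb: "norm (h n x) \<le> M" for n x
    using closest_point_in_set[of "cball (0::'b) M" "g n x"] by (simp add: h_def M_def)
  have hl: "(\<lambda>n. h n x) \<longlonglongrightarrow> Y x" if "x \<notin> N" for x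
  proof -
    have "(\<lambda>n. h n x) \<longlonglongrightarrow> closest_point (cball 0 M) (Y x)"
      unfolding h_def using cl by (intro continuous_on_tendsto_compose[OF cl lim[OF that]]) auto
    then show ?thesis using Yb[of x] by (simp add: closest_point_self)
  qed
  have AEN: "AE x in lborel. x \<notin> N"
  proof -
    have "AE x in lebesgue. x \<notin> N" using N by (auto simp: negligible_iff_null_sets intro: AE_not_in)
    then show ?thesis by (simp add: AE_completion_iff)
  qed
  have "(\<lambda>n. \<integral>\<^sup>+x. indicator D x * ennreal (norm (Y x - h n x) powr p) \<partial>lborel) \<longlonglongrightarrow> (\<integral>\<^sup>+x. 0 \<partial>(lborel :: 'a measure))"
  proof (rule nn_integral_dominated_convergence[where w = "\<lambda>x. ennreal ((2 * M) powr p) * indicator D x"])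
    show "AE x in lborel. (\<lambda>n. indicator D x * ennreal (norm (Y x - h n x) powr p)) \<longlonglongrightarrow> 0"
      using AEN
    proof eventually_elim
      case (elim x)
      have "(\<lambda>n. norm (Y x - h n x)) \<longlonglongrightarrow> norm (Y x - Y x)"
        using hl[OF elim] by (intro tendsto_intros)
      then have "(\<lambda>n. norm (Y x - h n x) powr p) \<longlonglongrightarrow> 0"
        using p by (intro tendsto_zero_powrI) auto
      then have "(\<lambda>n. ennreal (norm (Y x - h n x) powr p)) \<longlonglongrightarrow> ennreal 0"
        by (rule tendsto_ennrealI)
      then show ?case by (cases "x \<in> D") (auto simp: indicator_def)
    qed
    show "AE x in lborel. indicator D x * ennreal (norm (Y x - h n x) powr p) \<le> ennreal ((2 * M) powr p) * indicator D x" for n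
    proof (intro AE_I2)
      fix x
      have "norm (Y x - h n x) \<le> 2 * M" using norm_triangle_ineq4[of "Y x" "h n x"] Yb[of x] hb[of n x] by linarith
      then show "indicator D x * ennreal (norm (Y x - h n x) powr p) \<le> ennreal ((2 * M) powr p) * indicator D x"
        using p by (auto simp: indicator_def intro!: ennreal_leI powr_mono2)
    qed
  qed (use Df in \<open>auto simp: nn_integral_cmult ennreal_mult_less_top\<close>)
  then have "(\<lambda>n. \<integral>\<^sup>+x. indicator D x * ennreal (norm (Y x - h n x) powr p) \<partial>lborel) \<longlonglongrightarrow> 0" by simp
  from order_tendstoD(2)[OF this, of "ennreal \<delta>1"] \<delta>1
  have "eventually (\<lambda>n. (Lp_int_on D p (\<lambda>x. Y x - h n x)) < ennreal \<delta>1) sequentially" 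
    by simp
  then obtain n where n: "(Lp_int_on D p (\<lambda>x. Y x - h n x)) < ennreal \<delta>1"
    using eventually_happens trivial_limit_sequentially by blast
  have "(Lp_int_on D p (\<lambda>x. X x - h n x)) \<le>
     (\<integral>\<^sup>+x. ennreal (2 powr p) * ((indicator {x. norm (X x) > real k} x * ennreal (norm (X x) powr p)) + indicator D x * ennreal (norm (Y x - h n x) powr p)) \<partial>lborel)"
  proof (intro nn_integral_mono)
    fix x
    have "norm (X x - h n x) powr p \<le> 2 powr p * (norm (X x - Y x) powr p + norm (Y x - h n x) powr p)"
      using norm_add_powr_le[of p "X x - Y x" "Y x - h n x"] p by simp
    then have "ennreal (norm (X x - h n x) powr p) \<le> ennreal (2 powr p) * (ennreal (norm (X x - Y x) powr p) + ennreal (norm (Y x - h n x) powr p))"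
      by (simp add: ennreal_mult[symmetric] ennreal_plus[symmetric] ennreal_leI del: ennreal_plus)
    moreover have "ennreal (norm (X x - Y x) powr p) = indicator {x. norm (X x) > real k} x * ennreal (norm (X x) powr p)"
      by (auto simp: Y_def indicator_def)
    ultimately show "indicator D x * ennreal (norm (X x - h n x) powr p) \<le> ennreal (2 powr p) * ((indicator {x. norm (X x) > real k} x * ennreal (norm (X x) powr p)) + indicator D x * ennreal (norm (Y x - h n x) powr p))"
      by (cases "x \<in> D") auto
  qed
  also have "\<dots> = ennreal (2 powr p) * ((\<integral>\<^sup>+x. indicator {x. norm (X x) > real k} x * ennreal (norm (X x) powr p) \<partial>lborel) + (Lp_int_on D p (\<lambda>x. Y x - h n x)))"
    by (subst nn_integral_cmult, measurable) (subst nn_integral_add, auto)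
  also have "\<dots> \<le> ennreal (2 powr p) * (ennreal \<delta>1 + ennreal \<delta>1)"
    using k n by (intro mult_left_mono add_mono) auto
  also have "\<dots> = ennreal \<delta>"
    using \<delta>1 by (simp add: ennreal_mult[symmetric] ennreal_plus[symmetric] \<delta>1_def field_simps del: ennreal_plus)
  finally show ?thesis using hc by blast
qed

lemma nn_integral_affine_le:
  fixes f :: "real^3 \<Rightarrow> ennreal"
  assumes [measurable]: "f \<in> borel_measurable borel" and l: "l \<ge> 1/2"
  shows "(\<integral>\<^sup>+x. f (l *\<^sub>R x + w) \<partial>lborel) \<le> 8 * (\<integral>\<^sup>+x. f x \<partial>lborel)"
proof -
  have "(\<integral>\<^sup>+x. f x \<partial>lborel) = (\<integral>\<^sup>+x. f (w + x) \<partial>lborel)"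
    by (rule nn_integral_translate[symmetric]) simp
  also have "\<dots> = ennreal (\<bar>l\<bar> ^ DIM(real^3)) * (\<integral>\<^sup>+x. f (w + l *\<^sub>R x) \<partial>lborel)"
    using l by (intro nn_integral_scale) auto
  also have "DIM(real^3) = 3" by simp
  finally have eq: "(\<integral>\<^sup>+x. f x \<partial>lborel) = ennreal (\<bar>l\<bar> ^ 3) * (\<integral>\<^sup>+x. f (l *\<^sub>R x + w) \<partial>lborel)"
    by (simp add: add.commute)
  have "(1/2) ^ 3 \<le> \<bar>l\<bar> ^ 3" using l by (intro power_mono) auto
  then have "1 \<le> 8 * \<bar>l\<bar> ^ 3" by (simp add: power3_eq_cube)
  then have "(1::ennreal) \<le> ennreal (8 * \<bar>l\<bar> ^ 3)" by simp
  then have "1 * (\<integral>\<^sup>+x. f (l *\<^sub>R x + w) \<partial>lborel) \<le> ennreal (8 * \<bar>l\<bar> ^ 3) * (\<integral>\<^sup>+x. f (l *\<^sub>R x + w) \<partial>lborel)"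
    by (rule mult_right_mono) simp
  also have "\<dots> = 8 * (\<integral>\<^sup>+x. f x \<partial>lborel)"
    unfolding eq by (simp add: ennreal_mult' mult.assoc)
  finally show ?thesis by simp
qed

text \<open>Approximate \<open>X\<close> by a continuous function, which is uniformly continuous on a large ball, and use
  that composition with the affine map increases integrals at most eightfold.\<close>

lemma Lp_affine_continuity:
  fixes X :: "real^3 \<Rightarrow> real^3"
  assumes X [measurable]: "X \<in> borel_measurable borel" and p: "p > 0"
    and Xp: "(Lp_int p X) < \<infinity>"
    and supp: "\<And>x. norm x \<ge> 1 \<Longrightarrow> X x = 0" and \<delta>: "\<delta> > 0"
  shows "\<exists>\<eta>>0. \<forall>l w. \<bar>l - 1\<bar> \<le> \<eta> \<longrightarrow> norm w \<le> \<eta> \<longrightarrow>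
     (Lp_int p (\<lambda>x. X (l *\<^sub>R x + w) - X x)) \<le> ennreal \<delta>"
proof -
  define D where "D = cball (0::real^3) 5"
  define V where "V = measure lborel D"
  have DV: "emeasure lborel D = ennreal V" 
    unfolding V_def D_def by (rule emeasure_eq_ennreal_measure) (use emeasure_lborel_cball_finite[of "0::real^3" 5] in auto)
  have D [measurable]: "D \<in> sets borel" by (simp add: D_def)
  have V0: "V \<ge> 0" by (simp add: V_def)
  define \<delta>1 where "\<delta>1 = \<delta> / (3 powr p * 18)"
  define \<epsilon> where "\<epsilon> = (\<delta> / (2 * 3 powr p * (V + 1))) powr (1 / p)"
  have \<delta>1: "\<delta>1 > 0" using \<delta> by (simp add: \<delta>1_def)
  have \<epsilon>: "\<epsilon> > 0" using \<delta> V0 by (simp add: \<epsilon>_def)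
  have \<epsilon>p: "\<epsilon> powr p = \<delta> / (2 * 3 powr p * (V + 1))"
    using p \<delta> V0 by (simp add: \<epsilon>_def powr_powr)
  obtain g where g: "continuous_on UNIV g" and gX: "(Lp_int_on D p (\<lambda>x. X x - g x)) \<le> ennreal \<delta>1"
    using Lp_continuous_approximation[OF X p Xp D _ \<delta>1] DV by auto
  have gm [measurable]: "g \<in> borel_measurable borel" by (intro borel_measurable_continuous_onI g)
  have "uniformly_continuous_on D g"
    unfolding D_def by (intro compact_uniformly_continuous continuous_on_subset[OF g]) auto
  then obtain d where d: "d > 0" "\<And>x y. x \<in> D \<Longrightarrow> y \<in> D \<Longrightarrow> dist y x < d \<Longrightarrow> dist (g y) (g x) < \<epsilon>"
    using \<epsilon> unfolding uniformly_continuous_on_def by metis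
  \<comment> \<open>\<open>|T x - x| \<le> 3 |l - 1| + |w| \<le> 4 \<eta> < d\<close> on the ball of radius \<open>3\<close>, which \<open>T\<close> maps into \<open>D\<close>.\<close>
  define \<eta> where "\<eta> = min (1/2) (d / 5)"
  have \<eta>: "\<eta> > 0" using d by (simp add: \<eta>_def)
  have "(Lp_int p (\<lambda>x. X (l *\<^sub>R x + w) - X x)) \<le> ennreal \<delta>"
    if l: "\<bar>l - 1\<bar> \<le> \<eta>" and w: "norm w \<le> \<eta>" for l w
  proof -
    let ?T = "\<lambda>x. l *\<^sub>R x + w"
    have l': "1/2 \<le> l" "l \<le> 3/2" "norm w \<le> 1/2" using l w unfolding \<eta>_def by linarith+
    let ?F = "\<lambda>x. indicator D x * ennreal (norm (X x - g x) powr p)"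
    have "(Lp_int p (\<lambda>x. X (?T x) - X x)) \<le> 
      (\<integral>\<^sup>+x. ennreal (3 powr p) * (?F (?T x) + (?F x + ennreal (\<epsilon> powr p) * indicator D x)) \<partial>lborel)"
    proof (intro nn_integral_mono)
      fix x
      show "ennreal (norm (X (?T x) - X x) powr p) \<le> ennreal (3 powr p) * (?F (?T x) + (?F x + ennreal (\<epsilon> powr p) * indicator D x))"
      \<comment> \<open>Both \<open>X x\<close> and \<open>X (T x)\<close> vanish for \<open>|x| > 3\<close>, as \<open>|T x| \<ge> |x| / 2 - 1 / 2\<close>.\<close>
      proof (cases "norm x \<le> 3")
        case False
        have "l * norm x \<le> norm (?T x) + norm w"
          using norm_triangle_ineq4[of "?T x" w] l' by simp
        moreover have "1/2 * 3 \<le> l * norm x" using l' False by (intro mult_mono) auto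
        ultimately have "norm (?T x) \<ge> 1" using l' by linarith
        then have "X (?T x) = 0" "X x = 0" using False by (auto intro!: supp)
        then show ?thesis using p by simp
      next
        case True
        then have x: "x \<in> D" by (simp add: D_def)
        have "norm (?T x) \<le> l * norm x + norm w"
          using norm_triangle_ineq[of "l *\<^sub>R x" w] l' by simp
        moreover have "l * norm x \<le> 3/2 * 3" using l' True by (intro mult_mono) auto
        ultimately have Tx: "?T x \<in> D" using l' by (simp add: D_def)
        have "?T x - x = (l - 1) *\<^sub>R x + w" by (simp add: algebra_simps)
        then have "dist (?T x) x \<le> \<bar>l - 1\<bar> * norm x + norm w"
          by (metis dist_norm norm_scaleR norm_triangle_ineq)
        also have "\<dots> \<le> \<eta> * 3 + \<eta>" using l w True by (intro add_mono mult_mono) auto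
        also have "\<dots> < d" using d by (simp add: \<eta>_def min_def)
        finally have gd: "norm (g (?T x) - g x) \<le> \<epsilon>" using d(2)[OF x Tx] by (simp add: dist_norm)
        have "norm (X (?T x) - X x) \<le> norm (X (?T x) - g (?T x)) + (norm (g x - X x) + norm (g (?T x) - g x))"
          using norm_triangle_ineq[of "X (?T x) - g (?T x)" "g (?T x) - g x + (g x - X x)"] norm_triangle_ineq[of "g (?T x) - g x" "g x - X x"] by simp
        then have "norm (X (?T x) - X x) powr p \<le> (norm (X (?T x) - g (?T x)) + (norm (X x - g x) + \<epsilon>)) powr p"
          using p gd by (intro powr_mono2) (auto simp: norm_minus_commute)
        also have "\<dots> \<le> 3 powr p * (norm (X (?T x) - g (?T x)) powr p + (norm (X x - g x) powr p + \<epsilon> powr p))"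
        proof -
          let ?v = "\<lambda>i::nat. if i = 0 then norm (X (?T x) - g (?T x)) else if i = 1 then norm (X x - g x) else \<epsilon>"
          have "(\<Sum>i\<in>{0,1,2}. ?v i) powr p \<le> real (card {0,1,2::nat}) powr p * (\<Sum>i\<in>{0,1,2}. ?v i powr p)"
            using p \<epsilon> by (intro sum_powr_le) auto
          then show ?thesis by simp
        qed
        finally have "ennreal (norm (X (?T x) - X x) powr p) \<le> ennreal (3 powr p * (norm (X (?T x) - g (?T x)) powr p + (norm (X x - g x) powr p + \<epsilon> powr p)))"
          by (rule ennreal_leI)
        also have "\<dots> = ennreal (3 powr p) * (?F (?T x) + (?F x + ennreal (\<epsilon> powr p) * indicator D x))"
          using x Tx by (simp add: ennreal_mult)
        finally show ?thesis .
      qed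
    qed
    also have "\<dots> = ennreal (3 powr p) * ((\<integral>\<^sup>+x. ?F (?T x) \<partial>lborel) + ((\<integral>\<^sup>+x. ?F x \<partial>lborel) + ennreal (\<epsilon> powr p) * ennreal V))"
      by (subst nn_integral_cmult, measurable) (subst nn_integral_add, measurable, subst nn_integral_add, measurable, simp add: nn_integral_cmult DV)
    also have "\<dots> \<le> ennreal (3 powr p) * (8 * ennreal \<delta>1 + (ennreal \<delta>1 + ennreal (\<epsilon> powr p) * ennreal V))"
    proof -
      have "(\<integral>\<^sup>+x. ?F (?T x) \<partial>lborel) \<le> 8 * (\<integral>\<^sup>+x. ?F x \<partial>lborel)"
        by (rule nn_integral_affine_le) (use l' in auto)
      also have "\<dots> \<le> 8 * ennreal \<delta>1" using gX by (intro mult_left_mono) auto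
      finally show ?thesis using gX by (intro mult_left_mono add_mono) auto
    qed
    also have "\<dots> = ennreal (3 powr p * (9 * \<delta>1 + \<epsilon> powr p * V))"
    proof -
      have "8 * ennreal \<delta>1 + (ennreal \<delta>1 + ennreal (\<epsilon> powr p) * ennreal V) = ennreal (8 * \<delta>1) + (ennreal \<delta>1 + ennreal (\<epsilon> powr p * V))"
        using V0 by (simp add: ennreal_mult')
      also have "\<dots> = ennreal (9 * \<delta>1 + \<epsilon> powr p * V)"
        using \<delta>1 V0 by (simp add: ennreal_plus[symmetric] del: ennreal_plus)
      finally show ?thesis by (simp add: ennreal_mult')
    qed
    also have "\<dots> \<le> ennreal \<delta>"
    proof (rule ennreal_leI)
      have "3 powr p * (\<epsilon> powr p * V) = \<delta> / 2 * (V / (V + 1))" 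
      proof -
        have "q * (\<delta> / (2 * q * (V + 1)) * V) = \<delta> / 2 * (V / (V + 1))" if "q > 0" for q :: real
          using that V0 by (simp add: divide_simps)
        then show ?thesis unfolding \<epsilon>p by simp
      qed
      also have "\<dots> \<le> \<delta> / 2 * 1" using V0 \<delta> by (intro mult_left_mono) (auto simp: field_simps)
      finally show "3 powr p * (9 * \<delta>1 + \<epsilon> powr p * V) \<le> \<delta>" by (simp add: \<delta>1_def distrib_left)
    qed
    finally show ?thesis .
  qed
  with \<eta> show ?thesis by blast
qed

section \<open>Grids of cubes\<close>

definition grid_pt :: "real^3 \<Rightarrow> real \<Rightarrow> int^3 \<Rightarrow> real^3" where
  "grid_pt a r k = a + (\<chi> i. 2 * r * of_int (k $ i))"

abbreviation grid_sum :: "real \<Rightarrow> real^3 \<Rightarrow> (int^3) set \<Rightarrow> (real^3 \<Rightarrow> real^3) \<Rightarrow> real^3 \<Rightarrow> real^3" where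
  "grid_sum r a K X x \<equiv> \<Sum>k\<in>K. cube_field r X (grid_pt a r k) x"

lemma grid_pt_unique:
  assumes r: "r > 0" and "x \<in> halfcube r (grid_pt a r k)" "x \<in> halfcube r (grid_pt a r l)"
  shows "k = l"
proof -
  have "k $ i = l $ i" for i
  proof -
    have "- r \<le> x $ i - a $ i - 2 * r * k $ i" "x $ i - a $ i - 2 * r * k $ i < r"
      "- r \<le> x $ i - a $ i - 2 * r * l $ i" "x $ i - a $ i - 2 * r * l $ i < r"
      using assms by (auto simp: halfcube_def grid_pt_def algebra_simps)
    then have "2 * r * (k $ i - l $ i) < 2 * r * 1" "2 * r * (l $ i - k $ i) < 2 * r * 1"
      by (auto simp: algebra_simps)
    then have "real_of_int (k $ i - l $ i) < 1" "real_of_int (l $ i - k $ i) < 1"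
      using r by (auto simp only: mult_less_cancel_left_pos)
    then show ?thesis by linarith
  qed
  then show ?thesis by (simp add: vec_eq_iff)
qed

lemma grid_pt_exists:
  assumes r: "r > 0" shows "\<exists>k. x \<in> halfcube r (grid_pt a r k)"
proof
  let ?k = "\<chi> i. \<lfloor>((x - a) $ i + r) / (2 * r)\<rfloor>"
  have "- r \<le> (x - a) $ i - 2 * r * of_int (?k $ i) \<and> (x - a) $ i - 2 * r * of_int (?k $ i) < r" for i
  proof -
    define q where "q = ((x - a) $ i + r) / (2 * r)"
    have "2 * r * of_int \<lfloor>q\<rfloor> \<le> 2 * r * q" using r by (intro mult_left_mono) auto
    moreover have "2 * r * q < 2 * r * (of_int \<lfloor>q\<rfloor> + 1)" using r by (intro mult_strict_left_mono) auto
    moreover have "2 * r * q = (x - a) $ i + r" using r by (simp add: q_def)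
    moreover have "?k $ i = \<lfloor>q\<rfloor>" by (simp add: q_def)
    ultimately show ?thesis by (simp add: distrib_left)
  qed
  then show "x \<in> halfcube r (grid_pt a r ?k)" by (simp add: halfcube_def grid_pt_def algebra_simps)
qed

text \<open>The cells of the grid are the translates of one cube \<open>U\<close>, so the integral over \<open>a \<in> U\<close> of the
  sum of \<open>e\<close> over the grid points is at most the integral of \<open>e\<close> over space. If the sum exceeded
  twice the mean for almost every \<open>a\<close>, this would be violated.\<close>

lemma grid_selection:
  assumes e [measurable]: "e \<in> borel_measurable borel" and r: "r > 0" and I: "I > 0"
    and eI: "(\<integral>\<^sup>+c. e c \<partial>lborel) \<le> ennreal (I * (8 * r ^ 3))"
    and P: "AE c in lborel. P c" and K: "finite K"
  shows "\<exists>a\<in>halfcube r 0. (\<forall>k\<in>K. P (grid_pt a r k)) \<and> (\<Sum>k\<in>K. e (grid_pt a r k)) \<le> ennreal (2 * I)"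
proof (rule ccontr)
  assume no: "\<not> ?thesis"
  let ?U = "halfcube r 0"
  define T where "T k = grid_pt 0 r k" for k
  have shift: "grid_pt a r k = T k + a" for a k by (simp add: T_def grid_pt_def)
  have uniq: "k = l" if "x \<in> halfcube r (T k)" "x \<in> halfcube r (T l)" for k l x
    using grid_pt_unique[OF r] that unfolding T_def by blast
  have "AE a in lborel. P (grid_pt a r k)" for k
  proof -
    have "AE c in distr lborel borel ((+) (T k)). P c" using P by (simp only: lborel_distr_plus)
    then have "AE a in lborel. P (T k + a)"
      by (rule AE_distrD[rotated]) simp
    then show ?thesis by (simp add: shift)
  qed
  then have "AE a in lborel. \<forall>k\<in>K. P (grid_pt a r k)" using K by (intro AE_finite_allI) auto
  then have big: "AE a in lborel. ennreal (2 * I) * indicator ?U a \<le> (\<Sum>k\<in>K. indicator ?U a * e (grid_pt a r k))"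
  proof eventually_elim
    case (elim a)
    have "ennreal (2 * I) \<le> (\<Sum>k\<in>K. e (grid_pt a r k))" if "a \<in> ?U"
      using elim no that by (meson linear)
    then show ?case by (auto simp: indicator_def)
  qed
  have gm [measurable]: "(\<lambda>a. grid_pt a r k) \<in> borel_measurable borel" for k
    unfolding shift by measurable
  have "ennreal (2 * I) * ennreal (8 * r ^ 3) = (\<integral>\<^sup>+a. ennreal (2 * I) * indicator ?U a \<partial>lborel)"
    by (simp add: nn_integral_cmult emeasure_halfcube[OF r])
  also have "\<dots> \<le> (\<integral>\<^sup>+a. (\<Sum>k\<in>K. indicator ?U a * e (grid_pt a r k)) \<partial>lborel)"
    by (rule nn_integral_mono_AE[OF big])
  also have "\<dots> = (\<Sum>k\<in>K. \<integral>\<^sup>+a. indicator ?U a * e (grid_pt a r k) \<partial>lborel)"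
    by (subst nn_integral_sum) auto
  also have "\<dots> = (\<Sum>k\<in>K. \<integral>\<^sup>+x. indicator (halfcube r (T k)) x * e x \<partial>lborel)"
  proof (intro sum.cong refl)
    fix k
    show "(\<integral>\<^sup>+a. indicator ?U a * e (grid_pt a r k) \<partial>lborel) = (\<integral>\<^sup>+x. indicator (halfcube r (T k)) x * e x \<partial>lborel)"
      by (subst nn_integral_translate[of _ "T k", symmetric], measurable) (simp add: shift indicator_def halfcube_translate)
  qed
  also have "\<dots> = (\<integral>\<^sup>+x. (\<Sum>k\<in>K. indicator (halfcube r (T k)) x * e x) \<partial>lborel)"
    by (subst nn_integral_sum) auto
  also have "\<dots> \<le> (\<integral>\<^sup>+x. e x \<partial>lborel)"
  proof (intro nn_integral_mono)
    fix x
    show "(\<Sum>k\<in>K. indicator (halfcube r (T k)) x * e x) \<le> e x"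
    proof (cases "\<exists>k\<in>K. x \<in> halfcube r (T k)")
      case True
      then obtain k where k: "k \<in> K" "x \<in> halfcube r (T k)" by blast
      have "(\<Sum>k\<in>K. indicator (halfcube r (T k)) x * e x) = (\<Sum>l\<in>{k}. indicator (halfcube r (T l)) x * e x)"
        
      proof (rule sum.mono_neutral_right)
        show "\<forall>l\<in>K - {k}. indicator (halfcube r (T l)) x * e x = 0"
        proof
          fix l assume "l \<in> K - {k}"
          then have "x \<notin> halfcube r (T l)" using uniq[OF k(2)] by blast
          then show "indicator (halfcube r (T l)) x * e x = 0" by simp
        qed
      qed (use k K in auto)
      then show ?thesis using k by simp
    next
      case False
      then have "(\<Sum>k\<in>K. indicator (halfcube r (T k)) x * e x) = (\<Sum>k\<in>K. 0)"
        by (intro sum.cong) auto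
      then show ?thesis by simp
    qed
  qed
  also note eI
  finally have "ennreal (2 * I * (8 * r ^ 3)) \<le> ennreal (I * (8 * r ^ 3))"
    using I r by (simp add: ennreal_mult'[symmetric])
  moreover have "I * (8 * r ^ 3) > 0" using I r by simp
  ultimately show False by (simp add: ennreal_le_iff)
qed

text \<open>Test functions on the open ball of radius \<open>R\<close>. To vanish on and beyond the sphere is a condition
  that behaves simply under translations and dilations.\<close>

definition test_on :: "real \<Rightarrow> (real^3 \<Rightarrow> real) \<Rightarrow> (real^3 \<Rightarrow> real^3) \<Rightarrow> bool" where
  "test_on R \<phi> G \<longleftrightarrow> has_gradient \<phi> G \<and> (\<forall>x. R \<le> norm x \<longrightarrow> \<phi> x = 0)"

text \<open>Almost all cubes of half side \<open>r\<close> have quantised flux. The bound \<open>1 - 4 r\<close> keeps them inside the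
  range of side lengths about which the flux condition speaks, because \<open>2 sqrt 3 < 4\<close>.\<close>

definition integral_flux :: "(real^3 \<Rightarrow> real^3) \<Rightarrow> real \<Rightarrow> bool" where
  "integral_flux X r \<longleftrightarrow> (AE c in lborel. norm c < 1 - 4 * r \<longrightarrow> (\<exists>n::int. cube_outflow r X c = 2 * pi * of_int n))"

lemma finite_int_box: "finite {k :: int^3. \<forall>i. \<bar>k $ i\<bar> \<le> N}"
proof (rule finite_subset)
  show "{k :: int^3. \<forall>i. \<bar>k $ i\<bar> \<le> N} \<subseteq> vec_lambda ` (PiE UNIV (\<lambda>_. {-N..N}))"
  proof
    fix k :: "int^3" assume "k \<in> {k. \<forall>i. \<bar>k $ i\<bar> \<le> N}"
    then have "(\<lambda>i. k $ i) \<in> PiE UNIV (\<lambda>_. {-N..N})" "k = vec_lambda (\<lambda>i. k $ i)"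
      by (auto simp: abs_le_iff) (metis minus_le_iff)
    then show "k \<in> vec_lambda ` (PiE UNIV (\<lambda>_. {-N..N}))" by blast
  qed
qed (auto intro!: finite_PiE)

lemma face_integrable:
  assumes X [measurable]: "X \<in> borel_measurable borel" and [measurable]: "\<Phi> \<in> borel_measurable borel" and r: "r > 0"
    and \<Phi>: "\<And>t. t \<ge> 0 \<Longrightarrow> 0 \<le> \<Phi> t \<and> t \<le> \<Phi> t + 1" and E: "cube_energy \<Phi> r X c < \<infinity>" and s: "s \<in> {-1, 1}"
  shows "integrable lborel (\<lambda>u. indicator (face r) u * X (c + fpt j (s * r) u) $ j)"
proof (rule integrableI_bounded)
  let ?I = "\<lambda>j s. \<integral>\<^sup>+u. indicator (face r) u * ennreal (\<Phi> (norm (X (c + fpt j (s * r) u) - X c))) \<partial>lborel"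
  have "ennreal r * (face_sum (\<lambda>j s. ?I j s)) < \<infinity>"
    using E unfolding cube_energy_def by (simp add: ennreal_add_eq_top less_top[symmetric] )
  then have "(face_sum (\<lambda>j s. ?I j s)) < \<infinity>"
    using r by (auto simp: ennreal_mult_less_top)
  moreover have "?I j s \<le> (\<Sum>s\<in>{-1, 1}. ?I j s)" by (rule member_le_sum[OF s]) auto
  moreover have "(\<Sum>s\<in>{-1, 1}. ?I j s) \<le> (face_sum (\<lambda>j s. ?I j s))" by (rule member_le_sum) auto
  ultimately have fin: "?I j s < \<infinity>" by (meson order.strict_trans1)
  have "(\<integral>\<^sup>+u. ennreal (norm (indicator (face r) u * X (c + fpt j (s * r) u) $ j)) \<partial>lborel) \<le>
    (\<integral>\<^sup>+u. ennreal (norm (X c) + 1) * indicator (face r) u + indicator (face r) u * ennreal (\<Phi> (norm (X (c + fpt j (s * r) u) - X c))) \<partial>lborel)"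
  proof (intro nn_integral_mono)
    fix u
    have "\<bar>X (c + fpt j (s * r) u) $ j\<bar> \<le> norm (X (c + fpt j (s * r) u))" by (rule component_le_norm_cart)
    also have "\<dots> \<le> norm (X c) + norm (X (c + fpt j (s * r) u) - X c)" by (simp add: norm_triangle_sub)
    also have "\<dots> \<le> (norm (X c) + 1) + \<Phi> (norm (X (c + fpt j (s * r) u) - X c))" using \<Phi>[of "norm (X (c + fpt j (s * r) u) - X c)"] by simp
    finally show "ennreal (norm (indicator (face r) u * X (c + fpt j (s * r) u) $ j)) \<le> ennreal (norm (X c) + 1) * indicator (face r) u + indicator (face r) u * ennreal (\<Phi> (norm (X (c + fpt j (s * r) u) - X c)))"
      using \<Phi>[of "norm (X (c + fpt j (s * r) u) - X c)"] by (auto simp: indicator_def ennreal_plus[symmetric] simp del: ennreal_plus intro!: ennreal_leI)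
  qed
  also have "\<dots> = ennreal (norm (X c) + 1) * emeasure lborel (face r) + ?I j s"
    by (subst nn_integral_add, measurable) (simp add: nn_integral_cmult)
  also have "\<dots> < \<infinity>" using fin r by (simp add: emeasure_face ennreal_mult_less_top del: ennreal_plus)
  finally show "(\<integral>\<^sup>+u. ennreal (norm (indicator (face r) u * X (c + fpt j (s * r) u) $ j)) \<partial>lborel) < \<infinity>" .
qed measurable

text \<open>The face \<open>s = 1\<close> of a cube is the face \<open>s = -1\<close> of its neighbour in direction \<open>j\<close>, so the sum
  telescopes. Nothing is left over at the ends because \<open>\<phi>\<close> vanishes there.\<close>

lemma grid_telescope:
  assumes r: "r > 0" and a: "a \<in> halfcube r 0" and N: "N \<ge> 1 / r + 2" and \<phi>: "\<And>x. 1 \<le> norm x \<Longrightarrow> \<phi> x = 0"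
  defines "K \<equiv> {k :: int^3. \<forall>i. \<bar>k $ i\<bar> \<le> N}"
  shows "(\<Sum>k\<in>K. \<Sum>s\<in>{-1, 1}. s * (face_int r (\<lambda>u. X (grid_pt a r k + fpt j (s * r) u) $ j * \<phi> (grid_pt a r k + fpt j (s * r) u)))) = 0"
proof -
  define h where "h k = (face_int r (\<lambda>u. X (grid_pt a r k + fpt j r u) $ j * \<phi> (grid_pt a r k + fpt j r u)))" for k
  have shift: "grid_pt a r k + fpt j (-r) u = grid_pt a r (k - axis j 1) + fpt j r u" for k u
    by (simp add: vec_eq_iff all_cyclic[of _ j] grid_pt_def) (simp add: axis_def algebra_simps)
  define K' where "K' = {k :: int^3. \<forall>i. \<bar>k $ i\<bar> \<le> N - 1}"
  have h0: "h k = 0" if kK: "k \<notin> K'" for k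
  proof -
    obtain i where i: "\<not> \<bar>k $ i\<bar> \<le> N - 1" using kK unfolding K'_def by blast
    have z: "indicator (face r) u * (X (grid_pt a r k + fpt j r u) $ j * \<phi> (grid_pt a r k + fpt j r u)) = 0" for u
    proof (cases "u \<in> face r")
      case True
      let ?x = "grid_pt a r k + fpt j r u"
      have "\<forall>i. \<bar>fpt j r u $ i\<bar> \<le> r" unfolding all_cyclic[of _ j] using True r by (cases u) auto
      then have f: "\<bar>fpt j r u $ i\<bar> \<le> r" by blast
      have "- r \<le> a $ i \<and> a $ i < r" using a by (simp add: halfcube_def)
      then have ai: "\<bar>a $ i\<bar> \<le> r" by linarith
      have "real_of_int \<bar>k $ i\<bar> \<ge> real_of_int N" using i by linarith
      then have "\<bar>real_of_int (k $ i)\<bar> \<ge> 1 / r + 2" using N by simp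
      then have "2 * r * \<bar>real_of_int (k $ i)\<bar> \<ge> 2 * r * (1 / r + 2)" using r by (intro mult_left_mono) auto
      then have "\<bar>2 * r * of_int (k $ i)\<bar> \<ge> 2 + 4 * r" using r by (simp add: abs_mult distrib_left)
      moreover have "?x $ i = a $ i + 2 * r * of_int (k $ i) + fpt j r u $ i" by (simp add: grid_pt_def)
      ultimately have "\<bar>?x $ i\<bar> \<ge> 1" using f ai r by linarith
      then have "norm ?x \<ge> 1" using component_le_norm_cart[of ?x i] by linarith
      then show ?thesis using \<phi> by simp
    qed simp
    show ?thesis unfolding h_def z by simp
  qed
  have fin: "finite K" unfolding K_def by (rule finite_int_box)
  have KK: "K' \<subseteq> K" by (auto simp: K_def K'_def less_imp_le)
  have "(\<Sum>k\<in>K. h (k - axis j 1)) = (\<Sum>l\<in>(\<lambda>k. k - axis j 1) ` K. h l)"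
    by (subst sum.reindex) (auto simp: inj_on_def)
  also have "\<dots> = (\<Sum>l\<in>K'. h l)"
  proof (rule sum.mono_neutral_right)
    show "K' \<subseteq> (\<lambda>k. k - axis j 1) ` K"
    proof
      fix l assume l: "l \<in> K'"
      have "\<bar>(l + axis j 1) $ i\<bar> \<le> N" for i
      proof -
        have "\<bar>l $ i\<bar> \<le> N - 1" using l by (simp add: K'_def)
        moreover have "(axis j 1 :: int^3) $ i = 0 \<or> (axis j 1 :: int^3) $ i = 1" by (simp add: axis_def)
        ultimately show ?thesis unfolding vector_add_component by linarith
      qed
      then have "l + axis j 1 \<in> K" by (simp add: K_def)
      then show "l \<in> (\<lambda>k. k - axis j 1) ` K" by (intro image_eqI[of _ _ "l + axis j 1"]) auto
    qed
  qed (use fin h0 in auto)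
  also have "\<dots> = (\<Sum>k\<in>K. h k)"
    by (rule sum.mono_neutral_left) (use fin h0 KK in auto)
  finally have "(\<Sum>k\<in>K. h k - h (k - axis j 1)) = 0" by (simp add: sum_subtractf)
  moreover have "(\<Sum>s\<in>{-1, 1}. s * (face_int r (\<lambda>u. X (grid_pt a r k + fpt j (s * r) u) $ j * \<phi> (grid_pt a r k + fpt j (s * r) u)))) = h k - h (k - axis j 1)" for k
    unfolding h_def by (simp add: shift)
  ultimately show ?thesis by simp
qed

text \<open>The sum of the cube fields of a well placed grid. Its divergence is read off from
  \<open>cube_divergence\<close> and \<open>grid_telescope\<close>; fluxes are known to be quantised only for cubes centred
  in the ball of radius \<open>R\<close>, and the others are invisible to test functions on that ball.\<close>

lemma grid_field:
  assumes X [measurable]: "X \<in> borel_measurable borel" and P [measurable]: "\<Phi> \<in> borel_measurable borel"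
    and \<Phi>: "\<And>t. t \<ge> 0 \<Longrightarrow> 0 \<le> \<Phi> t \<and> t \<le> \<Phi> t + 1"
    and mod: "\<And>\<delta>. \<delta> > 0 \<Longrightarrow> \<exists>\<eta>>0. \<forall>w. norm w \<le> \<eta> \<longrightarrow> (\<integral>\<^sup>+x. ennreal (\<Phi> (norm (X (x + w) - X x))) \<partial>lborel) \<le> ennreal \<delta>"
    and flux: "\<And>\<eta>. \<eta> > 0 \<Longrightarrow> \<exists>r>0. r < \<eta> \<and> integral_flux X r"
    and R: "R < 1" and \<delta>: "\<delta> > 0"
  shows "\<exists>r a K. r > 0 \<and> finite K \<and> (\<forall>x\<in>ball 0 1. \<exists>k\<in>K. x \<in> halfcube r (grid_pt a r k)) \<and>
     (\<forall>k\<in>K. norm (grid_pt a r k) < R \<longrightarrow> (\<exists>n::int. cube_outflow r X (grid_pt a r k) = 2 * pi * of_int n)) \<and>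
     (\<Sum>k\<in>K. cube_energy \<Phi> r X (grid_pt a r k)) \<le> ennreal \<delta> \<and>
     (\<forall>\<phi> G. test_on R \<phi> G \<longrightarrow> integrable lborel (\<lambda>x. grid_sum r a K X x \<bullet> G x) \<and>
        (\<integral>x. grid_sum r a K X x \<bullet> G x \<partial>lborel) = - (\<Sum>k\<in>K. \<phi> (grid_pt a r k) * cube_outflow r X (grid_pt a r k)))"
proof -
  obtain \<eta> where \<eta>: "\<eta> > 0" and m: "\<And>w. norm w \<le> \<eta> \<Longrightarrow> (\<integral>\<^sup>+x. ennreal (\<Phi> (norm (X (x + w) - X x))) \<partial>lborel) \<le> ennreal (\<delta> / 8)"
    using mod[of "\<delta> / 8"] \<delta> by auto
  \<comment> \<open>The points of a cube are within \<open>2 r \<le> \<eta>\<close> of its centre, and \<open>R < 1 - 4 r\<close>.\<close>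
  obtain r where r: "r > 0" "r < min (\<eta> / 2) ((1 - R) / 4)" and fl: "integral_flux X r"
    using flux[of "min (\<eta> / 2) ((1 - R) / 4)"] \<eta> R by auto
  have "(\<integral>\<^sup>+c. cube_energy \<Phi> r X c \<partial>lborel) \<le> ennreal (32 * r ^ 3) * ennreal (\<delta> / 8)"
    using r by (intro cube_energy_average m X P) auto
  also have "\<dots> = ennreal (\<delta> / 2 * (8 * r ^ 3))"
    using r \<delta> by (subst ennreal_mult[symmetric]) (auto intro!: arg_cong[where f = ennreal])
  finally have av: "(\<integral>\<^sup>+c. cube_energy \<Phi> r X c \<partial>lborel) \<le> ennreal (\<delta> / 2 * (8 * r ^ 3))" .
  \<comment> \<open>Enough cubes in each direction to cover the unit ball for every \<open>a\<close> in the fundamental cell.\<close>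
  define N where "N = \<lceil>1 / r + 2\<rceil>"
  have N: "N \<ge> 1 / r + 2" by (simp add: N_def)
  define K where "K = {k :: int^3. \<forall>i. \<bar>k $ i\<bar> \<le> N}"
  have K: "finite K" unfolding K_def by (rule finite_int_box)
  obtain a where a: "a \<in> halfcube r 0" and aF: "\<forall>k\<in>K. norm (grid_pt a r k) < 1 - 4 * r \<longrightarrow> (\<exists>n::int. cube_outflow r X (grid_pt a r k) = 2 * pi * of_int n)"
    and aE: "(\<Sum>k\<in>K. cube_energy \<Phi> r X (grid_pt a r k)) \<le> ennreal (2 * (\<delta> / 2))"
    using grid_selection[OF cube_energy_borel[OF X P] r(1) _ av fl[unfolded integral_flux_def] K] \<delta> by auto
  have cov: "\<exists>k\<in>K. x \<in> halfcube r (grid_pt a r k)" if "x \<in> ball 0 1" for x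
  proof -
    obtain k where k: "x \<in> halfcube r (grid_pt a r k)" using grid_pt_exists[OF r(1)] by blast
    have "\<bar>k $ i\<bar> \<le> N" for i
    proof -
      have xi: "\<bar>x $ i\<bar> < 1" using that component_le_norm_cart[of x i] by simp
      have ai: "- r \<le> a $ i" "a $ i < r" using a by (auto simp: halfcube_def)
      have "- r \<le> x $ i - a $ i - 2 * r * of_int (k $ i)" "x $ i - a $ i - 2 * r * of_int (k $ i) < r"
        using k by (auto simp: halfcube_def grid_pt_def algebra_simps)
      then have "\<bar>2 * r * of_int (k $ i)\<bar> \<le> 2 * r * (1 / r + 2)" using xi ai r by (simp add: distrib_left)
      then have "2 * r * \<bar>of_int (k $ i)\<bar> \<le> 2 * r * (1 / r + 2)" using r by (simp add: abs_mult)
      then have "\<bar>real_of_int (k $ i)\<bar> \<le> 1 / r + 2" using r by (simp only: mult_le_cancel_left_pos zero_less_mult_iff zero_less_numeral simp_thms)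
      then show ?thesis using N by linarith
    qed
    then show ?thesis using k by (auto simp: K_def)
  qed
  have Efin: "cube_energy \<Phi> r X (grid_pt a r k) < \<infinity>" if "k \<in> K" for k
  proof -
    have "cube_energy \<Phi> r X (grid_pt a r k) \<le> (\<Sum>k\<in>K. cube_energy \<Phi> r X (grid_pt a r k))"
      by (rule member_le_sum[OF that _ K]) simp
    also note aE
    finally show ?thesis by (rule order.strict_trans1) simp
  qed
  have "integrable lborel (\<lambda>x. grid_sum r a K X x \<bullet> G x) \<and>
        (\<integral>x. grid_sum r a K X x \<bullet> G x \<partial>lborel) = - (\<Sum>k\<in>K. \<phi> (grid_pt a r k) * cube_outflow r X (grid_pt a r k))"
    if t: "test_on R \<phi> G" for \<phi> G
  proof -
    have g: "has_gradient \<phi> G" and \<phi>0: "\<And>x. 1 \<le> norm x \<Longrightarrow> \<phi> x = 0" using t R by (auto simp: test_on_def)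
    note fi = face_integrable[OF X P r(1) \<Phi> Efin]
    have i: "integrable lborel (\<lambda>x. cube_field r X (grid_pt a r k) x \<bullet> G x)" if "k \<in> K" for k
      by (rule cube_divergence(1)[OF r(1) X fi[OF _ that] g])
    define Q where "Q k j s = s * (face_int r (\<lambda>u. X (grid_pt a r k + fpt j (s * r) u) $ j * \<phi> (grid_pt a r k + fpt j (s * r) u)))" for k j s
    have "(\<integral>x. grid_sum r a K X x \<bullet> G x \<partial>lborel) = (\<Sum>k\<in>K. \<integral>x. cube_field r X (grid_pt a r k) x \<bullet> G x \<partial>lborel)"
      unfolding inner_sum_left by (intro Bochner_Integration.integral_sum i)
    also have "\<dots> = (\<Sum>k\<in>K. (face_sum (\<lambda>j s. Q k j s)) - \<phi> (grid_pt a r k) * cube_outflow r X (grid_pt a r k))"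
      unfolding Q_def by (intro sum.cong refl cube_divergence(2)[OF r(1) X fi g])
    also have "\<dots> = (\<Sum>j\<in>UNIV. \<Sum>k\<in>K. \<Sum>s\<in>{-1, 1}. Q k j s) - (\<Sum>k\<in>K. \<phi> (grid_pt a r k) * cube_outflow r X (grid_pt a r k))"
      unfolding sum_subtractf by (subst sum.swap) (rule refl)
    also have "\<dots> = - (\<Sum>k\<in>K. \<phi> (grid_pt a r k) * cube_outflow r X (grid_pt a r k))"
    proof -
      have "(\<Sum>k\<in>K. \<Sum>s\<in>{-1, 1}. Q k j s) = 0" for j
        unfolding Q_def K_def by (rule grid_telescope[OF r(1) a N \<phi>0])
      then show ?thesis by (simp only: sum.neutral_const diff_0)
    qed
    finally show ?thesis unfolding inner_sum_left using i by (auto intro!: Bochner_Integration.integrable_sum)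
  qed
  moreover have "norm (grid_pt a r k) < R \<Longrightarrow> norm (grid_pt a r k) < 1 - 4 * r" for k using r by auto
  ultimately show ?thesis using r K cov aF aE \<delta>
    by (intro exI[of _ r] exI[of _ a] exI[of _ K]) auto
qed

section \<open>Approximation by fields with point charges\<close>

lemma test_on_gradient_zero:
  assumes t: "test_on R \<phi> G" and x: "R < norm x"
  shows "G x = 0"
proof -
  have d: "(\<phi> has_derivative (\<lambda>h. G x \<bullet> h)) (at x)"
    using t by (auto simp: test_on_def has_gradient_def)
  have "((\<lambda>_. 0) has_derivative (\<lambda>_. 0)) (at x)" by simp
  then have "(\<phi> has_derivative (\<lambda>_. 0)) (at x)"
  proof (rule has_derivative_transform_within_open)
    show "open {y. R < norm y}" by (intro open_Collect_less continuous_intros)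
  qed (use t x in \<open>auto simp: test_on_def\<close>)
  from has_derivative_unique[OF d this] have "G x \<bullet> G x = 0" by meson
  then show ?thesis by simp
qed

lemma test_on_gradient_bounded:
  assumes t: "test_on R \<phi> G"
  shows "\<exists>B\<ge>0. \<forall>x. norm (G x) \<le> B"
proof -
  have "bounded (G ` cball 0 R)"
    using t by (intro compact_imp_bounded compact_continuous_image)
      (auto simp: test_on_def has_gradient_def intro: continuous_on_subset)
  then obtain B where B: "\<And>x. x \<in> cball 0 R \<Longrightarrow> norm (G x) \<le> B" by (auto simp: bounded_iff simp del: mem_cball mem_cball_0)
  have "norm (G x) \<le> max B 0" for x
    using B[of x] test_on_gradient_zero[OF t, of x] by (cases "norm x \<le> R") auto
  then show ?thesis by (intro exI[of _ "max B 0"]) auto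
qed

lemma cube_energy_mono:
  assumes "\<And>t. t \<ge> 0 \<Longrightarrow> \<Phi> t \<le> \<Psi> t"
  shows "cube_energy \<Phi> r X c \<le> cube_energy \<Psi> r X c"
  unfolding cube_energy_def using assms
  by (intro add_mono mult_left_mono sum_mono nn_integral_mono ennreal_leI) auto

lemma grid_Lp_error:
  assumes p: "1 \<le> p" "p < 3/2"
  shows "\<exists>C>0. \<forall>X r a K. X \<in> borel_measurable borel \<longrightarrow> r > 0 \<longrightarrow> finite K \<longrightarrow>
    (\<forall>x\<in>ball 0 1. \<exists>k\<in>K. x \<in> halfcube r (grid_pt a r k)) \<longrightarrow>
    (Lp_int_on (ball 0 1) p (\<lambda>x. grid_sum r a K X x - X x))
      \<le> ennreal C * (\<Sum>k\<in>K. cube_energy (\<lambda>t. t powr p) r X (grid_pt a r k))"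
proof -
  obtain C where C: "C > 0" "\<And>r c X. r > 0 \<Longrightarrow> X \<in> borel_measurable borel \<Longrightarrow>
    (Lp_int_on (halfcube r c) p (\<lambda>x. cube_field r X c x - X x))
      \<le> ennreal C * cube_energy (\<lambda>t. t powr p) r X c" using cube_field_energy[OF p] by blast
  have "(Lp_int_on (ball 0 1) p (\<lambda>x. grid_sum r a K X x - X x))
      \<le> ennreal C * (\<Sum>k\<in>K. cube_energy (\<lambda>t. t powr p) r X (grid_pt a r k))"
    if X [measurable]: "X \<in> borel_measurable borel" and r: "r > 0" and K: "finite K" 
      and cov: "\<forall>x\<in>ball 0 1. \<exists>k\<in>K. x \<in> halfcube r (grid_pt a r k)" for X r a and K :: "(int^3) set"
  proof -
    have "(Lp_int_on (ball 0 1) p (\<lambda>x. grid_sum r a K X x - X x))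
      \<le> (\<integral>\<^sup>+x. (\<Sum>k\<in>K. indicator (halfcube r (grid_pt a r k)) x * ennreal (norm (cube_field r X (grid_pt a r k) x - X x) powr p)) \<partial>lborel)"
    proof (intro nn_integral_mono)
      fix x
      let ?S = "\<Sum>k\<in>K. indicator (halfcube r (grid_pt a r k)) x * ennreal (norm (cube_field r X (grid_pt a r k) x - X x) powr p)"
      show "indicator (ball 0 1) x * ennreal (norm (grid_sum r a K X x - X x) powr p) \<le> ?S"
      proof (cases "x \<in> ball 0 1")
        case True
        then obtain k where k: "k \<in> K" "x \<in> halfcube r (grid_pt a r k)" using cov by blast
        have "grid_sum r a K X x = (\<Sum>k\<in>{k}. cube_field r X (grid_pt a r k) x)"
        proof (rule sum.mono_neutral_right)
          show "\<forall>l\<in>K - {k}. cube_field r X (grid_pt a r l) x = 0"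
            using grid_pt_unique[OF r k(2)] cube_field_outside by blast
        qed (use k K in auto)
        then have "ennreal (norm (grid_sum r a K X x - X x) powr p) =
          indicator (halfcube r (grid_pt a r k)) x * ennreal (norm (cube_field r X (grid_pt a r k) x - X x) powr p)"
          using k by simp
        also have "\<dots> \<le> ?S" by (rule member_le_sum[OF k(1) _ K]) simp
        finally show ?thesis using True by simp
      qed simp
    qed
    also have "\<dots> = (\<Sum>k\<in>K. \<integral>\<^sup>+x. indicator (halfcube r (grid_pt a r k)) x * ennreal (norm (cube_field r X (grid_pt a r k) x - X x) powr p) \<partial>lborel)"
      by (rule nn_integral_sum) measurable
    also have "\<dots> \<le> (\<Sum>k\<in>K. ennreal C * cube_energy (\<lambda>t. t powr p) r X (grid_pt a r k))"
      by (intro sum_mono C(2) r X)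
    finally show ?thesis by (simp only: sum_distrib_left)
  qed
  then show ?thesis using C(1) by blast
qed

text \<open>The flux of \<open>X\<close> is that of \<open>X - X c\<close>, and \<open>t \<le> 1 / (24 r\<^sup>2) + 5 r t powr (3/2)\<close>: for
  \<open>t > 1 / (24 r\<^sup>2)\<close> one has \<open>5 r sqrt t \<ge> 1\<close>. The first summand integrates to \<open>1\<close> over the
  boundary, whose area is \<open>24 r\<^sup>2\<close>. As \<open>1 < 2 \<pi>\<close>, a nonzero quantised flux needs a definite
  amount of energy, however small the cube.\<close>

lemma outflow_le_energy:
  assumes X [measurable]: "X \<in> borel_measurable borel" and P [measurable]: "\<Phi> \<in> borel_measurable borel" and r: "r > 0"
    and \<Phi>: "\<And>t. t \<ge> 0 \<Longrightarrow> t powr (3/2) \<le> \<Phi> t \<and> t \<le> \<Phi> t + 1"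
    and E: "cube_energy \<Phi> r X c < \<infinity>"
  shows "ennreal \<bar>cube_outflow r X c\<bar> \<le> 1 + 5 * cube_energy \<Phi> r X c"
proof -
  have \<Phi>0: "0 \<le> \<Phi> t" if "t \<ge> 0" for t using \<Phi>[OF that] powr_ge_zero[of t "3/2"] by linarith
  have i: "integrable lborel (\<lambda>u. indicator (face r) u * X (c + fpt j (s * r) u) $ j)" if "s \<in> {-1, 1}" for j s
    by (rule face_integrable[OF X P r _ E that]) (use \<Phi> \<Phi>0 in auto)
  have one: "integrable lborel (\<lambda>u. indicator (face r) u * (k::real))" for k
    by (intro integrable_indicator_mult_continuous) (auto intro: bounded_face)
  let ?d = "\<lambda>j s u. norm (X (c + fpt j (s * r) u) - X c)"
  let ?I = "\<lambda>j s. \<integral>\<^sup>+u. indicator (face r) u * ennreal (\<Phi> (?d j s u)) \<partial>lborel"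
  define D where "D j s = (face_int r (\<lambda>u. X (c + fpt j (s * r) u) $ j - X c $ j))" for j s
  have Dd: "D j s = (face_int r (\<lambda>u. X (c + fpt j (s * r) u) $ j)) - (\<integral>u. indicator (face r) u * X c $ j \<partial>(lborel :: (real \<times> real) measure))"
    if "s \<in> {-1, 1}" for j s
    unfolding D_def right_diff_distrib by (intro Bochner_Integration.integral_diff i that one)
  have o: "cube_outflow r X c = (face_sum (\<lambda>j s. s * D j s))"
    unfolding cube_outflow_def by (rule sum.cong[OF refl]) (simp add: Dd algebra_simps)
  have pt: "t \<le> 1 / (24 * r\<^sup>2) + 5 * r * \<Phi> t" if t: "t \<ge> 0" for t
  proof (cases "t \<le> 1 / (24 * r\<^sup>2)")
    case True then show ?thesis using \<Phi>0[OF t] r by (simp add: add_increasing2)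
  next
    case False
    then have tp: "t > 0" using r by (smt (verit) divide_pos_pos zero_less_power)
    have "1 < 24 * r\<^sup>2 * t" using False r by (simp add: field_simps)
    also have "\<dots> \<le> 25 * r\<^sup>2 * t" using r t by simp
    also have "\<dots> = (5 * r * sqrt t)\<^sup>2" using t by (simp add: power_mult_distrib)
    finally have "1 \<le> 5 * r * sqrt t" using r t by (smt (verit) power_le_one_iff mult_nonneg_nonneg real_sqrt_ge_zero power2_less_imp_less one_power2)
    then have "t * 1 \<le> t * (5 * r * sqrt t)" using t by (intro mult_left_mono)
    also have "\<dots> = 5 * r * t powr (3/2)"
      using tp powr_add[of t 1 "1/2"] by (simp add: powr_half_sqrt)
    also have "\<dots> \<le> 5 * r * \<Phi> t" using \<Phi>[OF t] r by (intro mult_left_mono) auto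
    finally show ?thesis using r by (simp add: add_increasing)
  qed
  have Db: "ennreal \<bar>D j s\<bar> \<le> ennreal (1/6) + 5 * (ennreal r * ?I j s)" if s: "s \<in> {-1, 1}" for j s
  proof -
    have "ennreal (norm (D j s)) \<le> (\<integral>\<^sup>+u. ennreal (norm (indicator (face r) u * (X (c + fpt j (s * r) u) $ j - X c $ j))) \<partial>lborel)"
      unfolding D_def right_diff_distrib by (intro integral_norm_bound_ennreal Bochner_Integration.integrable_diff i s one)
    also have "\<dots> \<le> (\<integral>\<^sup>+u. ennreal (1 / (24 * r\<^sup>2)) * indicator (face r) u + ennreal (5 * r) * (indicator (face r) u * ennreal (\<Phi> (?d j s u))) \<partial>lborel)"
    proof (intro nn_integral_mono)
      fix u
      have "\<bar>X (c + fpt j (s * r) u) $ j - X c $ j\<bar> \<le> ?d j s u"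
        using component_le_norm_cart[of "X (c + fpt j (s * r) u) - X c" j] by simp
      also have "\<dots> \<le> 1 / (24 * r\<^sup>2) + 5 * r * \<Phi> (?d j s u)" by (rule pt) simp
      finally have "ennreal \<bar>X (c + fpt j (s * r) u) $ j - X c $ j\<bar> \<le> ennreal (1 / (24 * r\<^sup>2) + 5 * r * \<Phi> (?d j s u))" by (rule ennreal_leI)
      also have "\<dots> = ennreal (1 / (24 * r\<^sup>2)) + ennreal (5 * r) * ennreal (\<Phi> (?d j s u))"
        using r \<Phi>0[of "?d j s u"] by (subst ennreal_plus) (auto simp: ennreal_mult)
      finally show "ennreal (norm (indicator (face r) u * (X (c + fpt j (s * r) u) $ j - X c $ j))) \<le> ennreal (1 / (24 * r\<^sup>2)) * indicator (face r) u + ennreal (5 * r) * (indicator (face r) u * ennreal (\<Phi> (?d j s u)))"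
        by (cases "u \<in> face r") auto
    qed
    also have "\<dots> = ennreal (1 / (24 * r\<^sup>2)) * ennreal (4 * r\<^sup>2) + ennreal (5 * r) * ?I j s"
      by (subst nn_integral_add, measurable) (simp add: nn_integral_cmult emeasure_face[OF r])
    also have "ennreal (1 / (24 * r\<^sup>2)) * ennreal (4 * r\<^sup>2) = ennreal (1/6)"
      using r by (subst ennreal_mult[symmetric]) (auto intro!: arg_cong[where f = ennreal])
    also have "ennreal (5 * r) * ?I j s = 5 * (ennreal r * ?I j s)" using r by (simp add: ennreal_mult mult.assoc)
    finally show ?thesis by simp
  qed
  have "ennreal \<bar>cube_outflow r X c\<bar> \<le> ennreal (face_sum (\<lambda>j s. \<bar>D j s\<bar>))"
    unfolding o by (intro ennreal_leI order_trans[OF sum_abs] sum_mono) (auto simp: abs_mult)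
  also have "\<dots> = (face_sum (\<lambda>j s. ennreal \<bar>D j s\<bar>))"
    by (simp only: sum_ennreal[symmetric] sum_nonneg abs_ge_zero)
  also have "\<dots> \<le> (face_sum (\<lambda>j s. ennreal (1/6) + 5 * (ennreal r * ?I j s)))"
    by (intro sum_mono Db)
  also have "\<dots> = (\<Sum>j\<in>(UNIV::3 set). \<Sum>s\<in>{-1, 1::real}. ennreal (1/6)) + 5 * (ennreal r * (face_sum (\<lambda>j s. ?I j s)))"
    by (simp only: sum.distrib sum_distrib_left)
  also have "(\<Sum>j\<in>(UNIV::3 set). \<Sum>s\<in>{-1, 1::real}. ennreal (1/6)) = 1"
  proof -
    have "6 * ennreal (1/6) = ennreal (6 * (1/6))" by (subst ennreal_mult) auto
    then show ?thesis by simp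
  qed
  also have "1 + 5 * (ennreal r * (face_sum (\<lambda>j s. ?I j s))) \<le> 1 + 5 * cube_energy \<Phi> r X c"
    unfolding cube_energy_def by (intro add_mono mult_left_mono) auto
  finally show ?thesis .
qed

lemma Lp_translation_modulus:
  fixes X :: "real^3 \<Rightarrow> real^3"
  assumes "X \<in> borel_measurable borel" "p > 0" "(Lp_int p X) < \<infinity>"
    "\<And>x. norm x \<ge> 1 \<Longrightarrow> X x = 0" "\<delta> > 0"
  shows "\<exists>\<eta>>0. \<forall>w. norm w \<le> \<eta> \<longrightarrow> (Lp_int p (\<lambda>x. X (x + w) - X x)) \<le> ennreal \<delta>"
proof -
  obtain \<eta> where "\<eta> > 0" and \<eta>: "\<And>l w. \<bar>l - 1\<bar> \<le> \<eta> \<Longrightarrow> norm w \<le> \<eta> \<Longrightarrow>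
     (Lp_int p (\<lambda>x. X (l *\<^sub>R x + w) - X x)) \<le> ennreal \<delta>"
    using Lp_affine_continuity[OF assms] by blast
  then show ?thesis using \<eta>[of 1] by (intro exI[of _ \<eta>]) auto
qed

text \<open>On a set of finite measure, \<open>t powr q \<le> 1 + t powr p\<close>.\<close>

lemma ball_Lp_mono:
  fixes X :: "real^3 \<Rightarrow> real^3"
  assumes X [measurable]: "X \<in> borel_measurable borel" and q: "0 < q" "q \<le> p"
    and Xp: "(Lp_int p X) < \<infinity>"
    and supp: "\<And>x. norm x \<ge> 1 \<Longrightarrow> X x = 0"
  shows "(Lp_int q X) < \<infinity>"
proof -
  have "(Lp_int q X) \<le> (\<integral>\<^sup>+x. indicator (ball 0 1) x + ennreal (norm (X x) powr p) \<partial>lborel)"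
  proof (intro nn_integral_mono)
    fix x
    show "ennreal (norm (X x) powr q) \<le> indicator (ball 0 1) x + ennreal (norm (X x) powr p)"
    proof (cases "norm x < 1")
      case False then show ?thesis using supp[of x] q by simp
    next
      case True
      have "norm (X x) powr q \<le> 1 + norm (X x) powr p"
      proof (cases "norm (X x) \<le> 1")
        case True
        then have "norm (X x) powr q \<le> 1 powr q" using q by (intro powr_mono2) auto
        then show ?thesis by (simp add: add_increasing2)
      next
        case False
        then have "norm (X x) powr q \<le> norm (X x) powr p" using q by (intro powr_mono) auto
        then show ?thesis by simp
      qed
      then have "ennreal (norm (X x) powr q) \<le> ennreal (1 + norm (X x) powr p)" by (rule ennreal_leI)
      then show ?thesis using True by simp
    qed
  qed
  also have "\<dots> = emeasure lborel (ball (0::real^3) 1) + (Lp_int p X)"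
  proof -
    have b: "ball (0::real^3) 1 \<in> sets lborel" by simp
    have m: "(\<lambda>x. ennreal (norm (X x) powr p)) \<in> borel_measurable lborel"
      by measurable
    show ?thesis
      using nn_integral_add[OF borel_measurable_indicator[OF b] m] nn_integral_indicator[OF b] by simp
  qed
  also have "\<dots> < \<infinity>" using Xp emeasure_lborel_ball_finite[of "0::real^3" 1] by simp
  finally show ?thesis .
qed

lemma ball_borel [measurable]: "ball (a :: real^3) r \<in> sets borel"
  by simp

lemma solenoidal_limit:
  assumes X [measurable]: "X \<in> borel_measurable borel" and X1: "(\<integral>\<^sup>+x. ennreal (norm (X x)) \<partial>lborel) < \<infinity>"
    and R: "R < 1" and t: "test_on R \<phi> G"
    and Z: "\<And>\<delta>. \<delta> > 0 \<Longrightarrow> \<exists>Z. Z \<in> borel_measurable borel \<and> integrable_pairing Z G \<and> (pairing Z G) = 0 \<and>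
       (\<integral>\<^sup>+x. indicator (ball 0 1) x * ennreal (norm (Z x - X x)) \<partial>lborel) \<le> ennreal \<delta>"
  shows "integrable_pairing X G" "(pairing X G) = 0"
proof -
  obtain B where B: "B \<ge> 0" "\<And>x. norm (G x) \<le> B" using test_on_gradient_bounded[OF t] by blast
  have Gm [measurable]: "G \<in> borel_measurable borel" using t by (auto simp: test_on_def intro: has_gradient_borel)
  have bd: "norm (v \<bullet> G x) \<le> B * norm v" for v x
    using Cauchy_Schwarz_ineq2[of v "G x"] mult_left_mono[OF B(2)[of x], of "norm v"] by (simp add: mult.commute)
  show iX: "integrable_pairing X G"
  proof (rule integrableI_bounded)
    have "(\<integral>\<^sup>+x. ennreal (norm (X x \<bullet> G x)) \<partial>lborel) \<le> (\<integral>\<^sup>+x. ennreal B * ennreal (norm (X x)) \<partial>lborel)"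
      using bd B(1) by (intro nn_integral_mono) (simp add: ennreal_mult[symmetric] ennreal_leI)
    also have "\<dots> < \<infinity>" using X1 by (simp add: nn_integral_cmult ennreal_mult_less_top)
    finally show "(\<integral>\<^sup>+x. ennreal (norm (X x \<bullet> G x)) \<partial>lborel) < \<infinity>" .
  qed measurable
  have "\<bar>\<integral>x. X x \<bullet> G x \<partial>lborel\<bar> \<le> 0 + e" if e: "e > 0" for e
  proof -
    obtain Z where Zm [measurable]: "Z \<in> borel_measurable borel" and iZ: "integrable_pairing Z G" and Z0: "(pairing Z G) = 0"
      and Ze: "(\<integral>\<^sup>+x. indicator (ball 0 1) x * ennreal (norm (Z x - X x)) \<partial>lborel) \<le> ennreal (e / (B + 1))"
      using Z[of "e / (B + 1)"] e B(1) by auto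
    have "(pairing X G) = (\<integral>x. X x \<bullet> G x - Z x \<bullet> G x \<partial>lborel)"
      using iX iZ Z0 by simp
    also have "ennreal (norm \<dots>) \<le> (\<integral>\<^sup>+x. ennreal (norm (X x \<bullet> G x - Z x \<bullet> G x)) \<partial>lborel)"
      using iX iZ by (intro integral_norm_bound_ennreal) simp
    also have "\<dots> \<le> (\<integral>\<^sup>+x. ennreal B * (indicator (ball 0 1) x * ennreal (norm (Z x - X x))) \<partial>lborel)"
    proof (intro nn_integral_mono)
      fix x
      show "ennreal (norm (X x \<bullet> G x - Z x \<bullet> G x)) \<le> ennreal B * (indicator (ball 0 1) x * ennreal (norm (Z x - X x)))"
      proof (cases "norm x < 1")
        case True
        have "norm (X x \<bullet> G x - Z x \<bullet> G x) \<le> B * norm (Z x - X x)"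
          using bd[of "X x - Z x" x] by (simp add: inner_diff_left norm_minus_commute)
        then show ?thesis using True B(1) by (simp add: ennreal_mult[symmetric] ennreal_leI)
      next
        case False
        then have "G x = 0" using test_on_gradient_zero[OF t, of x] R by simp
        then show ?thesis by simp
      qed
    qed
    also have "\<dots> = ennreal B * (\<integral>\<^sup>+x. indicator (ball 0 1) x * ennreal (norm (Z x - X x)) \<partial>lborel)"
      by (rule nn_integral_cmult) measurable
    also have "\<dots> \<le> ennreal B * ennreal (e / (B + 1))" by (intro mult_left_mono Ze) simp
    also have "\<dots> = ennreal (B * (e / (B + 1)))" using B(1) e by (subst ennreal_mult) auto
    also have "\<dots> \<le> ennreal e"
    proof (rule ennreal_leI)
      have "B * (e / (B + 1)) = e * (B / (B + 1))" by simp
      also have "\<dots> \<le> e * 1" using B(1) e by (intro mult_left_mono) auto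
      finally show "B * (e / (B + 1)) \<le> e" by simp
    qed
    finally show ?thesis using e by (simp add: ennreal_le_iff)
  qed
  then have "\<bar>\<integral>x. X x \<bullet> G x \<partial>lborel\<bar> \<le> 0" by (rule field_le_epsilon)
  then show "(pairing X G) = 0" by simp
qed

text \<open>For \<open>p < 3/2\<close> this is \<open>grid_field\<close> with the energy of exponent \<open>p\<close>. For \<open>p \<ge> 3/2\<close> the energy
  with \<open>t + t powr (3/2)\<close> is made small instead: then every flux on the grid is at most \<open>6 < 2 \<pi>\<close> and
  hence zero, the grid fields are divergence free and tend to \<open>X\<close> in \<open>L\<^sup>1\<close>, and \<open>X\<close> may be taken
  as its own approximant.\<close>

lemma point_charge_approximation:
  fixes X :: "real^3 \<Rightarrow> real^3"
  assumes X [measurable]: "X \<in> borel_measurable borel" and p: "1 \<le> p"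
    and Xp: "(Lp_int p X) < \<infinity>"
    and supp: "\<And>x. norm x \<ge> 1 \<Longrightarrow> X x = 0"
    and flux: "\<And>\<eta>. \<eta> > 0 \<Longrightarrow> \<exists>r>0. r < \<eta> \<and> integral_flux X r"
    and R: "R < 1" and \<delta>: "\<delta> > 0"
  shows "\<exists>Z A n. Z \<in> borel_measurable borel \<and> finite A \<and> A \<subseteq> ball 0 R \<and> (A = {} \<or> p < 3/2) \<and>
     (Lp_int_on (ball 0 1) p (\<lambda>x. Z x - X x)) \<le> ennreal \<delta> \<and>
     (\<forall>\<phi> G. test_on R \<phi> G \<longrightarrow> integrable_pairing Z G \<and>
        (pairing Z G) = - (\<Sum>c\<in>A. 2 * pi * of_int (n c :: int) * \<phi> c))"
proof (cases "p < 3/2")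
  case True
  obtain C where C: "C > 0" and Cb: "\<And>X r a K. X \<in> borel_measurable borel \<Longrightarrow> r > 0 \<Longrightarrow> finite K \<Longrightarrow>
    (\<forall>x\<in>ball 0 1. \<exists>k\<in>K. x \<in> halfcube r (grid_pt a r k)) \<Longrightarrow>
    (Lp_int_on (ball 0 1) p (\<lambda>x. grid_sum r a K X x - X x))
      \<le> ennreal C * (\<Sum>k\<in>K. cube_energy (\<lambda>t. t powr p) r X (grid_pt a r k))"
    using grid_Lp_error[OF p True] by blast
  have \<Phi>: "0 \<le> t powr p \<and> t \<le> t powr p + 1" if "t \<ge> 0" for t
  proof (cases "t \<le> 1")
    case False
    then have "t powr 1 \<le> t powr p" using p by (intro powr_mono) auto
    then show ?thesis using False by simp
  qed (simp add: add_increasing)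
  have \<Phi>m: "(\<lambda>t::real. t powr p) \<in> borel_measurable borel" by measurable
  have p0: "p > 0" using p by simp
  obtain r a K where r: "r > 0" and K: "finite K" and cov: "\<forall>x\<in>ball 0 1. \<exists>k\<in>K. x \<in> halfcube r (grid_pt a r k)"
    and fl: "\<And>k. k \<in> K \<Longrightarrow> norm (grid_pt a r k) < R \<Longrightarrow> \<exists>n::int. cube_outflow r X (grid_pt a r k) = 2 * pi * of_int n"
    and en: "(\<Sum>k\<in>K. cube_energy (\<lambda>t. t powr p) r X (grid_pt a r k)) \<le> ennreal (\<delta> / C)"
    and div: "\<And>\<phi> G. test_on R \<phi> G \<Longrightarrow> integrable lborel (\<lambda>x. grid_sum r a K X x \<bullet> G x) \<and>
        (\<integral>x. grid_sum r a K X x \<bullet> G x \<partial>lborel) = - (\<Sum>k\<in>K. \<phi> (grid_pt a r k) * cube_outflow r X (grid_pt a r k))"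
    using grid_field[OF X \<Phi>m \<Phi> Lp_translation_modulus[OF X p0 Xp supp] flux R, of "\<delta> / C"] \<delta> C by auto
  define K' where "K' = {k\<in>K. norm (grid_pt a r k) < R}"
  define A where "A = grid_pt a r ` K'"
  define n where "n c = (SOME n::int. cube_outflow r X c = 2 * pi * of_int n)" for c
  have n: "cube_outflow r X (grid_pt a r k) = 2 * pi * of_int (n (grid_pt a r k))" if "k \<in> K'" for k
    unfolding n_def by (rule someI_ex[OF fl]) (use that in \<open>auto simp: K'_def\<close>)
  have inj: "inj_on (grid_pt a r) K'"
  proof (rule inj_onI)
    fix k l assume "grid_pt a r k = grid_pt a r l"
    moreover have "grid_pt a r k \<in> halfcube r (grid_pt a r k)" using r by (simp add: halfcube_def)
    ultimately show "k = l" using grid_pt_unique[OF r, of "grid_pt a r k" a k l] by simp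
  qed
  let ?Z = "\<lambda>x. \<Sum>k\<in>K. cube_field r X (grid_pt a r k) x"
  have "(\<Sum>k\<in>K. \<phi> (grid_pt a r k) * cube_outflow r X (grid_pt a r k)) = (\<Sum>c\<in>A. 2 * pi * of_int (n c) * \<phi> c)"
    if t: "test_on R \<phi> G" for \<phi> G
  proof -
    have "(\<Sum>k\<in>K. \<phi> (grid_pt a r k) * cube_outflow r X (grid_pt a r k)) = (\<Sum>k\<in>K'. \<phi> (grid_pt a r k) * cube_outflow r X (grid_pt a r k))"
    proof (rule sum.mono_neutral_right)
      have "\<phi> x = 0" if "\<not> norm x < R" for x using t that by (auto simp: test_on_def)
      then show "\<forall>k\<in>K - K'. \<phi> (grid_pt a r k) * cube_outflow r X (grid_pt a r k) = 0"
        by (auto simp: K'_def)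
    qed (use K in \<open>auto simp: K'_def\<close>)
    also have "\<dots> = (\<Sum>k\<in>K'. 2 * pi * of_int (n (grid_pt a r k)) * \<phi> (grid_pt a r k))"
      by (intro sum.cong refl) (simp add: n)
    also have "\<dots> = (\<Sum>c\<in>A. 2 * pi * of_int (n c) * \<phi> c)"
      unfolding A_def by (subst sum.reindex[OF inj]) simp
    finally show ?thesis .
  qed
  moreover have "(Lp_int_on (ball 0 1) p (\<lambda>x. ?Z x - X x)) \<le> ennreal \<delta>"
  proof -
    have "(Lp_int_on (ball 0 1) p (\<lambda>x. ?Z x - X x)) \<le> ennreal C * ennreal (\<delta> / C)"
      by (rule order_trans[OF Cb[OF X r K cov] mult_left_mono[OF en]]) simp
    also have "\<dots> = ennreal \<delta>" using C \<delta> by (simp add: ennreal_mult[symmetric])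
    finally show ?thesis .
  qed
  moreover have "?Z \<in> borel_measurable borel" by measurable
  moreover have "finite A" "A \<subseteq> ball 0 R" using K by (auto simp: A_def K'_def)
  ultimately show ?thesis using True div by (intro exI[of _ ?Z] exI[of _ A] exI[of _ n]) auto
next
  case False
  obtain C where C: "C > 0" and Cb: "\<And>X r a K. X \<in> borel_measurable borel \<Longrightarrow> r > 0 \<Longrightarrow> finite K \<Longrightarrow>
    (\<forall>x\<in>ball 0 1. \<exists>k\<in>K. x \<in> halfcube r (grid_pt a r k)) \<Longrightarrow>
    (Lp_int_on (ball 0 1) 1 (\<lambda>x. grid_sum r a K X x - X x))
      \<le> ennreal C * (\<Sum>k\<in>K. cube_energy (\<lambda>t. t powr 1) r X (grid_pt a r k))"
    using grid_Lp_error[of 1] by auto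
  define \<Phi> where "\<Phi> t = t powr 1 + t powr (3/2)" for t :: real
  have \<Phi>m [measurable]: "\<Phi> \<in> borel_measurable borel" unfolding \<Phi>_def by measurable
  have \<Phi>: "t powr 1 \<le> \<Phi> t" "t powr (3/2) \<le> \<Phi> t" "0 \<le> \<Phi> t" for t by (auto simp: \<Phi>_def)
  have \<Phi>': "0 \<le> \<Phi> t \<and> t \<le> \<Phi> t + 1" if "t \<ge> 0" for t using \<Phi>[of t] that by simp
  have X1: "(Lp_int 1 X) < \<infinity>"
    by (rule ball_Lp_mono[OF X _ _ Xp supp]) (use p in auto)
  have X32: "(Lp_int (3/2) X) < \<infinity>"
    by (rule ball_Lp_mono[OF X _ _ Xp supp]) (use False in auto)
  have mod: "\<exists>\<eta>>0. \<forall>w. norm w \<le> \<eta> \<longrightarrow> (\<integral>\<^sup>+x. ennreal (\<Phi> (norm (X (x + w) - X x))) \<partial>lborel) \<le> ennreal \<delta>" if \<delta>: "\<delta> > 0" for \<delta>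
  proof -
    obtain \<eta>1 where 1: "\<eta>1 > 0" "\<And>w. norm w \<le> \<eta>1 \<Longrightarrow> (Lp_int 1 (\<lambda>x. X (x + w) - X x)) \<le> ennreal (\<delta> / 2)"
      using Lp_translation_modulus[OF X _ X1 supp, of "\<delta> / 2"] \<delta> by auto
    obtain \<eta>2 where 2: "\<eta>2 > 0" "\<And>w. norm w \<le> \<eta>2 \<Longrightarrow> (Lp_int (3/2) (\<lambda>x. X (x + w) - X x)) \<le> ennreal (\<delta> / 2)"
      using Lp_translation_modulus[OF X _ X32 supp, of "\<delta> / 2"] \<delta> by auto
    have "(\<integral>\<^sup>+x. ennreal (\<Phi> (norm (X (x + w) - X x))) \<partial>lborel) \<le> ennreal \<delta>" if w: "norm w \<le> min \<eta>1 \<eta>2" for w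
    proof -
      have "(\<integral>\<^sup>+x. ennreal (\<Phi> (norm (X (x + w) - X x))) \<partial>lborel) = 
        (Lp_int 1 (\<lambda>x. X (x + w) - X x)) + (Lp_int (3/2) (\<lambda>x. X (x + w) - X x))"
        unfolding \<Phi>_def by (subst nn_integral_add[symmetric]) (auto intro!: nn_integral_cong)
      also have "\<dots> \<le> ennreal (\<delta> / 2) + ennreal (\<delta> / 2)" using w by (intro add_mono 1 2) auto
      also have "\<dots> = ennreal \<delta>" using \<delta> by (simp add: ennreal_plus[symmetric] del: ennreal_plus)
      finally show ?thesis .
    qed
    then show ?thesis using 1(1) 2(1) by (intro exI[of _ "min \<eta>1 \<eta>2"]) auto
  qed
  have sol: "integrable_pairing X G \<and> (pairing X G) = 0" if t: "test_on R \<phi> G" for \<phi> G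
  proof -
    have "\<exists>Z. Z \<in> borel_measurable borel \<and> integrable_pairing Z G \<and> (pairing Z G) = 0 \<and>
       (\<integral>\<^sup>+x. indicator (ball 0 1) x * ennreal (norm (Z x - X x)) \<partial>lborel) \<le> ennreal \<epsilon>" if \<epsilon>: "\<epsilon> > 0" for \<epsilon>
    proof -
      \<comment> \<open>Energy at most \<open>1\<close> kills the fluxes, energy at most \<open>\<epsilon> / C\<close> gives the error \<open>\<epsilon>\<close>.\<close>
      define \<mu> where "\<mu> = min 1 (\<epsilon> / C)"
      have \<mu>: "\<mu> > 0" "\<mu> \<le> 1" "C * \<mu> \<le> \<epsilon>" using \<epsilon> C by (auto simp: \<mu>_def min_def field_simps)
      obtain r a K where r: "r > 0" and K: "finite K" and cov: "\<forall>x\<in>ball 0 1. \<exists>k\<in>K. x \<in> halfcube r (grid_pt a r k)"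
        and fl: "\<And>k. k \<in> K \<Longrightarrow> norm (grid_pt a r k) < R \<Longrightarrow> \<exists>n::int. cube_outflow r X (grid_pt a r k) = 2 * pi * of_int n"
        and en: "(\<Sum>k\<in>K. cube_energy \<Phi> r X (grid_pt a r k)) \<le> ennreal \<mu>"
        and div: "\<And>\<phi> G. test_on R \<phi> G \<Longrightarrow> integrable lborel (\<lambda>x. grid_sum r a K X x \<bullet> G x) \<and>
            (\<integral>x. grid_sum r a K X x \<bullet> G x \<partial>lborel) = - (\<Sum>k\<in>K. \<phi> (grid_pt a r k) * cube_outflow r X (grid_pt a r k))"
        using grid_field[OF X \<Phi>m \<Phi>' mod flux R \<mu>(1)] by auto
      let ?Z = "\<lambda>x. \<Sum>k\<in>K. cube_field r X (grid_pt a r k) x"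
      have zero: "cube_outflow r X (grid_pt a r k) = 0" if k: "k \<in> K" and kR: "norm (grid_pt a r k) < R" for k
      proof -
        have e: "cube_energy \<Phi> r X (grid_pt a r k) \<le> ennreal \<mu>"
          by (rule order_trans[OF member_le_sum[OF k _ K] en]) simp
        have "ennreal \<bar>cube_outflow r X (grid_pt a r k)\<bar> \<le> 1 + 5 * cube_energy \<Phi> r X (grid_pt a r k)"
          by (rule outflow_le_energy[OF X \<Phi>m r]) (use \<Phi> \<Phi>' e in \<open>auto intro: order.strict_trans1\<close>)
        also have "\<dots> \<le> 1 + 5 * ennreal 1"
          using e \<mu> by (intro add_mono mult_left_mono order_trans[OF e] ennreal_leI) auto
        also have "\<dots> = ennreal 6" by simp
        finally have "\<bar>cube_outflow r X (grid_pt a r k)\<bar> \<le> 6" by (subst (asm) ennreal_le_iff) auto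
        moreover obtain n :: int where n: "cube_outflow r X (grid_pt a r k) = 2 * pi * of_int n" using fl[OF k kR] by blast
        ultimately have "2 * pi * \<bar>real_of_int n\<bar> \<le> 6" by (simp add: abs_mult)
        have "n = 0"
        proof (rule ccontr)
          assume "n \<noteq> 0"
          then have "1 \<le> \<bar>real_of_int n\<bar>" by linarith
          then have "2 * pi * 1 \<le> 2 * pi * \<bar>real_of_int n\<bar>" by (intro mult_left_mono) auto
          then show False using \<open>2 * pi * \<bar>real_of_int n\<bar> \<le> 6\<close> pi_gt3 by linarith
        qed
        then show ?thesis using n by simp
      qed
      have "(\<Sum>k\<in>K. \<phi> (grid_pt a r k) * cube_outflow r X (grid_pt a r k)) = 0"
      proof (rule sum.neutral, rule ballI)
        fix k assume "k \<in> K"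
        then show "\<phi> (grid_pt a r k) * cube_outflow r X (grid_pt a r k) = 0"
          using zero[of k] t by (cases "norm (grid_pt a r k) < R") (auto simp: test_on_def)
      qed
      then have "integrable_pairing ?Z G \<and> (pairing ?Z G) = 0"
        using div[OF t] by simp
      moreover have "(\<integral>\<^sup>+x. indicator (ball 0 1) x * ennreal (norm (?Z x - X x)) \<partial>lborel) \<le> ennreal \<epsilon>"
      proof -
        have "(Lp_int_on (ball 0 1) 1 (\<lambda>x. ?Z x - X x)) \<le> ennreal C * (\<Sum>k\<in>K. cube_energy (\<lambda>t. t powr 1) r X (grid_pt a r k))"
          by (rule Cb[OF X r K cov])
        also have "\<dots> \<le> ennreal C * (\<Sum>k\<in>K. cube_energy \<Phi> r X (grid_pt a r k))"
          by (intro mult_left_mono sum_mono cube_energy_mono \<Phi>) auto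
        also have "\<dots> \<le> ennreal C * ennreal \<mu>" by (intro mult_left_mono en) simp
        also have "\<dots> \<le> ennreal \<epsilon>" using C \<mu> by (simp add: ennreal_mult[symmetric] ennreal_leI)
        finally show ?thesis by simp
      qed
      moreover have "?Z \<in> borel_measurable borel" by measurable
      ultimately show ?thesis by blast
    qed
    from solenoidal_limit[OF X _ R t this] X1 show ?thesis by simp
  qed
  show ?thesis
    by (rule exI[of _ X], rule exI[of _ "{}"]) (use sol in simp)
qed

section \<open>Smooth functions and a mollifier\<close>

lemma dif_eq: "(f has_derivative f') (at x) \<Longrightarrow> dif f x = f'"
  by (rule frechet_derivative_at[symmetric])

text \<open>Partial derivatives on an open set depend only on the values there.\<close>

lemma Ck_on_transfer:
  assumes S: "open S" shows "(\<And>x. x \<in> S \<Longrightarrow> f x = g x) \<Longrightarrow> Ck_on k S f \<Longrightarrow> Ck_on k S g"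
proof (induction k arbitrary: f g)
  case 0
  then show ?case using continuous_on_cong[of S S f g] by simp
next
  case (Suc k)
  have d: "(g has_derivative dif f x) (at x)" if x: "x \<in> S" for x
  proof -
    have "(f has_derivative dif f x) (at x)" using Suc.prems(2) x by (simp add: frechet_derivative_works)
    then show ?thesis by (rule has_derivative_transform_within_open[OF _ S x]) (rule Suc.prems(1))
  qed
  have "Ck_on k S (\<lambda>x. dif g x (axis i 1))" for i
    by (rule Suc.IH[of "\<lambda>x. dif f x (axis i 1)"]) (use Suc.prems dif_eq[OF d] in auto)
  then show ?case using d by (auto simp: differentiable_def)
qed

text \<open>The way in which smoothness is proved below: exhibit a gradient whose components are smooth.\<close>

lemma Ck_on_SucI:
  assumes S: "open S" and d: "\<And>x. x \<in> S \<Longrightarrow> (f has_derivative (\<lambda>h. D x \<bullet> h)) (at x)"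
    and D: "\<And>i. Ck_on k S (\<lambda>x. D x $ i)"
  shows "Ck_on (Suc k) S f"
proof -
  have "Ck_on k S (\<lambda>x. dif f x (axis i 1))" for i
    by (rule Ck_on_transfer[OF S _ D[of i]]) (simp add: dif_eq[OF d] inner_axis)
  then show ?thesis using d by (auto simp: differentiable_def)
qed

lemma Ck_on_gradient:
  assumes "Ck_on (Suc k) S f" "x \<in> S"
  shows "(f has_derivative (\<lambda>h. (\<chi> i. dif f x (axis i 1)) \<bullet> h)) (at x)"
proof -
  have d: "(f has_derivative dif f x) (at x)" using assms by (simp add: frechet_derivative_works)
  then have l: "linear (dif f x)" by (rule has_derivative_linear)
  have "dif f x h = (\<chi> i. dif f x (axis i 1)) \<bullet> h" for h
  proof -
    have h: "(\<Sum>i\<in>UNIV. h $ i *\<^sub>R axis i 1) = h"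
      using basis_expansion[of h] by (simp add: scalar_mult_eq_scaleR)
    have "dif f x (\<Sum>i\<in>UNIV. h $ i *\<^sub>R axis i 1) = (\<Sum>i\<in>UNIV. h $ i *\<^sub>R dif f x (axis i 1))"
      unfolding linear_sum[OF l] linear_scale[OF l] ..
    then have "dif f x h = (\<Sum>i\<in>UNIV. h $ i *\<^sub>R dif f x (axis i 1))"
      unfolding h .
    then show ?thesis by (simp add: inner_vec_def mult.commute)
  qed
  then have "dif f x = (\<lambda>h. (\<chi> i. dif f x (axis i 1)) \<bullet> h)" by blast
  then show ?thesis using d by simp
qed

lemma Ck_on_Suc_imp: "Ck_on (Suc k) S f \<Longrightarrow> Ck_on k S f"
proof (induction k arbitrary: f)
  case 0
  then show ?case by (auto intro!: continuous_at_imp_continuous_on differentiable_imp_continuous_within)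
next
  case (Suc k)
  have "Ck_on k S (\<lambda>x. dif f x (axis i 1))" for i
    by (rule Suc.IH) (use Suc.prems in auto)
  then show ?case using Suc.prems by simp
qed

lemma Ck_on_subset: "Ck_on k S f \<Longrightarrow> T \<subseteq> S \<Longrightarrow> Ck_on k T f"
  by (induction k arbitrary: f) (auto intro: continuous_on_subset)

lemma Ck_on_const: "open S \<Longrightarrow> Ck_on k S (\<lambda>x. c)"
proof (induction k arbitrary: c)
  case (Suc k)
  show ?case by (rule Ck_on_SucI[where D = "\<lambda>_. 0"]) (use Suc in auto)
qed simp

lemma Ck_on_add:
  assumes S: "open S" shows "Ck_on k S f \<Longrightarrow> Ck_on k S g \<Longrightarrow> Ck_on k S (\<lambda>x. f x + g x)"
proof (induction k arbitrary: f g)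
  case 0 then show ?case by (simp add: continuous_on_add)
next
  case (Suc k)
  let ?G = "\<lambda>f x. \<chi> i. dif f x (axis i 1)"
  show ?case
  proof (rule Ck_on_SucI[OF S, where D = "\<lambda>x. ?G f x + ?G g x"])
    show "((\<lambda>x. f x + g x) has_derivative (\<lambda>h. (?G f x + ?G g x) \<bullet> h)) (at x)" if "x \<in> S" for x
      unfolding inner_add_left by (intro has_derivative_add Ck_on_gradient[OF Suc.prems(1) that] Ck_on_gradient[OF Suc.prems(2) that])
    show "Ck_on k S (\<lambda>x. (?G f x + ?G g x) $ i)" for i
      using Suc.IH Suc.prems by simp
  qed
qed

lemma Ck_on_mult:
  assumes S: "open S" shows "Ck_on k S f \<Longrightarrow> Ck_on k S g \<Longrightarrow> Ck_on k S (\<lambda>x. f x * g x)"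
proof (induction k arbitrary: f g)
  case 0 then show ?case by (simp add: continuous_on_mult)
next
  case (Suc k)
  let ?G = "\<lambda>f x. \<chi> i. dif f x (axis i 1)"
  show ?case
  proof (rule Ck_on_SucI[OF S, where D = "\<lambda>x. f x *\<^sub>R ?G g x + g x *\<^sub>R ?G f x"])
    show "((\<lambda>x. f x * g x) has_derivative (\<lambda>h. (f x *\<^sub>R ?G g x + g x *\<^sub>R ?G f x) \<bullet> h)) (at x)" if "x \<in> S" for x
      using has_derivative_mult[OF Ck_on_gradient[OF Suc.prems(1) that] Ck_on_gradient[OF Suc.prems(2) that]]
      by (simp add: inner_add_left mult.commute[of "g x"])
    have "Ck_on k S (\<lambda>x. f x * dif g x (axis i 1) + g x * dif f x (axis i 1))" for i
      by (intro Ck_on_add[OF S] Suc.IH Ck_on_Suc_imp[OF Suc.prems(1)] Ck_on_Suc_imp[OF Suc.prems(2)])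
        (use Suc.prems in auto)
    then show "Ck_on k S (\<lambda>x. (f x *\<^sub>R ?G g x + g x *\<^sub>R ?G f x) $ i)" for i by simp
  qed
qed

lemma Ck_on_sum:
  assumes S: "open S" and "\<And>i. i \<in> I \<Longrightarrow> Ck_on k S (f i)"
  shows "Ck_on k S (\<lambda>x. \<Sum>i\<in>I. f i x)"
  using assms(2) by (induction I rule: infinite_finite_induct) (auto intro: Ck_on_const[OF S] Ck_on_add[OF S])

lemma has_derivative_nth: "((\<lambda>x::real^3. x $ i) has_derivative (\<lambda>h. h $ i)) F"
  by (rule bounded_linear_imp_has_derivative[OF bounded_linear_vec_nth])

lemma Ck_on_coord: 
  assumes S: "open S" shows "Ck_on k S (\<lambda>x. (x - c) $ i)"
proof (cases k)
  case 0 then show ?thesis by (auto intro!: continuous_intros)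
next
  case (Suc l)
  have "Ck_on (Suc l) S (\<lambda>x. (x - c) $ i)"
  proof (rule Ck_on_SucI[OF S, where D = "\<lambda>_. axis i 1"])
    show "((\<lambda>x. (x - c) $ i) has_derivative (\<lambda>h. axis i 1 \<bullet> h)) (at x)" for x
      by (auto simp: inner_axis' intro!: derivative_eq_intros has_derivative_nth)
  qed (auto intro: Ck_on_const[OF S])
  then show ?thesis using Suc by simp
qed

lemma Ck_on_scale:
  assumes S: "open S" shows "Ck_on k S f \<Longrightarrow> Ck_on k {x. l *\<^sub>R x \<in> S} (\<lambda>x. f (l *\<^sub>R x))"
proof (induction k arbitrary: f)
  case 0
  then show ?case by (auto intro!: continuous_intros intro: continuous_on_compose2)
next
  case (Suc k)
  have o: "open {x. l *\<^sub>R x \<in> S}"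
    using open_vimage[OF S, of "\<lambda>x. l *\<^sub>R x"] by (simp add: vimage_def continuous_intros)
  let ?G = "\<lambda>x. \<chi> i. dif f x (axis i 1)"
  show ?case
  proof (rule Ck_on_SucI[OF o, where D = "\<lambda>x. l *\<^sub>R ?G (l *\<^sub>R x)"])
    show "((\<lambda>x. f (l *\<^sub>R x)) has_derivative (\<lambda>h. l *\<^sub>R ?G (l *\<^sub>R x) \<bullet> h)) (at x)" if "x \<in> {x. l *\<^sub>R x \<in> S}" for x
    proof -
      have 1: "((\<lambda>x. l *\<^sub>R x) has_derivative (\<lambda>h. l *\<^sub>R h)) (at x)" by (auto intro!: derivative_eq_intros)
      have 2: "(f has_derivative (\<lambda>h. ?G (l *\<^sub>R x) \<bullet> h)) (at (l *\<^sub>R x))"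
        by (rule Ck_on_gradient[OF Suc.prems]) (use that in auto)
      show ?thesis using diff_chain_at[OF 1 2] by (simp add: o_def)
    qed
    have "Ck_on k {x. l *\<^sub>R x \<in> S} (\<lambda>x. l * dif f (l *\<^sub>R x) (axis i 1))" for i
      by (intro Ck_on_mult[OF o] Ck_on_const[OF o] Suc.IH) (use Suc.prems in auto)
    then show "Ck_on k {x. l *\<^sub>R x \<in> S} (\<lambda>x. (l *\<^sub>R ?G (l *\<^sub>R x)) $ i)" for i by simp
  qed
qed

text \<open>The derivatives of \<open>exp (- 1 / t)\<close> are combinations of these functions, so the whole family is
  shown to be smooth at once.\<close>

definition flat_exp :: "nat \<Rightarrow> real \<Rightarrow> real" where
  "flat_exp n t = (if t > 0 then exp (- 1 / t) / t ^ n else 0)"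

lemma flat_exp_tendsto: "(flat_exp n \<longlongrightarrow> 0) (at 0)"
proof -
  have "((\<lambda>t::real. (1 / t) ^ n / exp (1 / t)) \<longlongrightarrow> 0) (at_right 0)"
    using filterlim_compose[OF tendsto_power_div_exp_0[of n] filterlim_inverse_at_top_right] by (simp add: inverse_eq_divide)
  moreover have "eventually (\<lambda>t::real. (1 / t) ^ n / exp (1 / t) = flat_exp n t) (at_right 0)"
    using eventually_at_right_less[of "0::real"]
    by eventually_elim (simp add: flat_exp_def exp_minus power_one_over field_simps)
  ultimately have r: "(flat_exp n \<longlongrightarrow> 0) (at_right 0)" by (rule Lim_transform_eventually)
  have "eventually (\<lambda>t::real. 0 = flat_exp n t) (at_left 0)"
    using eventually_at_left_real[of "-1" 0] by (auto elim!: eventually_mono simp: flat_exp_def)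
  then have l: "(flat_exp n \<longlongrightarrow> 0) (at_left 0)" by (rule Lim_transform_eventually[OF tendsto_const])
  show ?thesis using l r by (simp add: filterlim_split_at)
qed

lemma flat_exp_deriv:
  "(flat_exp n has_real_derivative (flat_exp (n + 2) t - real n * flat_exp (n + 1) t)) (at t)"
proof -
  consider "t > 0" | "t < 0" | "t = 0" by linarith
  then show ?thesis
  proof cases
    case 1
    have "((\<lambda>t. exp (- 1 / t) / t ^ n) has_real_derivative (flat_exp (n + 2) t - real n * flat_exp (n + 1) t)) (at t)"
    proof (cases n)
      case 0
      then show ?thesis using 1 by (auto intro!: derivative_eq_intros simp: flat_exp_def power2_eq_square field_simps)
    next
      case (Suc m)
      then show ?thesis using 1 by (auto intro!: derivative_eq_intros simp: flat_exp_def power2_eq_square divide_simps) (simp add: algebra_simps, cases m, auto)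
    qed
    then show ?thesis
      by (rule has_field_derivative_transform_within_open[where S = "{0<..}"]) (use 1 in \<open>auto simp: flat_exp_def\<close>)
  next
    case 2
    have "((\<lambda>t. 0) has_real_derivative 0) (at t)" by simp
    then have "(flat_exp n has_real_derivative 0) (at t)"
      by (rule has_field_derivative_transform_within_open[where S = "{..<0}"]) (use 2 in \<open>auto simp: flat_exp_def\<close>)
    then show ?thesis using 2 by (simp add: flat_exp_def)
  next
    case 3
    have "((\<lambda>h. (flat_exp n (0 + h) - flat_exp n 0) / h) \<longlongrightarrow> 0) (at 0)"
    proof (rule Lim_transform_eventually[OF flat_exp_tendsto[of "n + 1"]])
      show "eventually (\<lambda>t. flat_exp (n + 1) t = (flat_exp n (0 + t) - flat_exp n 0) / t) (at 0)"
        by (rule always_eventually) (auto simp: flat_exp_def)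
    qed
    then show ?thesis using 3 by (simp add: DERIV_def flat_exp_def)
  qed
qed

lemma Ck_on_flat_exp: "Ck_on k UNIV (\<lambda>x. flat_exp n (a * x $ i + b))"
proof (induction k arbitrary: n)
  case 0
  have "continuous_on UNIV (flat_exp n)"
    using flat_exp_deriv by (intro DERIV_continuous_on) (auto intro: has_field_derivative_at_within)
  then show ?case by (auto intro!: continuous_intros intro: continuous_on_compose2)
next
  case (Suc k)
  let ?g = "\<lambda>x. flat_exp (n + 2) (a * x $ i + b) - real n * flat_exp (n + 1) (a * x $ i + b)"
  have gk: "Ck_on k UNIV (\<lambda>x. a * ?g x)"
  proof -
    have "Ck_on k UNIV (\<lambda>x. a * flat_exp (n + 2) (a * x $ i + b) + (- a * real n) * flat_exp (n + 1) (a * x $ i + b))"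
      by (intro Ck_on_add Ck_on_mult Ck_on_const Suc.IH open_UNIV)
    then show ?thesis by (simp add: algebra_simps)
  qed
  show ?case
  proof (rule Ck_on_SucI[where D = "\<lambda>x. axis i (a * ?g x)"])
    fix x :: "real^3"
    have 1: "((\<lambda>x. a * x $ i + b) has_derivative (\<lambda>h. a * h $ i)) (at x)" by (auto intro!: derivative_eq_intros has_derivative_nth)
    have 2: "(flat_exp n has_derivative (\<lambda>h. h * ?g x)) (at (a * x $ i + b))"
      using flat_exp_deriv[of n "a * x $ i + b"] by (simp add: has_field_derivative_def mult_commute_abs)
    show "((\<lambda>x. flat_exp n (a * x $ i + b)) has_derivative (\<lambda>h. axis i (a * ?g x) \<bullet> h)) (at x)"
      using diff_chain_at[OF 1 2] by (simp add: o_def inner_axis' mult_ac)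
    show "Ck_on k UNIV (\<lambda>x. axis i (a * ?g x) $ l)" for l
      using gk Ck_on_const[OF open_UNIV, of k 0] by (cases "l = i") (auto simp: axis_def)
  qed simp
qed

text \<open>A product over the coordinates of \<open>exp (- 1 / (\<nu> + x\<^sub>i)) exp (- 1 / (\<nu> - x\<^sub>i))\<close> with
  \<open>\<nu> = \<mu> / 2\<close> lives on a cube inside the ball of radius \<open>\<mu>\<close>; it is then normalised.\<close>

lemma mollifier_exists:
  assumes \<mu>: "\<mu> > 0"
  shows "\<exists>\<kappa>. Cinf_on UNIV \<kappa> \<and> (\<forall>x. 0 \<le> \<kappa> x) \<and> (\<forall>x. \<mu> < norm x \<longrightarrow> \<kappa> x = 0) \<and> integrable lborel \<kappa> \<and> (\<integral>x. \<kappa> x \<partial>lborel) = 1"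
proof -
  let ?\<nu> = "\<mu> / 2"
  let ?f = "\<lambda>i x. flat_exp 0 (1 * x $ i + ?\<nu>) * flat_exp 0 (-1 * x $ i + ?\<nu>)"
  define \<kappa>0 where "\<kappa>0 x = ?f 1 x * (?f 2 x * ?f 3 x)" for x :: "real^3"
  have ck: "Ck_on k UNIV \<kappa>0" for k
    unfolding \<kappa>0_def by (intro Ck_on_mult Ck_on_flat_exp open_UNIV)
  have nn: "0 \<le> \<kappa>0 x" for x by (auto simp: \<kappa>0_def flat_exp_def)
  have cont: "continuous_on UNIV \<kappa>0" using ck[of 0] by simp
  have box: "\<kappa>0 x > 0" if "\<forall>i. \<bar>x $ i\<bar> < ?\<nu>" for x
  proof -
    have f: "?f i x > 0" for i using that[rule_format, of i] by (auto simp: flat_exp_def abs_less_iff)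
    show ?thesis unfolding \<kappa>0_def by (rule mult_pos_pos[OF f[of 1] mult_pos_pos[OF f[of 2] f[of 3]]])
  qed
  have out: "\<kappa>0 x = 0" if x: "x \<notin> halfcube ?\<nu> 0" for x
  proof -
    obtain i where "\<not> (- ?\<nu> \<le> x $ i \<and> x $ i < ?\<nu>)" using x by (auto simp: halfcube_def)
    then have "?f i x = 0" by (auto simp: flat_exp_def)
    then show ?thesis using exhaust_3[of i] by (auto simp: \<kappa>0_def)
  qed
  have supp: "\<kappa>0 x = 0" if "\<mu> < norm x" for x
    using out[of x] norm_halfcube0[of x ?\<nu>] that by fastforce
  have int: "integrable lborel \<kappa>0"
  proof -
    have "integrable lborel (\<lambda>x. indicator (halfcube ?\<nu> 0) x * \<kappa>0 x)"
      by (intro integrable_indicator_mult_continuous halfcube_borel bounded_halfcube cont)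
    moreover have "indicator (halfcube ?\<nu> 0) x * \<kappa>0 x = \<kappa>0 x" for x using out by (auto simp: indicator_def)
    ultimately show ?thesis by simp
  qed
  define I where "I = (\<integral>x. \<kappa>0 x \<partial>lborel)"
  have "I \<noteq> 0"
  proof
    assume "I = 0"
    then have ae: "AE x in lborel. \<kappa>0 x = 0"
      using integral_nonneg_eq_0_iff_AE[OF int] nn by (simp add: I_def)
    have "AE x::real^3 in lborel. x \<notin> box (\<chi> i. - ?\<nu>) (\<chi> i. ?\<nu>)"
      using ae
    proof eventually_elim
      case (elim x)
      show ?case
      proof
        assume "x \<in> box (\<chi> i. - ?\<nu>) (\<chi> i. ?\<nu>)"
        then have b: "- ?\<nu> < x $ i \<and> x $ i < ?\<nu>" for i unfolding mem_box_cart vec_lambda_beta by blast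
        have "\<bar>x $ i\<bar> < ?\<nu>" for i using b[of i] by linarith
        then show False using box[of x] elim by simp
      qed
    qed
    then have "emeasure lborel (box (\<chi> i. - ?\<nu>) (\<chi> i. ?\<nu>) :: (real^3) set) = 0"
      by (subst (asm) AE_iff_measurable[OF _ refl]) auto
    moreover have "emeasure lborel (box (\<chi> i. - ?\<nu>) (\<chi> i. ?\<nu>) :: (real^3) set) = ennreal (\<Prod>b\<in>Basis. (((\<chi> i. ?\<nu>) :: real^3) - (\<chi> i. - ?\<nu>)) \<bullet> b)"
      using \<mu> by (intro emeasure_lborel_box) (auto simp: Basis_vec_def inner_axis)
    ultimately show False
      using \<mu> unfolding prod_Basis_real3 by (simp add: prod_cyclic[of _ 1])
  qed
  moreover have "I \<ge> 0" unfolding I_def using nn by (intro integral_nonneg_AE) auto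
  ultimately have I: "I > 0" by simp
  have "Ck_on k UNIV (\<lambda>x. \<kappa>0 x * (1 / I))" for k
    by (intro Ck_on_mult Ck_on_const ck open_UNIV)
  then have "Cinf_on UNIV (\<lambda>x. \<kappa>0 x * (1 / I))" by (simp add: Cinf_on_def)
  moreover have "(\<integral>x. \<kappa>0 x * (1 / I) \<partial>lborel) = 1" using int I by (simp add: I_def)
  moreover have "integrable lborel (\<lambda>x. \<kappa>0 x * (1 / I))" using int by simp
  ultimately show ?thesis using nn I supp by (intro exI[of _ "\<lambda>x. \<kappa>0 x * (1 / I)"]) auto
qed

section \<open>The field of a point charge\<close>

text \<open>The Coulomb field, with total flux \<open>point_flux\<close> through cubes about \<open>c\<close>. Multiples of
  \<open>1 / point_flux\<close> give fields with a prescribed charge.\<close>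

definition point_field :: "real^3 \<Rightarrow> real^3 \<Rightarrow> real^3" where
  "point_field c x = (1 / norm (x - c)) ^ 3 *\<^sub>R (x - c)"

text \<open>The normal component of the Coulomb field on the faces of the cube of half side \<open>2\<close>. Such a cube
  about a point of the unit ball contains that ball.\<close>

definition point_density :: "3 \<Rightarrow> real \<Rightarrow> real \<times> real \<Rightarrow> real" where
  "point_density j s u = 2 / norm (fpt j (s * 2) u) ^ 3"

definition point_flux :: real where
  "point_flux = (face_sum (\<lambda>j s. \<integral>u. indicator (face 2) u * point_density j s u \<partial>lborel))"

lemma has_derivative_inverse_norm:
  assumes "x \<noteq> c"
  shows "((\<lambda>x::real^3. 1 / norm (x - c)) has_derivative (\<lambda>h. (- ((1 / norm (x - c)) ^ 3 *\<^sub>R (x - c))) \<bullet> h)) (at x)"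
proof -
  have "((\<lambda>x. norm (x - c)) has_derivative (\<lambda>h. sgn (x - c) \<bullet> h)) (at x)"
  proof -
    have 1: "((\<lambda>x. x - c) has_derivative (\<lambda>h. h)) (at x)" by (auto intro!: derivative_eq_intros)
    have 2: "(norm has_derivative (\<lambda>h. sgn (x - c) \<bullet> h)) (at (x - c))"
      using GDERIV_norm[of "x - c"] assms by (simp add: gderiv_def inner_commute)
    show ?thesis using diff_chain_at[OF 1 2] by (simp add: o_def)
  qed
  then have "((\<lambda>x. inverse (norm (x - c))) has_derivative (\<lambda>h. - (inverse (norm (x - c)) * (sgn (x - c) \<bullet> h) * inverse (norm (x - c))))) (at x)"
    using assms by (intro Deriv.has_derivative_inverse) auto
  moreover have "- (inverse (norm (x - c)) * (sgn (x - c) \<bullet> h) * inverse (norm (x - c))) = (- ((1 / norm (x - c)) ^ 3 *\<^sub>R (x - c))) \<bullet> h" for h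
    unfolding sgn_div_norm inner_scaleR_left inner_minus_left by (simp add: power3_eq_cube inverse_eq_divide)
  ultimately show ?thesis by (simp add: inverse_eq_divide)
qed

text \<open>The gradient of \<open>1 / |x - c|\<close> is a polynomial in the coordinates and in the function itself, which
  makes an induction on the order of differentiability possible.\<close>

lemma Ck_on_inverse_norm:
  assumes S: "open S" and c: "c \<notin> S"
  shows "Ck_on k S (\<lambda>x. 1 / norm (x - c))"
proof (induction k)
  case 0 then show ?case using c by (auto intro!: continuous_intros)
next
  case (Suc k)
  show ?case
  proof (rule Ck_on_SucI[OF S])
    show "((\<lambda>x. 1 / norm (x - c)) has_derivative (\<lambda>h. (- ((1 / norm (x - c)) ^ 3 *\<^sub>R (x - c))) \<bullet> h)) (at x)" if "x \<in> S" for x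
      using that c by (intro has_derivative_inverse_norm) auto
    have "Ck_on k S (\<lambda>x. (-1) * ((1 / norm (x - c)) * ((1 / norm (x - c)) * (1 / norm (x - c)))) * (x - c) $ i)" for i
      by (intro Ck_on_mult Ck_on_const Ck_on_coord S Suc)
    then show "Ck_on k S (\<lambda>x. (- ((1 / norm (x - c)) ^ 3 *\<^sub>R (x - c))) $ i)" for i
      by (simp add: power3_eq_cube mult.assoc)
  qed
qed

lemma Ck_on_point_field:
  assumes S: "open S" and c: "c \<notin> S"
  shows "Ck_on k S (\<lambda>x. point_field c x $ i)"
proof -
  have "Ck_on k S (\<lambda>x. ((1 / norm (x - c)) * ((1 / norm (x - c)) * (1 / norm (x - c)))) * (x - c) $ i)"
    by (intro Ck_on_mult Ck_on_coord Ck_on_inverse_norm S c)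
  then show ?thesis by (simp add: point_field_def power3_eq_cube mult.assoc)
qed

lemma point_field_borel [measurable]: "point_field c \<in> borel_measurable borel"
  unfolding point_field_def[abs_def] by measurable

lemma norm_fpt_ge: "norm (fpt j z u) \<ge> \<bar>z\<bar>"
  using component_le_norm_cart[of "fpt j z u" j] by simp

lemma point_density_continuous: assumes "s \<in> {-1, 1}" shows "continuous_on UNIV (point_density j s)"
proof -
  have "norm (fpt j (s * 2) u) \<noteq> 0" for u using norm_fpt_ge[of "s * 2" j u] assms by auto
  then show ?thesis unfolding point_density_def[abs_def] by (intro continuous_intros) auto
qed

lemma point_density_bounds:
  assumes "s \<in> {-1, 1}"
  shows "0 < point_density j s u" "point_density j s u \<le> 1" "u \<in> face 2 \<Longrightarrow> 1 / 32 \<le> point_density j s u"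
proof -
  have n: "norm (fpt j (s * 2) u) \<ge> 2" using norm_fpt_ge[of "s * 2" j u] assms by auto
  have "(2::real) ^ 3 \<le> norm (fpt j (s * 2) u) ^ 3" using n by (intro power_mono) auto
  then have n3: "8 \<le> norm (fpt j (s * 2) u) ^ 3" by simp
  show "0 < point_density j s u" unfolding point_density_def using n3 by (intro divide_pos_pos) linarith+
  show "point_density j s u \<le> 1" unfolding point_density_def using n3 by (simp add: divide_le_eq)
  show "1 / 32 \<le> point_density j s u" if u: "u \<in> face 2"
  proof -
    have "norm (fpt j (s * 2) u) \<le> 2 * 2" using assms u by (intro norm_fpt_le) auto
    then have "norm (fpt j (s * 2) u) ^ 3 \<le> (2 * 2) ^ 3" by (intro power_mono) auto
    then have "1 / 32 * norm (fpt j (s * 2) u) ^ 3 \<le> 2" by simp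
    then show ?thesis unfolding point_density_def using n3 by (subst pos_le_divide_eq) linarith+
  qed
qed

lemma point_density_integrable:
  "s \<in> {-1, 1} \<Longrightarrow> integrable lborel (\<lambda>u. indicator (face 2) u * point_density j s u)"
  by (intro integrable_indicator_mult_continuous point_density_continuous bounded_face borel_rectangle)

lemma point_flux_pos: "point_flux > 0"
proof -
  have "0 < (face_int 2 (\<lambda>u. point_density j s u))" if s: "s \<in> {-1, 1}" for j s
  proof -
    have m: "measure lborel (face 2) = 16"
      using emeasure_face[of 2] by (simp add: measure_def)
    have "0 < (1/32) * measure lborel (face 2)" by (simp only: m)
    also have "\<dots> = (\<integral>u. indicator (face 2) u * (1/32) \<partial>(lborel :: (real \<times> real) measure))" by simp
    also have "\<dots> \<le> (face_int 2 (\<lambda>u. point_density j s u))"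
    proof (rule integral_mono)
      show "integrable (lborel :: (real \<times> real) measure) (\<lambda>u. indicator (face 2) u * (1/32::real))"
        by (intro integrable_indicator_mult_continuous bounded_face borel_rectangle continuous_intros)
      show "indicator (face 2) u * (1/32) \<le> indicator (face 2) u * point_density j s u" for u
        using point_density_bounds(3)[OF s, of u j] by (auto simp: indicator_def)
    qed (rule point_density_integrable[OF s])
    finally show ?thesis .
  qed
  then show ?thesis unfolding point_flux_def by (intro sum_pos) auto
qed

text \<open>The Coulomb field is radial and homogeneous of degree \<open>-2\<close>, so it is the radial extension of its
  values on any cube about \<open>c\<close>. Its divergence and integrability thus follow from the corresponding
  facts about \<open>cone_field\<close>.\<close>

lemma point_field_cone:
  assumes s: "s \<in> {-1, 1}" and x: "x \<in> cone 2 c j s"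
  shows "cone_field 2 c j s (point_density j s) x = point_field c x"
proof -
  define d where "d = s * (x - c) $ j"
  have d: "0 < d" "d < 2" using x by (auto simp: cone_def d_def)
  let ?u = "(2 / d) *\<^sub>R ((x - c) $ (j + 1), (x - c) $ (j + 2))"
  have sd: "s * d = (x - c) $ j" using s by (auto simp: d_def)
  have "fpt j (s * 2) ?u = (2 / d) *\<^sub>R fpt j (s * d) ((x - c) $ (j + 1), (x - c) $ (j + 2))"
    unfolding scaleR_fpt using d by (simp add: mult.commute[of s 2])
  also have "fpt j (s * d) ((x - c) $ (j + 1), (x - c) $ (j + 2)) = x - c"
    unfolding sd by (rule fpt_cases[symmetric])
  finally have Y: "norm (fpt j (s * 2) ?u) = (2 / d) * norm (x - c)" using d by simp
  have x0: "norm (x - c) \<noteq> 0" using d by (auto simp: d_def)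
  have "point_density j s ?u * 2\<^sup>2 / d ^ 3 = (1 / norm (x - c)) ^ 3"
    unfolding point_density_def Y using d x0 by (simp add: field_simps power3_eq_cube power2_eq_square)
  then show ?thesis using x unfolding cone_field_def Let_def d_def[symmetric] point_field_def by simp
qed

lemma AE_off_hyperplane:
  fixes v :: "real^3" assumes "v \<noteq> 0" shows "AE x in lborel. v \<bullet> x \<noteq> b"
proof -
  have "negligible {x. v \<bullet> x = b}" using assms by (intro negligible_hyperplane) auto
  then have "{x. v \<bullet> x = b} \<in> null_sets lebesgue" by (simp add: negligible_iff_null_sets)
  then have "AE x in lebesgue. x \<notin> {x. v \<bullet> x = b}" by (rule AE_not_in)
  then show ?thesis by (simp add: AE_completion_iff)
qed

text \<open>Off these planes the pyramids over the six faces are disjoint and fill the cube.\<close>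

lemma AE_distinct_coords:
  fixes c :: "real^3"
  shows "AE x in lborel. \<forall>i j. i \<noteq> j \<longrightarrow> \<bar>(x - c) $ i\<bar> \<noteq> \<bar>(x - c) $ j\<bar>"
proof -
  have "AE x in lborel. i \<noteq> j \<longrightarrow> \<bar>(x - c) $ i\<bar> \<noteq> \<bar>(x - c) $ j\<bar>" for i j :: 3
  proof (cases "i = j")
    case False
    have "(axis i 1 - axis j 1 :: real^3) $ i = 1" "(axis i 1 + axis j 1 :: real^3) $ i = 1" using False by (auto simp: axis_def)
    then have "axis i 1 - axis j 1 \<noteq> (0 :: real^3)" "axis i 1 + axis j 1 \<noteq> (0 :: real^3)" by (metis zero_index zero_neq_one)+
    from AE_off_hyperplane[OF this(1), of "c $ i - c $ j"] AE_off_hyperplane[OF this(2), of "c $ i + c $ j"]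
    show ?thesis
      by eventually_elim (auto simp: abs_eq_iff inner_diff_left inner_add_left inner_axis' algebra_simps)
  qed simp
  then show ?thesis by (simp add: AE_all_countable)
qed

lemma cone_cover:
  assumes x: "\<And>i j. i \<noteq> j \<Longrightarrow> \<bar>(x - c) $ i\<bar> \<noteq> \<bar>(x - c) $ j\<bar>" and b: "\<And>i. \<bar>(x - c) $ i\<bar> < r"
  shows "\<exists>j. \<exists>s\<in>{-1, 1}. x \<in> cone r c j s \<and> (\<forall>i. \<forall>t\<in>{-1, 1}. (i, t) \<noteq> (j, s) \<longrightarrow> x \<notin> cone r c i t)"
proof -
  let ?y = "\<lambda>i. \<bar>(x - c) $ i\<bar>"
  have "Max (range ?y) \<in> range ?y" by (rule Max_in) auto
  then obtain j where "Max (range ?y) = ?y j" by blast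
  then have j: "?y i \<le> ?y j" for i by (metis Max_ge finite rangeI finite_imageI)
  have lt: "?y i < ?y j" if "i \<noteq> j" for i using j[of i] x[OF that] by linarith
  have y0: "?y j > 0" using lt[of "j + 1"] by simp
  \<comment> \<open>The pyramid containing \<open>x\<close> belongs to the coordinate of largest modulus.\<close>
  define s where "s = sgn ((x - c) $ j)"
  have s: "s \<in> {-1, 1}" "s * (x - c) $ j = ?y j" using y0 by (auto simp: s_def sgn_if)
  have "x \<in> cone r c j s"
    unfolding cone_def mem_Collect_eq s(2) using y0 b[of j] lt[of "j + 1"] lt[of "j + 2"] by auto
  moreover have "x \<notin> cone r c i t" if t: "t \<in> {-1, 1}" and ne: "(i, t) \<noteq> (j, s)" for i t
  proof
    assume c: "x \<in> cone r c i t"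
    show False
    proof (cases "i = j")
      case True
      then have "t = - s" using ne t s(1) by auto
      then have "t * (x - c) $ i = - ?y j" using s(2) True by simp
      then show False using c y0 by (simp add: cone_def)
    next
      case False
      have "\<forall>k. \<bar>(x - c) $ k\<bar> \<le> \<bar>t * (x - c) $ i\<bar>"
        unfolding all_cyclic[of _ i] using c t by (auto simp: cone_def abs_mult)
      then have "?y j \<le> ?y i" using t by (auto simp: abs_mult)
      then show False using lt[OF False] by simp
    qed
  qed
  ultimately show ?thesis using s(1) by blast
qed

lemma point_field_cones:
  assumes x: "\<And>i j. i \<noteq> j \<Longrightarrow> \<bar>(x - c) $ i\<bar> \<noteq> \<bar>(x - c) $ j\<bar>" and b: "\<And>i. \<bar>(x - c) $ i\<bar> < 2"
  shows "point_field c x = (face_sum (\<lambda>j s. cone_field 2 c j s (point_density j s) x))"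
proof -
  obtain j s where s: "s \<in> {-1, 1}" and c: "x \<in> cone 2 c j s"
    and u: "\<And>i t. t \<in> {-1, 1} \<Longrightarrow> (i, t) \<noteq> (j, s) \<Longrightarrow> x \<notin> cone 2 c i t" using cone_cover[OF x b] by blast
  have "(\<Sum>i\<in>UNIV. \<Sum>t\<in>{-1, 1}. cone_field 2 c i t (point_density i t) x) =
     (\<Sum>k\<in>UNIV \<times> {-1, 1}. cone_field 2 c (fst k) (snd k) (point_density (fst k) (snd k)) x)"
    by (simp only: sum.cartesian_product case_prod_beta')
  also have "\<dots> = (\<Sum>k\<in>{(j, s)}. cone_field 2 c (fst k) (snd k) (point_density (fst k) (snd k)) x)"
  proof (rule sum.mono_neutral_right)
    show "\<forall>k\<in>UNIV \<times> {-1, 1} - {(j, s)}. cone_field 2 c (fst k) (snd k) (point_density (fst k) (snd k)) x = 0"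
    proof
      fix k assume k: "k \<in> UNIV \<times> {-1, 1} - {(j, s)}"
      then have "x \<notin> cone 2 c (fst k) (snd k)" by (intro u) auto
      then show "cone_field 2 c (fst k) (snd k) (point_density (fst k) (snd k)) x = 0"
        by (simp add: cone_field_def Let_def)
    qed
  qed (use s in auto)
  also have "\<dots> = point_field c x" using point_field_cone[OF s c] by simp
  finally show ?thesis by simp
qed

lemma point_density_borel [measurable]: "s \<in> {-1, 1} \<Longrightarrow> point_density j s \<in> borel_measurable borel"
  by (intro borel_measurable_continuous_onI point_density_continuous)

lemma point_field_divergence:
  assumes c: "norm c < 1" and t: "test_on 1 \<phi> G"
  shows "integrable lborel (\<lambda>x. point_field c x \<bullet> G x)"
    and "(\<integral>x. point_field c x \<bullet> G x \<partial>lborel) = - point_flux * \<phi> c"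
proof -
  have g: "has_gradient \<phi> G" using t by (simp add: test_on_def)
  note [measurable] = has_gradient_borel[OF g]
  let ?C = "\<lambda>j s x. cone_field 2 c j s (point_density j s) x \<bullet> G x"
  have i: "integrable lborel (?C j s)" if "s \<in> {-1, 1}" for j s
    by (rule cone_divergence(1)[OF that _ point_density_borel[OF that] point_density_integrable[OF that] g]) simp
  have ae: "AE x in lborel. point_field c x \<bullet> G x = (face_sum (\<lambda>j s. ?C j s x))"
    using AE_distinct_coords[of c]
  proof eventually_elim
    case (elim x)
    show ?case
    proof (cases "\<forall>i. \<bar>(x - c) $ i\<bar> < 2")
      case True
      then have "point_field c x = (face_sum (\<lambda>j s. cone_field 2 c j s (point_density j s) x))"
        using elim by (intro point_field_cones) auto
      then show ?thesis by (simp only: inner_sum_left)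
    next
      case False
      then obtain i where "\<bar>(x - c) $ i\<bar> \<ge> 2" by (auto simp: not_less)
      then have "norm (x - c) \<ge> 2" using component_le_norm_cart[of "x - c" i] by linarith
      then have "norm x > 1" using norm_triangle_ineq4[of x c] c by linarith
      then have "G x = 0" using test_on_gradient_zero[OF t] by simp
      then show ?thesis by simp
    qed
  qed
  have iS: "integrable lborel (\<lambda>x. \<Sum>j\<in>UNIV. \<Sum>s\<in>{-1, 1}. ?C j s x)"
    by (intro Bochner_Integration.integrable_sum i)
  have m: "(\<lambda>x. point_field c x \<bullet> G x) \<in> borel_measurable lborel" by measurable
  show "integrable lborel (\<lambda>x. point_field c x \<bullet> G x)"
    using integrable_cong_AE[OF m borel_measurable_integrable[OF iS] ae] iS by simp
  have "(\<integral>x. point_field c x \<bullet> G x \<partial>lborel) = (\<integral>x. (face_sum (\<lambda>j s. ?C j s x)) \<partial>lborel)"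
    by (rule integral_cong_AE[OF m borel_measurable_integrable[OF iS] ae])
  also have "\<dots> = (face_sum (\<lambda>j s. \<integral>x. ?C j s x \<partial>lborel))"
    by (subst Bochner_Integration.integral_sum, intro Bochner_Integration.integrable_sum i, assumption)
       (intro sum.cong refl Bochner_Integration.integral_sum i)
  also have "\<dots> = (face_sum (\<lambda>j s. (face_int 2 (\<lambda>u. point_density j s u)) * (- \<phi> c)))"
  proof (intro sum.cong refl)
    fix j :: 3 and s :: real assume s: "s \<in> {-1, 1}"
    have "(\<integral>x. ?C j s x \<partial>lborel) = (\<integral>u. indicator (face 2) u * point_density j s u * (\<phi> (c + fpt j (s * 2) u) - \<phi> c) \<partial>lborel)"
      by (rule cone_divergence(2)[OF s _ point_density_borel[OF s] point_density_integrable[OF s] g]) simp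
    moreover have "\<phi> (c + fpt j (s * 2) u) = 0" for u
    proof -
      have "2 \<le> norm (fpt j (s * 2) u)" using norm_fpt_ge[of "s * 2" j u] s by auto
      then have "1 \<le> norm (c + fpt j (s * 2) u)" using norm_triangle_ineq4[of "c + fpt j (s * 2) u" c] c by simp
      then show ?thesis using t by (simp add: test_on_def)
    qed
    ultimately show "(\<integral>x. ?C j s x \<partial>lborel) = (face_int 2 (\<lambda>u. point_density j s u)) * (- \<phi> c)"
      by simp
  qed
  finally show "(\<integral>x. point_field c x \<bullet> G x \<partial>lborel) = - point_flux * \<phi> c"
    unfolding point_flux_def sum_distrib_right[symmetric] by (simp only: mult_minus_left mult_minus_right)
qed

lemma point_field_Lp:
  assumes c: "norm c < 1" and p: "1 \<le> p" "p < 3/2"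
  shows "(Lp_int_on (ball 0 1) p (\<lambda>x. point_field c x)) < \<infinity>"
proof -
  let ?V = "\<lambda>j s x. ennreal (norm (cone_field 2 c j s (point_density j s) x) powr p)"
  have fin: "(\<integral>\<^sup>+x. ?V j s x \<partial>lborel) < \<infinity>" if s: "s \<in> {-1, 1}" for j s
  proof -
    have "(\<integral>\<^sup>+x. ?V j s x \<partial>lborel) \<le> ennreal (2 * 2 powr p / (3 - 2 * p)) * (\<integral>\<^sup>+u. ennreal (\<bar>point_density j s u\<bar> powr p) * indicator (face 2) u \<partial>lborel)"
      using cone_energy[OF p s _ point_density_borel[OF s], of 2] by simp
    also have "\<dots> \<le> ennreal (2 * 2 powr p / (3 - 2 * p)) * (\<integral>\<^sup>+u. 1 * indicator (face 2) u \<partial>(lborel :: (real \<times> real) measure))"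
    proof (intro mult_left_mono nn_integral_mono mult_right_mono)
      fix u
      have "\<bar>point_density j s u\<bar> powr p \<le> 1 powr p"
        using point_density_bounds(1,2)[OF s, of j u] p by (intro powr_mono2) auto
      then show "ennreal (\<bar>point_density j s u\<bar> powr p) \<le> 1" by simp
    qed auto
    also have "\<dots> < \<infinity>" using emeasure_face[of 2] by (simp add: ennreal_mult_less_top)
    finally show ?thesis .
  qed
  have "(Lp_int_on (ball 0 1) p (\<lambda>x. point_field c x)) \<le> (\<integral>\<^sup>+x. (face_sum (\<lambda>j s. ?V j s x)) \<partial>lborel)"
  proof (rule nn_integral_mono_AE)
    show "AE x in lborel. indicator (ball 0 1) x * ennreal (norm (point_field c x) powr p) \<le> (face_sum (\<lambda>j s. ?V j s x))"
      using AE_distinct_coords[of c]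
    proof eventually_elim
      case (elim x)
      show ?case
      proof (cases "norm x < 1")
        case True
        have b: "\<bar>(x - c) $ i\<bar> < 2" for i
          using component_le_norm_cart[of "x - c" i] norm_triangle_ineq4[of x c] c True by linarith
        obtain j s where s: "s \<in> {-1, 1}" and cx: "x \<in> cone 2 c j s" using cone_cover[of x c 2] elim b by blast
        have "ennreal (norm (point_field c x) powr p) = ?V j s x" using point_field_cone[OF s cx] by simp
        also have "\<dots> \<le> (\<Sum>s\<in>{-1, 1}. ?V j s x)" by (rule member_le_sum[OF s]) auto
        also have "\<dots> \<le> (face_sum (\<lambda>j s. ?V j s x))" by (rule member_le_sum) auto
        finally show ?thesis using True by simp
      qed simp
    qed
  qed
  also have "\<dots> = (face_sum (\<lambda>j s. \<integral>\<^sup>+x. ?V j s x \<partial>lborel))"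
    by (simp add: nn_integral_sum nn_integral_add)
  also have "\<dots> < \<infinity>" using fin by (simp add: sum_cyclic[of _ 1] del: ennreal_plus)
  finally show ?thesis .
qed

section \<open>Mollification of divergence free fields\<close>

definition mollify :: "(real^3 \<Rightarrow> real) \<Rightarrow> (real^3 \<Rightarrow> real^3) \<Rightarrow> real^3 \<Rightarrow> real^3" where
  "mollify \<kappa> Y x = (\<integral>y. \<kappa> (x - y) *\<^sub>R Y y \<partial>lborel)"

definition bump :: "real \<Rightarrow> (real^3 \<Rightarrow> real) \<Rightarrow> bool" where
  "bump \<mu> \<kappa> \<longleftrightarrow> Cinf_on UNIV \<kappa> \<and> (\<forall>x. \<mu> < norm x \<longrightarrow> \<kappa> x = 0)"

lemma bump_continuous: "bump \<mu> \<kappa> \<Longrightarrow> continuous_on UNIV \<kappa>"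
  unfolding bump_def Cinf_on_def using Ck_on.simps(1) by blast

lemma bump_bounded:
  assumes b: "bump \<mu> \<kappa>" shows "\<exists>B\<ge>0. \<forall>x. \<bar>\<kappa> x\<bar> \<le> B"
proof -
  have "bounded (\<kappa> ` cball 0 \<mu>)"
    by (intro compact_imp_bounded compact_continuous_image continuous_on_subset[OF bump_continuous[OF b]]) auto
  then obtain B where B: "\<And>x. x \<in> cball 0 \<mu> \<Longrightarrow> norm (\<kappa> x) \<le> B" by (auto simp: bounded_iff simp del: mem_cball mem_cball_0)
  have "\<bar>\<kappa> x\<bar> \<le> max B 0" for x
    using B[of x] b by (cases "norm x \<le> \<mu>") (auto simp: bump_def)
  then show ?thesis by (intro exI[of _ "max B 0"]) auto
qed

lemma bump_partial:
  assumes b: "bump \<mu> \<kappa>" shows "bump \<mu> (\<lambda>x. dif \<kappa> x (axis i 1))"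
proof -
  have "Ck_on k UNIV (\<lambda>x. dif \<kappa> x (axis i 1))" for k
    using b unfolding bump_def Cinf_on_def by (metis Ck_on.simps(2))
  moreover have "dif \<kappa> x (axis i 1) = 0" if x: "\<mu> < norm x" for x
  proof -
    have "((\<lambda>_. 0) has_derivative (\<lambda>_. 0)) (at x)" by simp
    then have "(\<kappa> has_derivative (\<lambda>_. 0)) (at x)"
    proof (rule has_derivative_transform_within_open)
      show "open {y. \<mu> < norm y}" by (intro open_Collect_less continuous_intros)
    qed (use b x in \<open>auto simp: bump_def\<close>)
    then show ?thesis by (simp add: dif_eq)
  qed
  ultimately show ?thesis by (simp add: bump_def Cinf_on_def)
qed

text \<open>The gradient is uniformly continuous because it is continuous with compact support; the mean value
  inequality on the segment from \<open>z\<close> to \<open>z + h\<close> does the rest.\<close>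

lemma bump_uniform_derivative:
  assumes b: "bump \<mu> \<kappa>" and e: "e > 0"
  shows "\<exists>d>0. \<forall>z h. norm h < d \<longrightarrow> \<bar>\<kappa> (z + h) - \<kappa> z - (\<chi> i. dif \<kappa> z (axis i 1)) \<bullet> h\<bar> \<le> e * norm h"
proof -
  let ?G = "\<lambda>x. \<chi> i. dif \<kappa> x (axis i 1)"
  have "Ck_on 1 UNIV \<kappa>" using b by (simp add: bump_def Cinf_on_def)
  then have D: "(\<kappa> has_derivative (\<lambda>h. ?G x \<bullet> h)) (at x)" for x by (intro Ck_on_gradient[of 0]) auto
  have G0: "?G x = 0" if "\<mu> < norm x" for x
    using bump_partial[OF b] that by (simp add: vec_eq_iff bump_def)
  have Gc: "continuous_on UNIV ?G"
    using bump_continuous[OF bump_partial[OF b]] by (intro continuous_on_vec_lambda) 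
  have "uniformly_continuous_on (cball 0 (\<mu> + 2)) ?G"
    by (intro compact_uniformly_continuous continuous_on_subset[OF Gc]) auto
  then obtain d where d: "d > 0" "\<And>x y. x \<in> cball 0 (\<mu> + 2) \<Longrightarrow> y \<in> cball 0 (\<mu> + 2) \<Longrightarrow> dist y x < d \<Longrightarrow> dist (?G y) (?G x) < e"
    using e unfolding uniformly_continuous_on_def by metis
  have near: "norm (?G y - ?G x) \<le> e" if "dist y x < min d 1" for x y
  proof (cases "norm x \<le> \<mu> + 1")
    case True
    then have "norm y \<le> \<mu> + 2" using that norm_triangle_ineq[of x "y - x"] by (simp add: dist_norm)
    then show ?thesis using d(2)[of x y] True that by (simp add: dist_norm)
  next
    case False
    then have "\<mu> < norm y" using that norm_triangle_ineq[of y "x - y"] by (simp add: dist_norm norm_minus_commute)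
    then show ?thesis using False e G0[of x] G0[of y] by simp
  qed
  have "\<bar>\<kappa> (z + h) - \<kappa> z - ?G z \<bullet> h\<bar> \<le> e * norm h" if h: "norm h < min d 1" for z h
  proof -
    have "norm (\<kappa> (z + h) - \<kappa> z - (\<lambda>h. ?G z \<bullet> h) ((z + h) - z)) \<le> norm ((z + h) - z) * e"
    proof (rule differentiable_bound_linearization[where S = "ball z (min d 1)" and f' = "\<lambda>x h. ?G x \<bullet> h"])
      fix t :: real assume t: "t \<in> {0..1}"
      have "t * norm h \<le> 1 * norm h" using t by (intro mult_right_mono) auto
      then show "z + t *\<^sub>R (z + h - z) \<in> ball z (min d 1)" using h t by (simp add: dist_norm)
    next
      fix x assume "x \<in> ball z (min d 1)"
      show "(\<kappa> has_derivative (\<lambda>h. ?G x \<bullet> h)) (at x within ball z (min d 1))"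
        by (rule has_derivative_at_withinI[OF D])
    next
      fix x assume x: "x \<in> ball z (min d 1)"
      show "onorm ((\<lambda>h. ?G x \<bullet> h) - (\<lambda>h. ?G z \<bullet> h)) \<le> e"
      proof (rule onorm_bound)
        fix v
        have "norm ((?G x - ?G z) \<bullet> v) \<le> norm (?G x - ?G z) * norm v" by (rule Cauchy_Schwarz_ineq2[folded real_norm_def])
        also have "\<dots> \<le> e * norm v" using near[of x z] x by (intro mult_right_mono) (auto simp: dist_commute)
        finally show "norm (((\<lambda>h. ?G x \<bullet> h) - (\<lambda>h. ?G z \<bullet> h)) v) \<le> e * norm v" by (simp add: inner_diff_left)
      qed (use e in simp)
    next
      show "z \<in> ball z (min d 1)" using d(1) by simp
    qed
    then show ?thesis by (simp add: mult.commute)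
  qed
  then show ?thesis using d(1) by (intro exI[of _ "min d 1"]) auto
qed

lemma integrable_bump_mult:
  assumes b: "bump \<mu> \<kappa>" and Y: "integrable lborel Y"
  shows "integrable lborel (\<lambda>y. \<kappa> (x - y) * (Y y :: real))"
proof -
  obtain B where B: "B \<ge> 0" "\<And>x. \<bar>\<kappa> x\<bar> \<le> B" using bump_bounded[OF b] by blast
  have [measurable]: "\<kappa> \<in> borel_measurable borel" using bump_continuous[OF b] by (rule borel_measurable_continuous_onI)
  note [measurable] = borel_measurable_integrable[OF Y]
  show ?thesis
    by (rule Bochner_Integration.integrable_bound[OF integrable_mult_right[OF Y, of B]])
      (use B in \<open>auto simp: abs_mult intro!: AE_I2 mult_mono\<close>)
qed

text \<open>The uniform first order expansion of the kernel may be integrated against \<open>Y\<close>.\<close>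

lemma convolution_has_derivative:
  assumes b: "bump \<mu> \<kappa>" and Y: "integrable lborel (Y :: real^3 \<Rightarrow> real)"
  shows "((\<lambda>x. \<integral>y. \<kappa> (x - y) * Y y \<partial>lborel) has_derivative
     (\<lambda>h. (\<chi> i. \<integral>y. dif \<kappa> (x - y) (axis i 1) * Y y \<partial>lborel) \<bullet> h)) (at x)"
  unfolding has_derivative_at_alt
proof (intro conjI allI impI)
  show "bounded_linear (\<lambda>h. (\<chi> i. \<integral>y. dif \<kappa> (x - y) (axis i 1) * Y y \<partial>lborel) \<bullet> h)"
    by (rule bounded_linear_inner_right)
  fix e :: real assume e: "e > 0"
  define M where "M = (\<integral>y. \<bar>Y y\<bar> \<partial>lborel)"
  have M: "M \<ge> 0" unfolding M_def by simp
  obtain d where d: "d > 0" "\<And>z h. norm h < d \<Longrightarrow> \<bar>\<kappa> (z + h) - \<kappa> z - (\<chi> i. dif \<kappa> z (axis i 1)) \<bullet> h\<bar> \<le> e / (M + 1) * norm h"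
    using bump_uniform_derivative[OF b, of "e / (M + 1)"] e M by auto
  have "norm ((\<integral>y. \<kappa> (w - y) * Y y \<partial>lborel) - (\<integral>y. \<kappa> (x - y) * Y y \<partial>lborel) - (\<chi> i. \<integral>y. dif \<kappa> (x - y) (axis i 1) * Y y \<partial>lborel) \<bullet> (w - x)) \<le> e * norm (w - x)"
    if w: "norm (w - x) < d" for w
  proof -
    let ?h = "w - x"
    let ?r = "\<lambda>y. (\<kappa> (w - y) - \<kappa> (x - y) - (\<chi> i. dif \<kappa> (x - y) (axis i 1)) \<bullet> ?h) * Y y"
    have i1: "integrable lborel (\<lambda>y. \<kappa> (w - y) * Y y)" "integrable lborel (\<lambda>y. \<kappa> (x - y) * Y y)"
      using integrable_bump_mult[OF b Y] by auto
    have i2: "integrable lborel (\<lambda>y. dif \<kappa> (x - y) (axis i 1) * Y y)" for i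
      by (rule integrable_bump_mult[OF bump_partial[OF b] Y])
    have i3: "integrable lborel (\<lambda>y. \<Sum>i\<in>UNIV. (dif \<kappa> (x - y) (axis i 1) * Y y) * ?h $ i)"
      by (intro Bochner_Integration.integrable_sum integrable_mult_left i2)
    have r: "?r y = \<kappa> (w - y) * Y y - \<kappa> (x - y) * Y y - (\<Sum>i\<in>UNIV. (dif \<kappa> (x - y) (axis i 1) * Y y) * ?h $ i)" for y
      unfolding inner_vec_def left_diff_distrib sum_distrib_right by (simp add: mult_ac del: vector_minus_component)
    have eq: "(\<integral>y. \<kappa> (w - y) * Y y \<partial>lborel) - (\<integral>y. \<kappa> (x - y) * Y y \<partial>lborel) - (\<chi> i. \<integral>y. dif \<kappa> (x - y) (axis i 1) * Y y \<partial>lborel) \<bullet> ?h = (\<integral>y. ?r y \<partial>lborel)"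
    proof -
      have "(\<integral>y. ?r y \<partial>lborel) = (\<integral>y. \<kappa> (w - y) * Y y \<partial>lborel) - (\<integral>y. \<kappa> (x - y) * Y y \<partial>lborel) - (\<integral>y. (\<Sum>i\<in>UNIV. (dif \<kappa> (x - y) (axis i 1) * Y y) * ?h $ i) \<partial>lborel)"
        unfolding r using i1 i3 by (simp only: Bochner_Integration.integral_diff Bochner_Integration.integrable_diff)
      also have "(\<integral>y. (\<Sum>i\<in>UNIV. (dif \<kappa> (x - y) (axis i 1) * Y y) * ?h $ i) \<partial>lborel) = (\<Sum>i\<in>UNIV. (\<integral>y. dif \<kappa> (x - y) (axis i 1) * Y y \<partial>lborel) * ?h $ i)"
        by (subst Bochner_Integration.integral_sum) (simp_all add: i2 del: vector_minus_component)
      finally show ?thesis by (simp add: inner_vec_def)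
    qed
    have "\<bar>\<integral>y. ?r y \<partial>lborel\<bar> \<le> (\<integral>y. (e / (M + 1) * norm ?h) * \<bar>Y y\<bar> \<partial>lborel)"
    proof (rule integral_abs_bound_integral)
      show "integrable lborel ?r" unfolding r by (intro Bochner_Integration.integrable_diff i1 i3)
      show "integrable lborel (\<lambda>y. (e / (M + 1) * norm ?h) * \<bar>Y y\<bar>)" using Y by simp
      show "\<bar>?r y\<bar> \<le> (e / (M + 1) * norm ?h) * \<bar>Y y\<bar>" for y
        using d(2)[OF w, of "x - y"] unfolding abs_mult by (intro mult_right_mono) (auto simp: algebra_simps)
    qed
    also have "\<dots> = (e * norm ?h) * (M / (M + 1))" by (simp add: M_def)
    also have "\<dots> \<le> (e * norm ?h) * 1" using e M by (intro mult_left_mono) auto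
    finally show ?thesis unfolding eq by simp
  qed
  then show "\<exists>d>0. \<forall>w. norm (w - x) < d \<longrightarrow> norm ((\<integral>y. \<kappa> (w - y) * Y y \<partial>lborel) - (\<integral>y. \<kappa> (x - y) * Y y \<partial>lborel) - (\<chi> i. \<integral>y. dif \<kappa> (x - y) (axis i 1) * Y y \<partial>lborel) \<bullet> (w - x)) \<le> e * norm (w - x)"
    using d(1) by blast
qed

lemma convolution_smooth:
  assumes "bump \<mu> \<kappa>" and Y: "integrable lborel (Y :: real^3 \<Rightarrow> real)"
  shows "Ck_on k UNIV (\<lambda>x. \<integral>y. \<kappa> (x - y) * Y y \<partial>lborel)"
  using assms(1)
proof (induction k arbitrary: \<kappa>)
  case 0
  show ?case
    using convolution_has_derivative[OF 0 Y]
    by (auto intro!: continuous_at_imp_continuous_on has_derivative_continuous)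
next
  case (Suc k)
  show ?case
    by (rule Ck_on_SucI[OF open_UNIV convolution_has_derivative[OF Suc.prems Y]])
       (simp add: Suc.IH[OF bump_partial[OF Suc.prems]])
qed

text \<open>A form of Jensen's inequality with the additional factor \<open>2\<^sup>p\<close>. Integrating
  \<open>t \<le> s + s powr (1 - p) * t powr p\<close> bounds the average by \<open>s + s powr (1 - p) * b\<close>, where
  \<open>b\<close> is the average of the powers, and \<open>s = b powr (1 / p)\<close> gives \<open>2 s\<close>.\<close>

lemma average_powr_le:
  assumes p: "1 \<le> p" and g [measurable]: "g \<in> borel_measurable M" and g0: "\<And>z. 0 \<le> g z"
    and k [measurable]: "k \<in> borel_measurable M" and k1: "(\<integral>\<^sup>+z. k z \<partial>M) = 1"
    and a: "0 \<le> a" "ennreal a \<le> (\<integral>\<^sup>+z. k z * ennreal (g z) \<partial>M)"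
  shows "ennreal (a powr p) \<le> ennreal (2 powr p) * (\<integral>\<^sup>+z. k z * ennreal (g z powr p) \<partial>M)"
proof (cases "(\<integral>\<^sup>+z. k z * ennreal (g z powr p) \<partial>M) = \<infinity>")
  case True
  then show ?thesis by (simp add: ennreal_mult_top)
next
  case False
  then obtain b where b: "0 \<le> b" "(\<integral>\<^sup>+z. k z * ennreal (g z powr p) \<partial>M) = ennreal b"
    by (metis ennreal_cases infinity_ennreal_def)
  have main: "a \<le> s + s powr (1 - p) * b" if s: "s > 0" for s
  proof -
    have pt: "t \<le> s + s powr (1 - p) * t powr p" if "t \<ge> 0" for t
    proof (cases "t \<le> s")
      case True then show ?thesis using s by (simp add: add_increasing2)
    next
      case False
      have "t = t powr (1 - p) * t powr p" using False s by (simp add: powr_add[symmetric])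
      also have "\<dots> \<le> s powr (1 - p) * t powr p" using False s p by (intro mult_right_mono powr_mono2') auto
      finally show ?thesis using s by linarith
    qed
    have "ennreal a \<le> (\<integral>\<^sup>+z. k z * ennreal (g z) \<partial>M)" by (rule a(2))
    also have "\<dots> \<le> (\<integral>\<^sup>+z. ennreal s * k z + ennreal (s powr (1 - p)) * (k z * ennreal (g z powr p)) \<partial>M)"
    proof (intro nn_integral_mono)
      fix z
      have "ennreal (g z) \<le> ennreal (s + s powr (1 - p) * g z powr p)" by (intro ennreal_leI pt g0)
      also have "\<dots> = ennreal s + ennreal (s powr (1 - p)) * ennreal (g z powr p)"
        using s by (simp add: ennreal_mult)
      finally have "k z * ennreal (g z) \<le> k z * (ennreal s + ennreal (s powr (1 - p)) * ennreal (g z powr p))"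
        by (rule mult_left_mono) simp
      then show "k z * ennreal (g z) \<le> ennreal s * k z + ennreal (s powr (1 - p)) * (k z * ennreal (g z powr p))"
        by (simp add: distrib_left mult_ac)
    qed
    also have "\<dots> = ennreal s * 1 + ennreal (s powr (1 - p)) * ennreal b"
      by (subst nn_integral_add, simp, simp, subst nn_integral_cmult, simp, subst nn_integral_cmult, simp, simp add: k1 b)
    also have "\<dots> = ennreal (s + s powr (1 - p) * b)" using s b by (simp add: ennreal_mult)
    finally show ?thesis using s b by (subst (asm) ennreal_le_iff) auto
  qed
  have "a powr p \<le> 2 powr p * b"
  proof (cases "b = 0")
    case True
    have "a \<le> 0 + e" if "e > 0" for e using main[OF that] True by simp
    then have "a \<le> 0" by (rule field_le_epsilon)
    then show ?thesis using a True p by simp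
  next
    case False
    then have b0: "b > 0" using b by simp
    define s where "s = b powr (1 / p)"
    have s: "s > 0" "s powr p = b" using b0 p by (auto simp: s_def powr_powr)
    have "s powr (1 - p) * b = s" using powr_add[of s "1 - p" p] s by simp
    then have "a \<le> 2 * s" using main[OF s(1)] by simp
    then have "a powr p \<le> (2 * s) powr p" using a p by (intro powr_mono2) auto
    then show ?thesis using s by (simp add: powr_mult)
  qed
  then show ?thesis using b by (simp add: ennreal_mult[symmetric] ennreal_leI)
qed

lemma lborel_reflect: "(lborel :: 'a::euclidean_space measure) = distr lborel borel (\<lambda>y. x - y)"
  using lborel_affine[of "-1" x] by (simp add: density_1)

lemma bump_borel: "bump \<mu> \<kappa> \<Longrightarrow> \<kappa> \<in> borel_measurable borel"
  using bump_continuous by (rule borel_measurable_continuous_onI)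

lemma integrable_bump_scaleR:
  fixes Y :: "real^3 \<Rightarrow> real^3"
  assumes b: "bump \<mu> \<kappa>" and Y: "integrable lborel Y"
  shows "integrable lborel (\<lambda>y. \<kappa> (x - y) *\<^sub>R Y y)"
proof -
  obtain B where B: "B \<ge> 0" "\<And>x. \<bar>\<kappa> x\<bar> \<le> B" using bump_bounded[OF b] by blast
  note [measurable] = bump_borel[OF b] borel_measurable_integrable[OF Y]
  show ?thesis
    by (rule Bochner_Integration.integrable_bound[OF integrable_scaleR_right[OF Y, of B]])
      (use B in \<open>auto intro!: AE_I2 mult_mono\<close>)
qed

lemma mollify_nth:
  assumes b: "bump \<mu> \<kappa>" and Y: "integrable lborel Y"
  shows "mollify \<kappa> Y x $ i = (\<integral>y. \<kappa> (x - y) * Y y $ i \<partial>lborel)"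
  using integral_bounded_linear[OF bounded_linear_vec_nth integrable_bump_scaleR[OF b Y]]
  by (simp add: mollify_def)

lemma mollify_smooth:
  assumes b: "bump \<mu> \<kappa>" and Y: "integrable lborel Y"
  shows "Ck_on k UNIV (\<lambda>x. mollify \<kappa> Y x $ i)"
proof -
  have "integrable lborel (\<lambda>y. Y y $ i)"
    using integrable_bounded_linear[OF bounded_linear_vec_nth Y] by simp
  from convolution_smooth[OF b this] show ?thesis by (simp add: mollify_nth[OF b Y])
qed

lemma mollify_continuous:
  assumes b: "bump \<mu> \<kappa>" and Y: "integrable lborel Y"
  shows "continuous_on UNIV (mollify \<kappa> Y)"
proof -
  have "continuous_on UNIV (\<lambda>x. \<chi> i. mollify \<kappa> Y x $ i)"
    using mollify_smooth[OF b Y, of 0] by (intro continuous_on_vec_lambda) simp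
  then show ?thesis by simp
qed

text \<open>\<open>mollify \<kappa> Y x - Y x\<close> is the average of \<open>Y (x + w) - Y x\<close> over \<open>|w| \<le> \<mu>\<close>.\<close>

lemma mollify_error:
  fixes Y :: "real^3 \<Rightarrow> real^3"
  assumes b: "bump \<mu> \<kappa>" and k0: "\<And>x. 0 \<le> \<kappa> x" and ki: "integrable lborel \<kappa>" and k1: "(\<integral>x. \<kappa> x \<partial>lborel) = 1"
    and Y: "integrable lborel Y" and p: "1 \<le> p"
    and m: "\<And>w. norm w \<le> \<mu> \<Longrightarrow> (Lp_int p (\<lambda>x. Y (x + w) - Y x)) \<le> m"
  shows "(Lp_int p (\<lambda>x. mollify \<kappa> Y x - Y x)) \<le> ennreal (2 powr p) * m"
proof -
  note [measurable] = bump_borel[OF b]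
  have Ym [measurable]: "Y \<in> borel_measurable borel" using borel_measurable_integrable[OF Y] by simp
  have kn: "(\<integral>\<^sup>+w. ennreal (\<kappa> (- w)) \<partial>lborel) = 1"
  proof -
    have "(\<integral>\<^sup>+w. ennreal (\<kappa> (- w)) \<partial>lborel) = (\<integral>\<^sup>+w. ennreal (\<kappa> w) \<partial>lborel)"
      by (subst (2) lborel_reflect[of 0], subst nn_integral_distr) auto
    also have "\<dots> = ennreal 1" using nn_integral_eq_integral[OF ki] k0 k1 by simp
    finally show ?thesis by simp
  qed
  have kx: "integrable lborel (\<lambda>y. \<kappa> (x - y))" "(\<integral>y. \<kappa> (x - y) \<partial>lborel) = 1" for x
  proof -
    have "integrable (distr lborel borel (\<lambda>y. x - y)) \<kappa>" using ki lborel_reflect[of x] by simp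
    then show "integrable lborel (\<lambda>y. \<kappa> (x - y))" by (subst (asm) integrable_distr_eq) auto
    have "(\<integral>y. \<kappa> (x - y) \<partial>lborel) = integral\<^sup>L (distr lborel borel (\<lambda>y. x - y)) \<kappa>" by (subst integral_distr) auto
    then show "(\<integral>y. \<kappa> (x - y) \<partial>lborel) = 1" using lborel_reflect[of x] k1 by simp
  qed
  have pt: "ennreal (norm (mollify \<kappa> Y x - Y x) powr p) \<le> ennreal (2 powr p) * (\<integral>\<^sup>+w. ennreal (\<kappa> (- w)) * ennreal (norm (Y (x + w) - Y x) powr p) \<partial>lborel)" for x
  proof (rule average_powr_le[OF p])
    have "mollify \<kappa> Y x - Y x = (\<integral>y. \<kappa> (x - y) *\<^sub>R Y y \<partial>lborel) - (\<integral>y. \<kappa> (x - y) *\<^sub>R Y x \<partial>lborel)"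
      using kx by (simp add: mollify_def)
    also have "\<dots> = (\<integral>y. \<kappa> (x - y) *\<^sub>R Y y - \<kappa> (x - y) *\<^sub>R Y x \<partial>lborel)"
      using integrable_bump_scaleR[OF b Y] kx by (intro Bochner_Integration.integral_diff[symmetric]) auto
    also have "ennreal (norm \<dots>) \<le> (\<integral>\<^sup>+y. ennreal (norm (\<kappa> (x - y) *\<^sub>R Y y - \<kappa> (x - y) *\<^sub>R Y x)) \<partial>lborel)"
      using integrable_bump_scaleR[OF b Y] kx by (intro integral_norm_bound_ennreal Bochner_Integration.integrable_diff) auto
    also have "\<dots> = (\<integral>\<^sup>+y. ennreal (\<kappa> (x - y)) * ennreal (norm (Y y - Y x)) \<partial>lborel)"
      using k0 by (intro nn_integral_cong) (simp add: scaleR_diff_right[symmetric] ennreal_mult del: scaleR_diff_right)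
    also have "\<dots> = (\<integral>\<^sup>+w. ennreal (\<kappa> (- w)) * ennreal (norm (Y (x + w) - Y x)) \<partial>lborel)"
      by (subst nn_integral_translate[of _ x, symmetric]) auto
    finally show "ennreal (norm (mollify \<kappa> Y x - Y x)) \<le> (\<integral>\<^sup>+w. ennreal (\<kappa> (- w)) * ennreal (norm (Y (x + w) - Y x)) \<partial>lborel)" .
  qed (auto simp: kn)
  have "(Lp_int p (\<lambda>x. mollify \<kappa> Y x - Y x)) \<le>
    (\<integral>\<^sup>+x. ennreal (2 powr p) * (\<integral>\<^sup>+w. ennreal (\<kappa> (- w)) * ennreal (norm (Y (x + w) - Y x) powr p) \<partial>lborel) \<partial>lborel)"
    by (intro nn_integral_mono pt)
  also have "\<dots> = ennreal (2 powr p) * (\<integral>\<^sup>+x. (\<integral>\<^sup>+w. ennreal (\<kappa> (- w)) * ennreal (norm (Y (x + w) - Y x) powr p) \<partial>lborel) \<partial>lborel)"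
    by (rule nn_integral_cmult) measurable
  also have "(\<integral>\<^sup>+x. (\<integral>\<^sup>+w. ennreal (\<kappa> (- w)) * ennreal (norm (Y (x + w) - Y x) powr p) \<partial>lborel) \<partial>lborel)
     = (\<integral>\<^sup>+w. (\<integral>\<^sup>+x. ennreal (\<kappa> (- w)) * ennreal (norm (Y (x + w) - Y x) powr p) \<partial>lborel) \<partial>lborel)"
    by (rule lborel_pair.Fubini') measurable
  also have "\<dots> = (\<integral>\<^sup>+w. ennreal (\<kappa> (- w)) * (Lp_int p (\<lambda>x. Y (x + w) - Y x)) \<partial>lborel)"
    by (intro nn_integral_cong nn_integral_cmult) measurable
  also have "\<dots> \<le> (\<integral>\<^sup>+w. ennreal (\<kappa> (- w)) * m \<partial>lborel)"
  proof (intro nn_integral_mono)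
    fix w
    show "ennreal (\<kappa> (- w)) * (Lp_int p (\<lambda>x. Y (x + w) - Y x)) \<le> ennreal (\<kappa> (- w)) * m"
    proof (cases "norm w \<le> \<mu>")
      case True then show ?thesis by (intro mult_left_mono m) auto
    next
      case False then show ?thesis using b by (simp add: bump_def)
    qed
  qed
  also have "\<dots> = m" by (simp add: nn_integral_multc kn)
  finally show ?thesis by (simp add: mult_left_mono)
qed

lemma test_on_shift:
  assumes t: "test_on R \<phi> G" and w: "norm w \<le> \<mu>" and R: "R + \<mu> \<le> R'"
  shows "test_on R' (\<lambda>x. \<phi> (x - w)) (\<lambda>x. G (x - w))"
  unfolding test_on_def has_gradient_def
proof (intro conjI allI impI)
  fix x :: "real^3"
  have 1: "((\<lambda>x. x - w) has_derivative (\<lambda>h. h)) (at x)" by (auto intro!: derivative_eq_intros)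
  have 2: "(\<phi> has_derivative (\<lambda>h. G (x - w) \<bullet> h)) (at (x - w))" using t by (simp add: test_on_def has_gradient_def)
  show "((\<lambda>x. \<phi> (x - w)) has_derivative (\<lambda>h. G (x - w) \<bullet> h)) (at x)"
    using diff_chain_at[OF 1 2] by (simp add: o_def)
next
  have "continuous_on UNIV G" using t by (simp add: test_on_def has_gradient_def)
  then show "continuous_on UNIV (\<lambda>x. G (x - w))"
    by (rule continuous_on_compose2) (auto intro!: continuous_intros)
next
  fix x :: "real^3" assume "R' \<le> norm x"
  then have "R \<le> norm (x - w)" using norm_triangle_ineq2[of x w] w R by linarith
  then show "\<phi> (x - w) = 0" using t by (simp add: test_on_def)
qed

text \<open>By Fubini's theorem, testing the mollified field with \<open>\<phi>\<close> amounts to averaging the tests of \<open>Y\<close>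
  with translates of \<open>\<phi>\<close>, which are test functions on a ball that is larger by \<open>\<mu>\<close>.\<close>

lemma mollify_solenoidal:
  fixes Y :: "real^3 \<Rightarrow> real^3"
  assumes b: "bump \<mu> \<kappa>" and k0: "\<And>x. 0 \<le> \<kappa> x" and ki: "integrable lborel \<kappa>" and Y: "integrable lborel Y"
    and sol: "\<And>\<phi> G. test_on R' \<phi> G \<Longrightarrow> (pairing Y G) = 0"
    and R: "R + \<mu> \<le> R'" and t: "test_on R \<phi> G"
  shows "(\<integral>x. mollify \<kappa> Y x \<bullet> G x \<partial>lborel) = 0"
proof -
  have g: "has_gradient \<phi> G" using t by (simp add: test_on_def)
  note [measurable] = bump_borel[OF b] has_gradient_borel[OF g]
  have Ym [measurable]: "Y \<in> borel_measurable borel" using borel_measurable_integrable[OF Y] by simp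
  obtain B where B: "B \<ge> 0" "\<And>x. norm (G x) \<le> B" using test_on_gradient_bounded[OF t] by blast
  let ?f = "\<lambda>w x. \<kappa> (- w) * (Y (x + w) \<bullet> G x)"
  have int: "integrable (lborel \<Otimes>\<^sub>M lborel) (case_prod ?f)"
  proof (rule integrableI_bounded)
    show fm: "case_prod ?f \<in> borel_measurable (lborel \<Otimes>\<^sub>M lborel)" by measurable
    have fm': "(\<lambda>z. ennreal (norm (case_prod ?f z))) \<in> borel_measurable (lborel \<Otimes>\<^sub>M lborel)"
      by (rule measurable_compose[OF measurable_compose[OF fm borel_measurable_norm] measurable_ennreal])
    have "(\<integral>\<^sup>+z. ennreal (norm (case_prod ?f z)) \<partial>(lborel \<Otimes>\<^sub>M lborel)) = (\<integral>\<^sup>+w. \<integral>\<^sup>+x. ennreal (norm (?f w x)) \<partial>lborel \<partial>lborel)"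
      by (subst lborel.nn_integral_fst[OF fm', symmetric]) simp
    also have "\<dots> \<le> (\<integral>\<^sup>+w. \<integral>\<^sup>+x. ennreal (\<kappa> (- w) * B) * ennreal (norm (Y (w + x))) \<partial>lborel \<partial>lborel)"
    proof (intro nn_integral_mono)
      fix w x
      have "norm (Y (x + w) \<bullet> G x) \<le> B * norm (Y (w + x))"
        using Cauchy_Schwarz_ineq2[of "Y (x + w)" "G x"] mult_left_mono[OF B(2)[of x], of "norm (Y (x + w))"] by (simp add: mult.commute add.commute)
      then have "norm (?f w x) \<le> \<kappa> (- w) * (B * norm (Y (w + x)))"
        using k0[of "- w"] unfolding norm_mult by (simp add: mult_left_mono)
      then show "ennreal (norm (?f w x)) \<le> ennreal (\<kappa> (- w) * B) * ennreal (norm (Y (w + x)))"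
        using k0[of "-w"] B(1) by (simp add: ennreal_mult[symmetric] ennreal_leI mult.assoc)
    qed
    also have "\<dots> = (\<integral>\<^sup>+w. ennreal (\<kappa> (- w) * B) * (\<integral>\<^sup>+x. ennreal (norm (Y x)) \<partial>lborel) \<partial>lborel)"
    proof (intro nn_integral_cong)
      fix w
      have "(\<integral>\<^sup>+x. ennreal (\<kappa> (- w) * B) * ennreal (norm (Y (w + x))) \<partial>lborel) = ennreal (\<kappa> (- w) * B) * (\<integral>\<^sup>+x. ennreal (norm (Y (w + x))) \<partial>lborel)"
        by (rule nn_integral_cmult) measurable
      also have "(\<integral>\<^sup>+x. ennreal (norm (Y (w + x))) \<partial>lborel) = (\<integral>\<^sup>+x. ennreal (norm (Y x)) \<partial>lborel)"
        by (rule nn_integral_translate) measurable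
      finally show "(\<integral>\<^sup>+x. ennreal (\<kappa> (- w) * B) * ennreal (norm (Y (w + x))) \<partial>lborel) = ennreal (\<kappa> (- w) * B) * (\<integral>\<^sup>+x. ennreal (norm (Y x)) \<partial>lborel)" .
    qed
    also have "\<dots> = (\<integral>\<^sup>+w. ennreal (\<kappa> (- w) * B) \<partial>lborel) * (\<integral>\<^sup>+x. ennreal (norm (Y x)) \<partial>lborel)"
      by (rule nn_integral_multc) measurable
    also have "(\<integral>\<^sup>+w. ennreal (\<kappa> (- w) * B) \<partial>lborel) = (\<integral>\<^sup>+w. ennreal (\<kappa> w * B) \<partial>lborel)"
      by (subst (2) lborel_reflect[of 0], subst nn_integral_distr) auto
    also have "\<dots> * (\<integral>\<^sup>+x. ennreal (norm (Y x)) \<partial>lborel) < \<infinity>"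
    proof -
      have "integrable lborel (\<lambda>w. \<kappa> w * B)" using ki by simp
      then have "(\<integral>\<^sup>+w. ennreal (norm (\<kappa> w * B)) \<partial>lborel) < \<infinity>"
        by (simp only: integrable_iff_bounded)
      moreover have "norm (\<kappa> w * B) = \<kappa> w * B" for w using k0[of w] B(1) by simp
      ultimately have "(\<integral>\<^sup>+w. ennreal (\<kappa> w * B) \<partial>lborel) < \<infinity>" by (simp only:)
      moreover have "(\<integral>\<^sup>+x. ennreal (norm (Y x)) \<partial>lborel) < \<infinity>" using Y by (auto simp: integrable_iff_bounded)
      ultimately show ?thesis by (simp add: ennreal_mult_less_top)
    qed
    finally show "(\<integral>\<^sup>+z. ennreal (norm (case_prod ?f z)) \<partial>(lborel \<Otimes>\<^sub>M lborel)) < \<infinity>" .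
  qed
  have "(\<integral>x. mollify \<kappa> Y x \<bullet> G x \<partial>lborel) = (\<integral>x. (\<integral>w. ?f w x \<partial>lborel) \<partial>lborel)"
  proof (intro Bochner_Integration.integral_cong refl)
    fix x
    have "mollify \<kappa> Y x \<bullet> G x = (\<integral>y. (\<kappa> (x - y) *\<^sub>R Y y) \<bullet> G x \<partial>lborel)"
      unfolding mollify_def using integral_bounded_linear[OF bounded_linear_inner_left integrable_bump_scaleR[OF b Y]] by simp
    also have "\<dots> = (\<integral>y. (\<kappa> (x - y) *\<^sub>R Y y) \<bullet> G x \<partial>distr lborel borel ((+) x))"
      by (simp only: lborel_distr_plus)
    also have "\<dots> = (\<integral>w. ?f w x \<partial>lborel)"
      by (subst integral_distr) auto
    finally show "mollify \<kappa> Y x \<bullet> G x = (\<integral>w. ?f w x \<partial>lborel)" .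
  qed
  also have "\<dots> = (\<integral>w. (\<integral>x. ?f w x \<partial>lborel) \<partial>lborel)"
    by (rule lborel_pair.Fubini_integral[OF int])
  also have "\<dots> = (\<integral>w. 0 \<partial>(lborel :: (real^3) measure))"
  proof (intro Bochner_Integration.integral_cong refl)
    fix w
    show "(\<integral>x. ?f w x \<partial>lborel) = 0"
    proof (cases "norm w \<le> \<mu>")
      case False
      then show ?thesis using b by (simp add: bump_def)
    next
      case True
      have "(\<integral>x. Y (x + w) \<bullet> G x \<partial>lborel) = (\<integral>x. Y x \<bullet> G (x - w) \<partial>distr lborel borel ((+) w))"
        by (subst integral_distr) (auto simp: add.commute)
      also have "\<dots> = 0" unfolding lborel_distr_plus by (rule sol[OF test_on_shift[OF t True R]])
      finally show ?thesis by simp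
    qed
  qed
  finally show ?thesis by simp
qed

lemma solenoidal_smoothing:
  fixes Y :: "real^3 \<Rightarrow> real^3"
  assumes Y [measurable]: "Y \<in> borel_measurable borel" and p: "1 \<le> p"
    and Yp: "(Lp_int p Y) < \<infinity>"
    and supp: "\<And>x. norm x \<ge> 1 \<Longrightarrow> Y x = 0"
    and sol: "\<And>\<phi> G. test_on R' \<phi> G \<Longrightarrow> (pairing Y G) = 0"
    and R: "R < R'" "R \<le> 1" and \<delta>: "\<delta> > 0"
  shows "\<exists>V. continuous_on UNIV V \<and> (\<forall>i k. Ck_on k UNIV (\<lambda>x. V x $ i)) \<and>
     (Lp_int p (\<lambda>x. V x - Y x)) \<le> ennreal \<delta> \<and>
     (\<forall>\<phi> G. test_on R \<phi> G \<longrightarrow> integrable_pairing V G \<and> (pairing V G) = 0)"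
proof -
  have p0: "p > 0" using p by simp
  have "(Lp_int 1 Y) < \<infinity>"
    by (rule ball_Lp_mono[OF Y _ _ Yp supp]) (use p in auto)
  then have Yi: "integrable lborel Y" by (intro integrableI_bounded) auto
  obtain \<eta> where \<eta>: "\<eta> > 0" "\<And>w. norm w \<le> \<eta> \<Longrightarrow> (Lp_int p (\<lambda>x. Y (x + w) - Y x)) \<le> ennreal (\<delta> / 2 powr p)"
    using Lp_translation_modulus[OF Y p0 Yp supp, of "\<delta> / 2 powr p"] \<delta> by auto
  define \<mu> where "\<mu> = min \<eta> (R' - R)"
  have \<mu>: "\<mu> > 0" "R + \<mu> \<le> R'" "\<mu> \<le> \<eta>" using \<eta>(1) R by (auto simp: \<mu>_def)
  obtain \<kappa> where \<kappa>: "Cinf_on UNIV \<kappa>" "\<And>x. 0 \<le> \<kappa> x" "\<forall>x. \<mu> < norm x \<longrightarrow> \<kappa> x = 0" "integrable lborel \<kappa>" "(\<integral>x. \<kappa> x \<partial>lborel) = 1"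
    using mollifier_exists[OF \<mu>(1)] by blast
  have b: "bump \<mu> \<kappa>" using \<kappa> by (simp add: bump_def)
  let ?V = "mollify \<kappa> Y"
  have "(Lp_int p (\<lambda>x. ?V x - Y x)) \<le> ennreal (2 powr p) * ennreal (\<delta> / 2 powr p)"
    by (rule mollify_error[OF b \<kappa>(2,4,5) Yi p \<eta>(2)]) (use \<mu> in auto)
  also have "\<dots> = ennreal \<delta>" using \<delta> by (simp add: ennreal_mult[symmetric])
  finally have err: "(Lp_int p (\<lambda>x. ?V x - Y x)) \<le> ennreal \<delta>" .
  have int: "integrable_pairing ?V G" if t: "test_on R \<phi> G" for \<phi> G
  proof -
    have "continuous_on UNIV (\<lambda>x. ?V x \<bullet> G x)"
      using t by (intro continuous_on_inner mollify_continuous[OF b Yi]) (simp add: test_on_def has_gradient_def)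
    then have "integrable lborel (\<lambda>x. indicator (cball 0 1) x * (?V x \<bullet> G x))"
      by (intro integrable_indicator_mult_continuous) auto
    moreover have "indicator (cball 0 1) x * (?V x \<bullet> G x) = ?V x \<bullet> G x" for x
      using test_on_gradient_zero[OF t, of x] R by (cases "norm x \<le> 1") auto
    ultimately show ?thesis by simp
  qed
  have sol': "(pairing ?V G) = 0" if t: "test_on R \<phi> G" for \<phi> G
    by (rule mollify_solenoidal[OF b \<kappa>(2,4) Yi sol \<mu>(2) t])
  show ?thesis
    using err int sol' mollify_continuous[OF b Yi] mollify_smooth[OF b Yi]
    by (intro exI[of _ ?V] conjI allI impI) auto
qed

section \<open>Approximants that are smooth away from their charges\<close>

lemma test_on_mono: "test_on R \<phi> G \<Longrightarrow> R \<le> R' \<Longrightarrow> test_on R' \<phi> G"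
  by (auto simp: test_on_def)

lemma test_on_dilate:
  assumes t: "test_on 1 \<phi> G" and l: "l > 0"
  shows "test_on l (\<lambda>y. \<phi> ((1 / l) *\<^sub>R y)) (\<lambda>y. (1 / l) *\<^sub>R G ((1 / l) *\<^sub>R y))"
  unfolding test_on_def has_gradient_def
proof (intro conjI allI impI)
  fix x :: "real^3"
  have 1: "((\<lambda>x. (1 / l) *\<^sub>R x) has_derivative (\<lambda>h. (1 / l) *\<^sub>R h)) (at x)" by (auto intro!: derivative_eq_intros)
  have 2: "(\<phi> has_derivative (\<lambda>h. G ((1 / l) *\<^sub>R x) \<bullet> h)) (at ((1 / l) *\<^sub>R x))" using t by (simp add: test_on_def has_gradient_def)
  show "((\<lambda>x. \<phi> ((1 / l) *\<^sub>R x)) has_derivative (\<lambda>h. (1 / l) *\<^sub>R G ((1 / l) *\<^sub>R x) \<bullet> h)) (at x)"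
    using diff_chain_at[OF 1 2] by (simp add: o_def)
next
  have "continuous_on UNIV G" using t by (simp add: test_on_def has_gradient_def)
  then have "continuous_on UNIV (\<lambda>y. G ((1 / l) *\<^sub>R y))"
    by (rule continuous_on_compose2) (auto intro!: continuous_intros)
  then show "continuous_on UNIV (\<lambda>y. (1 / l) *\<^sub>R G ((1 / l) *\<^sub>R y))" by (intro continuous_intros)
next
  fix x :: "real^3" assume "l \<le> norm x"
  then have "1 \<le> norm ((1 / l) *\<^sub>R x)" using l by (simp add: field_simps)
  then show "\<phi> ((1 / l) *\<^sub>R x) = 0" using t by (simp add: test_on_def)
qed

lemma integral_dilate:
  fixes f :: "real^3 \<Rightarrow> real"
  assumes l: "l > 0" and f: "f \<in> borel_measurable borel"
  shows "(\<integral>x. f x \<partial>lborel) = l ^ 3 * (\<integral>x. f (l *\<^sub>R x) \<partial>lborel)"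
proof -
  note [measurable] = f
  have "(\<integral>x. f x \<partial>lborel) = (\<integral>x. f x \<partial>density (distr lborel borel (\<lambda>x. 0 + l *\<^sub>R x)) (\<lambda>_. ennreal (\<bar>l\<bar> ^ DIM(real^3))))"
    using lborel_affine[of l "0 :: real^3"] l by (simp add: ennreal_power)
  also have "\<dots> = (\<integral>x. \<bar>l\<bar> ^ DIM(real^3) *\<^sub>R f x \<partial>distr lborel borel (\<lambda>x. 0 + l *\<^sub>R x))"
    by (rule integral_density) auto
  also have "\<dots> = (\<integral>x. \<bar>l\<bar> ^ DIM(real^3) *\<^sub>R f (0 + l *\<^sub>R x) \<partial>lborel)"
    by (rule integral_distr) auto
  finally show ?thesis using l by simp
qed

text \<open>The divergence of \<open>W\<close> on the ball of radius \<open>R\<close> is \<open>\<Sum>\<^sub>c 2 \<pi> n(c) \<delta>\<^sub>c\<close>.\<close>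

definition charged_on :: "real \<Rightarrow> (real^3 \<Rightarrow> real^3) \<Rightarrow> (real^3) set \<Rightarrow> (real^3 \<Rightarrow> int) \<Rightarrow> bool" where
  "charged_on R W A n \<longleftrightarrow> finite A \<and> A \<subseteq> ball 0 R \<and>
     (\<forall>\<phi> G. test_on R \<phi> G \<longrightarrow> (pairing W G) = - (\<Sum>c\<in>A. 2 * pi * of_int (n c) * \<phi> c))"

definition point_charges :: "(real^3) set \<Rightarrow> (real^3 \<Rightarrow> int) \<Rightarrow> real^3 \<Rightarrow> real^3" where
  "point_charges A n x = (\<Sum>c\<in>A. (2 * pi * of_int (n c) / point_flux) *\<^sub>R point_field c x)"

lemma point_charges_borel [measurable]: "point_charges A n \<in> borel_measurable borel"
  unfolding point_charges_def[abs_def] by measurable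

lemma point_charges_divergence:
  assumes A: "A \<subseteq> ball 0 1" and t: "test_on 1 \<phi> G"
  shows "integrable lborel (\<lambda>x. point_charges A n x \<bullet> G x)"
    "(\<integral>x. point_charges A n x \<bullet> G x \<partial>lborel) = - (\<Sum>c\<in>A. 2 * pi * of_int (n c) * \<phi> c)"
proof -
  have i: "integrable lborel (\<lambda>x. (2 * pi * of_int (n c) / point_flux) * (point_field c x \<bullet> G x))" if "c \<in> A" for c
    using A that by (intro integrable_mult_right point_field_divergence(1)[OF _ t]) auto
  show "integrable lborel (\<lambda>x. point_charges A n x \<bullet> G x)"
    unfolding point_charges_def inner_sum_left inner_scaleR_left using i by (rule Bochner_Integration.integrable_sum)
  have "(\<integral>x. point_charges A n x \<bullet> G x \<partial>lborel) = (\<Sum>c\<in>A. \<integral>x. (2 * pi * of_int (n c) / point_flux) * (point_field c x \<bullet> G x) \<partial>lborel)"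
    unfolding point_charges_def inner_sum_left inner_scaleR_left using i by (rule Bochner_Integration.integral_sum)
  also have "\<dots> = (\<Sum>c\<in>A. - (2 * pi * of_int (n c) * \<phi> c))"
  proof (intro sum.cong refl)
    fix c assume "c \<in> A"
    then have "norm c < 1" using A by auto
    then show "(\<integral>x. (2 * pi * of_int (n c) / point_flux) * (point_field c x \<bullet> G x) \<partial>lborel) = - (2 * pi * of_int (n c) * \<phi> c)"
      using point_flux_pos by (simp add: point_field_divergence(2)[OF _ t])
  qed
  finally show "(\<integral>x. point_charges A n x \<bullet> G x \<partial>lborel) = - (\<Sum>c\<in>A. 2 * pi * of_int (n c) * \<phi> c)"
    by (simp add: sum_negf)
qed

lemma point_charges_Lp:
  assumes A: "finite A" "A \<subseteq> ball 0 1" and p: "1 \<le> p" and Ap: "A = {} \<or> p < 3/2"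
  shows "(Lp_int_on (ball 0 1) p (\<lambda>x. point_charges A n x)) < \<infinity>"
proof (cases "A = {}")
  case True then show ?thesis by (simp add: point_charges_def)
next
  case False
  then have p': "p < 3/2" using Ap by simp
  let ?a = "\<lambda>c. 2 * pi * of_int (n c) / point_flux"
  have "(Lp_int_on (ball 0 1) p (\<lambda>x. point_charges A n x))
    \<le> (\<integral>\<^sup>+x. (\<Sum>c\<in>A. ennreal (real (card A) powr p * \<bar>?a c\<bar> powr p) * (indicator (ball 0 1) x * ennreal (norm (point_field c x) powr p))) \<partial>lborel)"
  proof (intro nn_integral_mono)
    fix x :: "real^3"
    have "norm (point_charges A n x) powr p \<le> (\<Sum>c\<in>A. norm (?a c *\<^sub>R point_field c x)) powr p"
      unfolding point_charges_def using p by (intro powr_mono2 norm_sum) auto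
    also have "\<dots> \<le> real (card A) powr p * (\<Sum>c\<in>A. norm (?a c *\<^sub>R point_field c x) powr p)"
      using A p by (intro sum_powr_le) auto
    also have "\<dots> = (\<Sum>c\<in>A. (real (card A) powr p * \<bar>?a c\<bar> powr p) * norm (point_field c x) powr p)"
      by (simp only: norm_scaleR powr_mult sum_distrib_left mult.assoc)
    finally have "ennreal (norm (point_charges A n x) powr p) \<le> ennreal (\<Sum>c\<in>A. (real (card A) powr p * \<bar>?a c\<bar> powr p) * norm (point_field c x) powr p)"
      by (rule ennreal_leI)
    also have "\<dots> = (\<Sum>c\<in>A. ennreal (real (card A) powr p * \<bar>?a c\<bar> powr p) * ennreal (norm (point_field c x) powr p))"
      by (subst sum_ennreal[symmetric]) (simp_all only: ennreal_mult powr_ge_zero mult_nonneg_nonneg)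
    finally show "indicator (ball 0 1) x * ennreal (norm (point_charges A n x) powr p) \<le>
      (\<Sum>c\<in>A. ennreal (real (card A) powr p * \<bar>?a c\<bar> powr p) * (indicator (ball 0 1) x * ennreal (norm (point_field c x) powr p)))"
      by (cases "x \<in> ball 0 1") simp_all
  qed
  also have "\<dots> = (\<Sum>c\<in>A. \<integral>\<^sup>+x. ennreal (real (card A) powr p * \<bar>?a c\<bar> powr p) * (indicator (ball 0 1) x * ennreal (norm (point_field c x) powr p)) \<partial>lborel)"
    by (rule nn_integral_sum) measurable
  also have "\<dots> = (\<Sum>c\<in>A. ennreal (real (card A) powr p * \<bar>?a c\<bar> powr p) * (Lp_int_on (ball 0 1) p (\<lambda>x. point_field c x)))"
    by (intro sum.cong refl nn_integral_cmult) measurable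
  also have "\<dots> < \<infinity>"
  proof -
    have "ennreal (real (card A) powr p * \<bar>?a c\<bar> powr p) * (Lp_int_on (ball 0 1) p (\<lambda>x. point_field c x)) < \<infinity>" if "c \<in> A" for c
    proof -
      have "norm c < 1" using A that by auto
      from point_field_Lp[OF this p p'] show ?thesis
        by (simp only: ennreal_mult_less_top infinity_ennreal_def ennreal_less_top simp_thms)
    qed
    then show ?thesis using A(1) by (simp add: less_top[symmetric])
  qed
  finally show ?thesis .
qed

text \<open>Subtract from the field of \<open>point_charge_approximation\<close> the Coulomb fields of its charges, mollify
  the divergence free remainder, and add the Coulomb fields again. Charges in the shell between the
  radii \<open>l\<close> and \<open>R\<close> remain in the field and are dropped from \<open>A\<close>.\<close>

lemma smooth_charged_approximation:
  fixes X :: "real^3 \<Rightarrow> real^3"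
  assumes X [measurable]: "X \<in> borel_measurable borel" and p: "1 \<le> p"
    and Xp: "(Lp_int p X) < \<infinity>"
    and supp: "\<And>x. norm x \<ge> 1 \<Longrightarrow> X x = 0"
    and flux: "\<And>\<eta>. \<eta> > 0 \<Longrightarrow> \<exists>r>0. r < \<eta> \<and> integral_flux X r"
    and R: "R < 1" and l: "l < R" and \<delta>: "\<delta> > 0"
  shows "\<exists>W A n. W \<in> borel_measurable borel \<and> charged_on l W A n \<and> (\<forall>i k. Ck_on k (ball 0 l - A) (\<lambda>x. W x $ i)) \<and>
     (Lp_int_on (ball 0 1) p (\<lambda>x. W x - X x)) \<le> ennreal \<delta>"
proof -
  have p0: "0 \<le> p" using p by simp
  define \<delta>1 where "\<delta>1 = \<delta> / (2 * 2 powr p)"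
  have \<delta>1: "\<delta>1 > 0" using \<delta> by (simp add: \<delta>1_def)
  obtain Z A0 n where Z [measurable]: "Z \<in> borel_measurable borel" and A0: "finite A0" "A0 \<subseteq> ball 0 R" "A0 = {} \<or> p < 3/2"
    and Ze: "(Lp_int_on (ball 0 1) p (\<lambda>x. Z x - X x)) \<le> ennreal \<delta>1"
    and Zd: "\<And>\<phi> G. test_on R \<phi> G \<Longrightarrow> integrable_pairing Z G \<and>
        (pairing Z G) = - (\<Sum>c\<in>A0. 2 * pi * of_int (n c :: int) * \<phi> c)"
    using point_charge_approximation[OF X p Xp supp flux R \<delta>1] by blast
  have A01: "A0 \<subseteq> ball 0 1" using A0(2) R by auto
  define Y where "Y x = indicator (ball 0 1) x *\<^sub>R (Z x - point_charges A0 n x)" for x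
  have Ym [measurable]: "Y \<in> borel_measurable borel" unfolding Y_def[abs_def] by measurable
  have Y0: "Y x = 0" if "norm x \<ge> 1" for x using that by (simp add: Y_def)
  have Yp: "(Lp_int p Y) < \<infinity>"
  proof -
    let ?I = "\<lambda>x. indicator (ball 0 1) (x::real^3) :: ennreal"
    have "(Lp_int p Y) \<le> (\<integral>\<^sup>+x. ennreal (3 powr p) * ((?I x * ennreal (norm (Z x - X x) powr p) + ennreal (norm (X x) powr p)) + ?I x * ennreal (norm (point_charges A0 n x) powr p)) \<partial>lborel)"
    proof (intro nn_integral_mono)
      fix x :: "real^3"
      show "ennreal (norm (Y x) powr p) \<le> ennreal (3 powr p) * ((?I x * ennreal (norm (Z x - X x) powr p) + ennreal (norm (X x) powr p)) + ?I x * ennreal (norm (point_charges A0 n x) powr p))"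
      proof (cases "x \<in> ball 0 1")
        case True
        let ?v = "\<lambda>i::nat. if i = 0 then Z x - X x else if i = 1 then X x else - point_charges A0 n x"
        have "Y x = (\<Sum>i\<in>{0,1,2}. ?v i)" using True by (simp add: Y_def)
        then have "norm (Y x) powr p \<le> (\<Sum>i\<in>{0,1,2}. norm (?v i)) powr p"
          using p by (simp only:) (intro powr_mono2 norm_sum, auto)
        also have "\<dots> \<le> real (card {0,1,2::nat}) powr p * (\<Sum>i\<in>{0,1,2}. norm (?v i) powr p)"
          using p by (intro sum_powr_le) auto
        finally have "norm (Y x) powr p \<le> 3 powr p * ((norm (Z x - X x) powr p + norm (X x) powr p) + norm (point_charges A0 n x) powr p)"
          by (simp add: add.assoc)
        then have "ennreal (norm (Y x) powr p) \<le> ennreal (3 powr p * ((norm (Z x - X x) powr p + norm (X x) powr p) + norm (point_charges A0 n x) powr p))"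
          by (rule ennreal_leI)
        then show ?thesis using True by (simp add: ennreal_mult)
      qed (simp add: Y_def)
    qed
    also have "\<dots> = ennreal (3 powr p) * (((\<integral>\<^sup>+x. ?I x * ennreal (norm (Z x - X x) powr p) \<partial>lborel) + (Lp_int p X)) + (\<integral>\<^sup>+x. ?I x * ennreal (norm (point_charges A0 n x) powr p) \<partial>lborel))"
    proof -
      have m1: "(\<lambda>x. ?I x * ennreal (norm (Z x - X x) powr p)) \<in> borel_measurable lborel" by measurable
      have m2: "(\<lambda>x. ennreal (norm (X x) powr p)) \<in> borel_measurable lborel" by measurable
      have m3: "(\<lambda>x. ?I x * ennreal (norm (point_charges A0 n x) powr p)) \<in> borel_measurable lborel" by measurable
      show ?thesis
        by (simp only: nn_integral_cmult nn_integral_add m1 m2 m3 borel_measurable_add)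
    qed
    also have "\<dots> < \<infinity>"
      using Xp point_charges_Lp[OF A0(1) A01 p A0(3), of n] order.strict_trans1[OF Ze, of \<infinity>]
      by (simp add: ennreal_mult_less_top)
    finally show ?thesis .
  qed
  have sol: "(pairing Y G) = 0" if t: "test_on R \<phi> G" for \<phi> G
  proof -
    have t1: "test_on 1 \<phi> G" using test_on_mono[OF t] R by simp
    have "Y x \<bullet> G x = Z x \<bullet> G x - point_charges A0 n x \<bullet> G x" for x
      using test_on_gradient_zero[OF t, of x] R by (cases "norm x < 1") (auto simp: Y_def inner_diff_left)
    then show ?thesis using Zd[OF t] point_charges_divergence[OF A01 t1, of n] by simp
  qed
  have "\<exists>V. continuous_on UNIV V \<and> (\<forall>i k. Ck_on k UNIV (\<lambda>x. V x $ i)) \<and>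
     (Lp_int p (\<lambda>x. V x - Y x)) \<le> ennreal \<delta>1 \<and>
     (\<forall>\<phi> G. test_on l \<phi> G \<longrightarrow> integrable_pairing V G \<and> (pairing V G) = 0)"
  proof (rule solenoidal_smoothing[OF Ym p Yp Y0 _ l _ \<delta>1])
    show "(pairing Y G) = 0" if "test_on R \<phi> G" for \<phi> G by (rule sol[OF that])
  qed (use l R in auto)
  then obtain V where Vc: "continuous_on UNIV V" and Vs: "\<And>i k. Ck_on k UNIV (\<lambda>x. V x $ i)"
    and Ve: "(Lp_int p (\<lambda>x. V x - Y x)) \<le> ennreal \<delta>1"
    and Vd: "\<And>\<phi> G. test_on l \<phi> G \<Longrightarrow> integrable_pairing V G \<and> (pairing V G) = 0"
    by blast
  have Vm [measurable]: "V \<in> borel_measurable borel" using Vc by (rule borel_measurable_continuous_onI)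
  define A where "A = {c\<in>A0. norm c < l}"
  define W where "W x = V x + point_charges A0 n x" for x
  have Wm [measurable]: "W \<in> borel_measurable borel" unfolding W_def[abs_def] by measurable
  have ch: "charged_on l W A n"
    unfolding charged_on_def
  proof (intro conjI allI impI)
    show "finite A" "A \<subseteq> ball 0 l" using A0 by (auto simp: A_def)
    fix \<phi> G assume t: "test_on l \<phi> G"
    have t1: "test_on 1 \<phi> G" using test_on_mono[OF t] l R by simp
    have "(pairing W G) = (pairing V G) + (\<integral>x. point_charges A0 n x \<bullet> G x \<partial>lborel)"
      unfolding W_def inner_add_left using Vd[OF t] point_charges_divergence(1)[OF A01 t1, of n]
      by (intro Bochner_Integration.integral_add) auto
    also have "\<dots> = - (\<Sum>c\<in>A0. 2 * pi * of_int (n c) * \<phi> c)"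
      using Vd[OF t] point_charges_divergence(2)[OF A01 t1, of n] by simp
    also have "(\<Sum>c\<in>A0. 2 * pi * of_int (n c) * \<phi> c) = (\<Sum>c\<in>A. 2 * pi * of_int (n c) * \<phi> c)"
    proof (rule sum.mono_neutral_right)
      have "\<phi> x = 0" if "\<not> norm x < l" for x using t that by (auto simp: test_on_def)
      then show "\<forall>c\<in>A0 - A. 2 * pi * of_int (n c) * \<phi> c = 0" by (auto simp: A_def)
    qed (use A0 in \<open>auto simp: A_def\<close>)
    finally show "(pairing W G) = - (\<Sum>c\<in>A. 2 * pi * of_int (n c) * \<phi> c)" .
  qed
  have sm: "Ck_on k (ball 0 l - A) (\<lambda>x. W x $ i)" for i k
  proof -
    have S: "open (ball 0 l - A)" using A0(1) by (intro open_Diff finite_imp_closed) (auto simp: A_def)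
    have "Ck_on k (ball 0 l - A) (\<lambda>x. V x $ i + (\<Sum>c\<in>A0. (2 * pi * of_int (n c) / point_flux) * point_field c x $ i))"
      by (intro Ck_on_add[OF S] Ck_on_sum[OF S] Ck_on_mult[OF S] Ck_on_const[OF S] Ck_on_point_field[OF S] Ck_on_subset[OF Vs])
        (auto simp: A_def)
    then show ?thesis by (simp add: W_def point_charges_def)
  qed
  have "(Lp_int_on (ball 0 1) p (\<lambda>x. W x - X x))
    \<le> (\<integral>\<^sup>+x. ennreal (2 powr p) * (ennreal (norm (V x - Y x) powr p) + indicator (ball 0 1) x * ennreal (norm (Z x - X x) powr p)) \<partial>lborel)"
  proof (intro nn_integral_mono)
    fix x :: "real^3"
    show "indicator (ball 0 1) x * ennreal (norm (W x - X x) powr p) \<le> ennreal (2 powr p) * (ennreal (norm (V x - Y x) powr p) + indicator (ball 0 1) x * ennreal (norm (Z x - X x) powr p))"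
    proof (cases "x \<in> ball 0 1")
      case True
      then have d: "W x - X x = (V x - Y x) + (Z x - X x)" by (simp add: W_def Y_def)
      have "norm (W x - X x) powr p \<le> 2 powr p * (norm (V x - Y x) powr p + norm (Z x - X x) powr p)"
        unfolding d by (rule norm_add_powr_le[OF p0])
      then have "ennreal (norm (W x - X x) powr p) \<le> ennreal (2 powr p * (norm (V x - Y x) powr p + norm (Z x - X x) powr p))"
        by (rule ennreal_leI)
      then show ?thesis using True by (simp add: ennreal_mult)
    qed simp
  qed
  also have "\<dots> = ennreal (2 powr p) * ((Lp_int p (\<lambda>x. V x - Y x)) + (Lp_int_on (ball 0 1) p (\<lambda>x. Z x - X x)))"
  proof -
    have m1: "(\<lambda>x. ennreal (norm (V x - Y x) powr p)) \<in> borel_measurable lborel" by measurable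
    have m2: "(\<lambda>x. indicator (ball 0 1) x * ennreal (norm (Z x - X x) powr p)) \<in> borel_measurable lborel" by measurable
    show ?thesis by (simp only: nn_integral_cmult nn_integral_add m1 m2 borel_measurable_add)
  qed
  also have "\<dots> \<le> ennreal (2 powr p) * (ennreal \<delta>1 + ennreal \<delta>1)"
    by (intro mult_left_mono add_mono Ve Ze) simp
  also have "\<dots> = ennreal \<delta>"
    using \<delta>1 by (simp add: ennreal_mult[symmetric] ennreal_plus[symmetric] \<delta>1_def field_simps del: ennreal_plus)
  finally show ?thesis using Wm ch sm by blast
qed

lemma nn_integral_combination3:
  fixes a b :: ennreal
  assumes [measurable]: "f \<in> borel_measurable M" "g \<in> borel_measurable M" "h \<in> borel_measurable M"
  shows "(\<integral>\<^sup>+x. a * ((f x + g x) + b * h x) \<partial>M) = a * (((\<integral>\<^sup>+x. f x \<partial>M) + (\<integral>\<^sup>+x. g x \<partial>M)) + b * (\<integral>\<^sup>+x. h x \<partial>M))"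
  by (simp add: nn_integral_cmult nn_integral_add)

text \<open>The factor \<open>l\<^sup>2\<close> is that of the pullback of a 2-form; it preserves charges.\<close>

lemma charged_dilate:
  assumes ch: "charged_on l W A n" and l: "l > 0" and W [measurable]: "W \<in> borel_measurable borel"
  shows "charged_on 1 (\<lambda>x. l\<^sup>2 *\<^sub>R W (l *\<^sub>R x)) ((\<lambda>c. (1 / l) *\<^sub>R c) ` A) (\<lambda>c. n (l *\<^sub>R c))"
  unfolding charged_on_def
proof (intro conjI allI impI)
  show "finite ((\<lambda>c. (1 / l) *\<^sub>R c) ` A)" using ch by (simp add: charged_on_def)
  show "(\<lambda>c. (1 / l) *\<^sub>R c) ` A \<subseteq> ball 0 1" using ch l by (auto simp: charged_on_def field_simps)
  fix \<phi> G assume t: "test_on 1 \<phi> G"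
  have [measurable]: "G \<in> borel_measurable borel" using t by (auto simp: test_on_def intro: has_gradient_borel)
  have "(\<integral>x. W x \<bullet> ((1 / l) *\<^sub>R G ((1 / l) *\<^sub>R x)) \<partial>lborel) = l ^ 3 * (\<integral>x. W (l *\<^sub>R x) \<bullet> ((1 / l) *\<^sub>R G ((1 / l) *\<^sub>R l *\<^sub>R x)) \<partial>lborel)"
    by (rule integral_dilate[OF l]) measurable
  also have "\<dots> = l ^ 3 * (1 / l) * (\<integral>x. W (l *\<^sub>R x) \<bullet> G x \<partial>lborel)"
    using l by simp
  also have "l ^ 3 * (1 / l) = l\<^sup>2" using l by (simp add: power3_eq_cube power2_eq_square)
  finally have "(\<integral>x. l\<^sup>2 *\<^sub>R W (l *\<^sub>R x) \<bullet> G x \<partial>lborel) = (\<integral>x. W x \<bullet> ((1 / l) *\<^sub>R G ((1 / l) *\<^sub>R x)) \<partial>lborel)"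
    by simp
  also have "\<dots> = - (\<Sum>c\<in>A. 2 * pi * of_int (n c) * \<phi> ((1 / l) *\<^sub>R c))"
    using ch test_on_dilate[OF t l] unfolding charged_on_def by blast
  also have "(\<Sum>c\<in>A. 2 * pi * of_int (n c) * \<phi> ((1 / l) *\<^sub>R c)) = (\<Sum>c\<in>(\<lambda>c. (1 / l) *\<^sub>R c) ` A. 2 * pi * of_int (n (l *\<^sub>R c)) * \<phi> c)"
    using l by (subst sum.reindex) (auto simp: inj_on_def)
  finally show "(\<integral>x. l\<^sup>2 *\<^sub>R W (l *\<^sub>R x) \<bullet> G x \<partial>lborel) = - (\<Sum>c\<in>(\<lambda>c. (1 / l) *\<^sub>R c) ` A. 2 * pi * of_int (n (l *\<^sub>R c)) * \<phi> c)" .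
qed

text \<open>The approximant on the smaller ball is dilated to the unit ball. The error consists of the
  dilated error on the small ball, of the difference between \<open>X\<close> and its dilation, and of the effect
  of the factor \<open>l\<^sup>2\<close>.\<close>

lemma charged_field_approximation:
  fixes X :: "real^3 \<Rightarrow> real^3"
  assumes X [measurable]: "X \<in> borel_measurable borel" and p: "1 \<le> p"
    and Xp: "(Lp_int p X) < \<infinity>"
    and supp: "\<And>x. norm x \<ge> 1 \<Longrightarrow> X x = 0"
    and flux: "\<And>\<eta>. \<eta> > 0 \<Longrightarrow> \<exists>r>0. r < \<eta> \<and> integral_flux X r"
    and \<delta>: "\<delta> > 0"
  shows "\<exists>W A n. W \<in> borel_measurable borel \<and> charged_on 1 W A n \<and> (\<forall>i k. Ck_on k (ball 0 1 - A) (\<lambda>x. W x $ i)) \<and>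
     (Lp_int_on (ball 0 1) p (\<lambda>x. W x - X x)) \<le> ennreal \<delta>"
proof -
  have p0: "p > 0" "0 \<le> p" using p by auto
  define I where "I = enn2real (Lp_int p X)"
  have I: "(Lp_int p X) = ennreal I" "I \<ge> 0"
    using Xp by (auto simp: I_def)
  define \<delta>1 where "\<delta>1 = \<delta> / (3 powr p * 10)"
  have \<delta>1: "\<delta>1 > 0" using \<delta> by (simp add: \<delta>1_def)
  obtain \<eta> where \<eta>: "\<eta> > 0" "\<And>l w. \<bar>l - 1\<bar> \<le> \<eta> \<Longrightarrow> norm w \<le> \<eta> \<Longrightarrow>
     (Lp_int p (\<lambda>x. X (l *\<^sub>R x + w) - X x)) \<le> ennreal \<delta>1"
    using Lp_affine_continuity[OF X p0(1) Xp supp \<delta>1] by blast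
  define \<tau> where "\<tau> = (\<delta>1 / (I + 1)) powr (1 / p)"
  have \<tau>: "\<tau> > 0" "\<tau> powr p = \<delta>1 / (I + 1)" using \<delta>1 I p0 by (auto simp: \<tau>_def powr_powr)
  \<comment> \<open>Close to \<open>1\<close> in three ways: the change of variables costs at most a factor \<open>8\<close>, \<open>X\<close> moves little under the dilation, and \<open>1 - l\<^sup>2 \<le> \<tau>\<close>.\<close>
  define l where "l = 1 - min (1/2) (min \<eta> (\<tau> / 2))"
  have l: "1/2 \<le> l" "l < 1" "\<bar>l - 1\<bar> \<le> \<eta>" "1 - l \<le> \<tau> / 2" using \<eta>(1) \<tau>(1) by (auto simp: l_def)
  have l0: "l > 0" using l by simp
  have l2: "1 - l\<^sup>2 \<le> \<tau>" "0 \<le> 1 - l\<^sup>2" "l\<^sup>2 \<le> 1"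
  proof -
    have "1 - l\<^sup>2 = (1 - l) * (1 + l)" by (simp add: power2_eq_square algebra_simps)
    also have "\<dots> \<le> (\<tau> / 2) * 2" using l \<tau> by (intro mult_mono) auto
    finally show "1 - l\<^sup>2 \<le> \<tau>" by simp
    show "l\<^sup>2 \<le> 1" using l by (simp add: power_le_one)
    then show "0 \<le> 1 - l\<^sup>2" by simp
  qed
  obtain W A n where W [measurable]: "W \<in> borel_measurable borel" and ch: "charged_on l W A n" and sm: "\<And>i k. Ck_on k (ball 0 l - A) (\<lambda>x. W x $ i)"
    and err: "(Lp_int_on (ball 0 1) p (\<lambda>x. W x - X x)) \<le> ennreal \<delta>1"
    using smooth_charged_approximation[OF X p Xp supp flux _ _ \<delta>1, of "(1 + l) / 2" l] l by auto
  let ?W = "\<lambda>x. l\<^sup>2 *\<^sub>R W (l *\<^sub>R x)"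
  let ?A = "(\<lambda>c. (1 / l) *\<^sub>R c) ` A"
  have Wm: "?W \<in> borel_measurable borel" by measurable
  have sm': "Ck_on k (ball 0 1 - ?A) (\<lambda>x. ?W x $ i)" for i k
  proof -
    have fin: "finite A" using ch by (simp add: charged_on_def)
    have S: "open (ball 0 l - A)" "open (ball 0 1 - ?A)" using fin by (auto intro!: open_Diff finite_imp_closed)
    have "Ck_on k (ball 0 1 - ?A) (\<lambda>x. W (l *\<^sub>R x) $ i)"
    proof (rule Ck_on_subset[OF Ck_on_scale[OF S(1) sm, where l = l]])
      show "ball 0 1 - ?A \<subseteq> {x. l *\<^sub>R x \<in> ball 0 l - A}"
      proof
        fix x assume x: "x \<in> ball 0 1 - ?A"
        have "l *\<^sub>R x \<notin> A"
        proof
          assume "l *\<^sub>R x \<in> A"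
          then have "(1 / l) *\<^sub>R l *\<^sub>R x \<in> ?A" by blast
          then show False using x l0 by simp
        qed
        then show "x \<in> {x. l *\<^sub>R x \<in> ball 0 l - A}" using x l0 by simp
      qed
    qed
    then have "Ck_on k (ball 0 1 - ?A) (\<lambda>x. l\<^sup>2 * W (l *\<^sub>R x) $ i)"
      by (intro Ck_on_mult Ck_on_const S)
    then show ?thesis by simp
  qed
  let ?E = "\<lambda>x. indicator (ball 0 1) x * ennreal (norm (W x - X x) powr p)"
  have "(Lp_int_on (ball 0 1) p (\<lambda>x. ?W x - X x))
    \<le> (\<integral>\<^sup>+x. ennreal (3 powr p) * ((?E (l *\<^sub>R x + 0) + ennreal (norm (X (l *\<^sub>R x + 0) - X x) powr p)) + ennreal (\<tau> powr p) * ennreal (norm (X x) powr p)) \<partial>lborel)"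
  proof (intro nn_integral_mono)
    fix x :: "real^3"
    show "indicator (ball 0 1) x * ennreal (norm (?W x - X x) powr p) \<le> ennreal (3 powr p) * ((?E (l *\<^sub>R x + 0) + ennreal (norm (X (l *\<^sub>R x + 0) - X x) powr p)) + ennreal (\<tau> powr p) * ennreal (norm (X x) powr p))"
    proof (cases "x \<in> ball 0 1")
      case True
      have "l * norm x < 1 * 1" using True l l0 by (intro mult_strict_mono') auto
      then have lx: "l *\<^sub>R x \<in> ball 0 1" using l0 by simp
      let ?v = "\<lambda>i::nat. if i = 0 then l\<^sup>2 *\<^sub>R (W (l *\<^sub>R x) - X (l *\<^sub>R x)) else if i = 1 then l\<^sup>2 *\<^sub>R (X (l *\<^sub>R x) - X x) else - ((1 - l\<^sup>2) *\<^sub>R X x)"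
      have "?W x - X x = (\<Sum>i\<in>{0,1,2}. ?v i)" by (simp add: algebra_simps)
      then have "norm (?W x - X x) powr p \<le> (\<Sum>i\<in>{0,1,2}. norm (?v i)) powr p"
        using p by (simp only:) (intro powr_mono2 norm_sum, auto)
      also have "\<dots> \<le> real (card {0,1,2::nat}) powr p * (\<Sum>i\<in>{0,1,2}. norm (?v i) powr p)"
        using p by (intro sum_powr_le) auto
      also have "\<dots> = 3 powr p * ((norm (?v 0) powr p + norm (?v 1) powr p) + norm (?v 2) powr p)"
        by (simp add: add.assoc)
      also have "\<dots> \<le> 3 powr p * ((norm (W (l *\<^sub>R x) - X (l *\<^sub>R x)) powr p + norm (X (l *\<^sub>R x) - X x) powr p) + \<tau> powr p * norm (X x) powr p)"
      proof (intro mult_left_mono add_mono)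
        have c: "norm (l\<^sup>2 *\<^sub>R v) powr p \<le> norm v powr p" for v :: "real^3"
          using p l2 by (intro powr_mono2) (auto intro: mult_left_le_one_le)
        show "norm (?v 0) powr p \<le> norm (W (l *\<^sub>R x) - X (l *\<^sub>R x)) powr p" using c by simp
        show "norm (?v 1) powr p \<le> norm (X (l *\<^sub>R x) - X x) powr p" using c by simp
        have "norm ((1 - l\<^sup>2) *\<^sub>R X x) powr p \<le> (\<tau> * norm (X x)) powr p"
          using p l2 by (intro powr_mono2) (auto intro: mult_right_mono)
        then show "norm (?v 2) powr p \<le> \<tau> powr p * norm (X x) powr p" using \<tau> by (simp add: powr_mult)
      qed simp
      finally have "ennreal (norm (?W x - X x) powr p) \<le> ennreal (3 powr p * ((norm (W (l *\<^sub>R x) - X (l *\<^sub>R x)) powr p + norm (X (l *\<^sub>R x) - X x) powr p) + \<tau> powr p * norm (X x) powr p))"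
        by (rule ennreal_leI)
      then show ?thesis using True lx by (simp add: ennreal_mult)
    qed simp
  qed
  also have "\<dots> = ennreal (3 powr p) * (((\<integral>\<^sup>+x. ?E (l *\<^sub>R x + 0) \<partial>lborel) + (Lp_int p (\<lambda>x. X (l *\<^sub>R x + 0) - X x))) + ennreal (\<tau> powr p) * (Lp_int p X))"
    by (rule nn_integral_combination3) measurable
  also have "\<dots> \<le> ennreal (3 powr p) * ((8 * ennreal \<delta>1 + ennreal \<delta>1) + ennreal (\<tau> powr p) * ennreal I)"
  proof (intro mult_left_mono add_mono)
    have "(\<integral>\<^sup>+x. ?E (l *\<^sub>R x + 0) \<partial>lborel) \<le> 8 * (\<integral>\<^sup>+x. ?E x \<partial>lborel)"
      by (rule nn_integral_affine_le) (use l in auto)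
    also have "\<dots> \<le> 8 * ennreal \<delta>1" by (intro mult_left_mono err) simp
    finally show "(\<integral>\<^sup>+x. ?E (l *\<^sub>R x + 0) \<partial>lborel) \<le> 8 * ennreal \<delta>1" .
    show "(Lp_int p (\<lambda>x. X (l *\<^sub>R x + 0) - X x)) \<le> ennreal \<delta>1"
      by (rule \<eta>(2)) (use l \<eta>(1) in auto)
  qed (simp_all add: I)
  also have "\<dots> = ennreal (3 powr p * ((8 * \<delta>1 + \<delta>1) + \<tau> powr p * I))"
  proof -
    have 8: "8 * ennreal \<delta>1 = ennreal (8 * \<delta>1)" using \<delta>1 by (simp add: ennreal_mult)
    show ?thesis unfolding 8 using \<delta>1 I(2)
      by (simp add: ennreal_mult[symmetric] ennreal_plus[symmetric] del: ennreal_plus)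
  qed
  also have "\<dots> \<le> ennreal \<delta>"
  proof (rule ennreal_leI)
    have "\<tau> powr p * I = \<delta>1 * (I / (I + 1))" by (simp add: \<tau>(2))
    also have "\<dots> \<le> \<delta>1 * 1" using \<delta>1 I(2) by (intro mult_left_mono) auto
    finally have "(8 * \<delta>1 + \<delta>1) + \<tau> powr p * I \<le> 10 * \<delta>1" by simp
    then have "3 powr p * ((8 * \<delta>1 + \<delta>1) + \<tau> powr p * I) \<le> 3 powr p * (10 * \<delta>1)" by (intro mult_left_mono) auto
    also have "\<dots> = \<delta>" by (simp add: \<delta>1_def)
    finally show "3 powr p * ((8 * \<delta>1 + \<delta>1) + \<tau> powr p * I) \<le> \<delta>" .
  qed
  finally show ?thesis using Wm sm' charged_dilate[OF ch l0 W] by blast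
qed

section \<open>Lebesgue points\<close>

lemma one_sided_average:
  fixes f :: "real \<Rightarrow> real"
  assumes f: "\<And>a b. f integrable_on cbox a b"
  shows "\<exists>N. negligible N \<and> (\<forall>x. x \<notin> N \<longrightarrow> ((\<lambda>h. integral {x..x+h} f / h) \<longlongrightarrow> f x) (at_right 0))"
proof -
  obtain N where N: "negligible N" and lim: "\<And>x e. \<lbrakk>x \<notin> N; 0 < e\<rbrakk> \<Longrightarrow>
               \<exists>d>0. \<forall>h. 0 < h \<and> h < d \<longrightarrow> norm(integral (cbox x (x + h *\<^sub>R One)) f /\<^sub>R h ^ DIM(real) - f x) < e"
    using integrable_ccontinuous_explicit[OF f] by blast
  have "((\<lambda>h. integral {x..x+h} f / h) \<longlongrightarrow> f x) (at_right 0)" if x: "x \<notin> N" for x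
  proof (rule tendstoI)
    fix e :: real assume "e > 0"
    from lim[OF x this] obtain d where d: "d > 0" "\<And>h. 0 < h \<Longrightarrow> h < d \<Longrightarrow> norm(integral {x..x+h} f / h - f x) < e"
      by (auto simp: divide_inverse mult.commute)
    then show "eventually (\<lambda>h. dist (integral {x..x+h} f / h) (f x) < e) (at_right 0)"
      by (auto simp: eventually_at_right_field dist_norm intro!: exI[of _ d])
  qed
  with N show ?thesis by blast
qed

text \<open>The left half of the interval is treated by reflection.\<close>

lemma two_sided_average:
  fixes f :: "real \<Rightarrow> real"
  assumes f: "\<And>a b. f integrable_on cbox a b"
  shows "\<exists>N. negligible N \<and> (\<forall>x. x \<notin> N \<longrightarrow> ((\<lambda>h. integral {x-h..x+h} f / (2 * h)) \<longlongrightarrow> f x) (at_right 0))"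
proof -
  obtain N1 where N1: "negligible N1" and l1: "\<And>x. x \<notin> N1 \<Longrightarrow> ((\<lambda>h. integral {x..x+h} f / h) \<longlongrightarrow> f x) (at_right 0)"
    using one_sided_average[OF f] by blast
  have "(\<lambda>t. f (- t)) integrable_on cbox a b" for a b
    using integrable_reflect[of f "-a" "-b"] f by simp
  then obtain N2 where N2: "negligible N2" and l2: "\<And>x. x \<notin> N2 \<Longrightarrow> ((\<lambda>h. integral {x..x+h} (\<lambda>t. f (- t)) / h) \<longlongrightarrow> f (- x)) (at_right 0)"
    using one_sided_average[of "\<lambda>t. f (- t)"] by blast
  have "negligible (uminus ` N2)"
    by (rule negligible_differentiable_image_negligible[OF _ N2]) (auto intro!: derivative_intros)
  moreover have "((\<lambda>h. integral {x-h..x+h} f / (2 * h)) \<longlongrightarrow> f x) (at_right 0)" if x: "x \<notin> N1 \<union> uminus ` N2" for x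
  proof -
    have "- x \<notin> N2" using x by (metis Un_iff imageI minus_minus)
    from tendsto_add[OF l1[of x] l2[OF this]] x
    have s: "((\<lambda>h. integral {x..x+h} f / h + integral {- x..- x+h} (\<lambda>t. f (- t)) / h) \<longlongrightarrow> f x + f (- (- x))) (at_right 0)"
      by blast
    have "((\<lambda>h. (integral {x..x+h} f / h + integral {- x..- x+h} (\<lambda>t. f (- t)) / h) / 2) \<longlongrightarrow> (f x + f (- (- x))) / 2) (at_right 0)"
      by (intro tendsto_divide tendsto_const s) simp
    then have "((\<lambda>h. (integral {x..x+h} f / h + integral {- x..- x+h} (\<lambda>t. f (- t)) / h) / 2) \<longlongrightarrow> f x) (at_right 0)" by simp
    moreover have "eventually (\<lambda>h. (integral {x..x+h} f / h + integral {- x..- x+h} (\<lambda>t. f (- t)) / h) / 2 = integral {x-h..x+h} f / (2 * h)) (at_right 0)"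
      using eventually_at_right_less[of "0::real"]
    proof eventually_elim
      case (elim h)
      have "integral {- x..- x+h} (\<lambda>t. f (- t)) = integral {x-h..x} f"
        using Henstock_Kurzweil_Integration.integral_reflect_real[of x "x - h" f] by (simp add: algebra_simps)
      moreover have "integral {x-h..x} f + integral {x..x+h} f = integral {x-h..x+h} f"
        by (rule Henstock_Kurzweil_Integration.integral_combine) (use elim f[of "x - h" "x + h"] in auto)
      ultimately show ?case using elim by (simp add: field_simps)
    qed
    ultimately show ?thesis by (rule Lim_transform_eventually)
  qed
  ultimately show ?thesis using N1 by (intro exI[of _ "N1 \<union> uminus ` N2"]) auto
qed

text \<open>Averages of \<open>|f - q|\<close> converge almost everywhere, simultaneously for all rational \<open>q\<close>. Choosing \<open>q\<close>
  close to \<open>f r\<close> controls the averages of \<open>|f - f r|\<close>.\<close>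

lemma AE_lebesgue_point:
  fixes f :: "real \<Rightarrow> real"
  assumes f: "integrable lebesgue f"
  shows "AE r in lebesgue. lebesgue_point f r"
proof -
  have si: "set_integrable lebesgue {a..b} (\<lambda>t. \<bar>f t - q\<bar>)" for a b q
  proof -
    have "set_integrable lebesgue {a..b} f"
      unfolding set_integrable_def by (rule integrable_mult_indicator[OF _ f]) simp
    moreover have "set_integrable lebesgue {a..b} (\<lambda>_. q)"
      by (simp add: set_integrable_def flip: lmeasurable_iff_integrable)
    ultimately show ?thesis by (intro set_integrable_abs set_integral_diff)
  qed
  have hk: "(\<lambda>t. \<bar>f t - q\<bar>) integrable_on cbox a b" for q a b
    using set_lebesgue_integral_eq_integral(1)[OF si[of a b q]] by simp
  have "\<exists>N. negligible N \<and> (\<forall>x. x \<notin> N \<longrightarrow> ((\<lambda>h. integral {x-h..x+h} (\<lambda>t. \<bar>f t - q\<bar>) / (2 * h)) \<longlongrightarrow> \<bar>f x - q\<bar>) (at_right 0))" for q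
    by (rule two_sided_average[OF hk])
  note ex = this
  define N where "N q = (SOME N. negligible N \<and> (\<forall>x. x \<notin> N \<longrightarrow> ((\<lambda>h. integral {x-h..x+h} (\<lambda>t. \<bar>f t - q\<bar>) / (2 * h)) \<longlongrightarrow> \<bar>f x - q\<bar>) (at_right 0)))" for q
  have N: "negligible (N q)" and lim: "\<And>x. x \<notin> N q \<Longrightarrow> ((\<lambda>h. integral {x-h..x+h} (\<lambda>t. \<bar>f t - q\<bar>) / (2 * h)) \<longlongrightarrow> \<bar>f x - q\<bar>) (at_right 0)" for q
    using someI_ex[OF ex[of q]] unfolding N_def[symmetric] by blast+
  have "AE r in lebesgue. r \<notin> N q" for q
    using N[of q] by (auto simp: negligible_iff_null_sets intro: AE_not_in)
  then have "AE r in lebesgue. \<forall>q\<in>\<rat>. r \<notin> N q"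
    by (subst AE_ball_countable) (auto simp: countable_rat)
  then show ?thesis
  proof eventually_elim
    case (elim r)
    have int: "\<exists>e>0. set_integrable lebesgue {r-e..r+e} f"
      using integrable_mult_indicator[OF _ f, of "{r-1..r+1}"] unfolding set_integrable_def by (intro exI[of _ 1]) simp
    have eq: "set_lebesgue_integral lebesgue {r-h..r+h} (\<lambda>t. \<bar>f t - q\<bar>) = integral {r-h..r+h} (\<lambda>t. \<bar>f t - q\<bar>)" for h q
      by (rule set_lebesgue_integral_eq_integral(2)[OF si])
    have "((\<lambda>e. 1 / (2 * e) * set_lebesgue_integral lebesgue {r-e..r+e} (\<lambda>t. \<bar>f t - f r\<bar>)) \<longlongrightarrow> 0) (at_right 0)"
    proof (rule tendstoI)
      fix \<epsilon> :: real assume \<epsilon>: "\<epsilon> > 0"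
      have "f r - \<epsilon> / 3 < f r + \<epsilon> / 3" using \<epsilon> by simp
      from Rats_dense_in_real[OF this] obtain q where q0: "q \<in> \<rat>" "f r - \<epsilon> / 3 < q" "q < f r + \<epsilon> / 3" by blast
      have "\<bar>f r - q\<bar> < \<epsilon> / 3" using q0(2,3) by linarith
      with q0(1) have q: "q \<in> \<rat>" "\<bar>f r - q\<bar> < \<epsilon> / 3" by auto
      have "r \<notin> N q" using elim q by blast
      from order_tendstoD(2)[OF lim[OF this], of "2 * \<epsilon> / 3"] q \<epsilon>
      have "eventually (\<lambda>h. integral {r-h..r+h} (\<lambda>t. \<bar>f t - q\<bar>) / (2 * h) < 2 * \<epsilon> / 3) (at_right 0)" by simp
      then show "eventually (\<lambda>e. dist (1 / (2 * e) * set_lebesgue_integral lebesgue {r-e..r+e} (\<lambda>t. \<bar>f t - f r\<bar>)) 0 < \<epsilon>) (at_right 0)"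
        using eventually_at_right_less[of "0::real"]
      proof eventually_elim
        case (elim h)
        have hk': "(\<lambda>t. \<bar>f t - q\<bar>) integrable_on {r-h..r+h}" "(\<lambda>t. \<bar>f t - f r\<bar>) integrable_on {r-h..r+h}"
          using hk[of _ "r - h" "r + h"] by simp_all
        have "integral {r-h..r+h} (\<lambda>t. \<bar>f t - f r\<bar>) \<le> integral {r-h..r+h} (\<lambda>t. \<bar>f t - q\<bar> + \<bar>f r - q\<bar>)"
          by (intro integral_le Henstock_Kurzweil_Integration.integrable_add hk') auto
        also have "\<dots> = integral {r-h..r+h} (\<lambda>t. \<bar>f t - q\<bar>) + 2 * h * \<bar>f r - q\<bar>"
          using elim by (subst Henstock_Kurzweil_Integration.integral_add) (auto simp: hk' content_real)
        finally have "integral {r-h..r+h} (\<lambda>t. \<bar>f t - f r\<bar>) / (2 * h) \<le> (integral {r-h..r+h} (\<lambda>t. \<bar>f t - q\<bar>) + 2 * h * \<bar>f r - q\<bar>) / (2 * h)"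
          using elim by (intro divide_right_mono) auto
        also have "\<dots> = integral {r-h..r+h} (\<lambda>t. \<bar>f t - q\<bar>) / (2 * h) + \<bar>f r - q\<bar>"
          using elim by (simp add: add_divide_distrib)
        also have "\<dots> < \<epsilon>" using elim q by simp
        finally have "integral {r-h..r+h} (\<lambda>t. \<bar>f t - f r\<bar>) / (2 * h) < \<epsilon>" .
        moreover have "0 \<le> integral {r-h..r+h} (\<lambda>t. \<bar>f t - f r\<bar>)" by (rule Henstock_Kurzweil_Integration.integral_nonneg[OF hk'(2)]) simp
        ultimately show ?case using elim by (simp add: eq dist_norm)
      qed
    qed
    with int show ?case by (simp add: lebesgue_point_def)
  qed
qed

section \<open>The flux condition\<close>

definition form_vec :: "form2 \<Rightarrow> real^3 \<Rightarrow> real^3" where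
  "form_vec F x = (\<chi> j. F x (axis (j + 1) 1) (axis (j + 2) 1))"

lemma numeral_wrap3: "(4::3) = 1" "(5::3) = 2"
  by simp_all

text \<open>The 3-form \<open>F \<and> \<alpha>\<close> is the scalar product of the vector field of \<open>F\<close> with \<open>\<alpha>\<close>.\<close>

lemma hodge3_wedge21: "hodge3 (wedge21 (F x) \<alpha>) = (\<Sum>j\<in>UNIV. form_vec F x $ j * \<alpha> (axis j 1))"
  by (simp add: hodge3_def wedge21_def form_vec_def sum_3 numeral_wrap3)

lemma infnorm_eq_coord:
  fixes v :: "real^3"
  assumes "s \<in> {-1, 1}" and "\<And>i. \<bar>v $ i\<bar> \<le> s * v $ j"
  shows "infnorm v = s * v $ j"
proof (rule antisym)
  show "infnorm v \<le> s * v $ j"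
    unfolding infnorm_cart by (rule cSup_least) (use assms(2) in auto)
  have "s * v $ j \<le> \<bar>v $ j\<bar>" using assms(1) by auto
  then show "s * v $ j \<le> infnorm v" using component_le_infnorm_cart[of v j] by linarith
qed

text \<open>Near a point of an open face one coordinate dominates, and there the max norm is linear.\<close>

lemma dif_infnorm_face:
  assumes s: "s \<in> {-1, 1}" and u: "\<bar>fst u\<bar> < r" "\<bar>snd u\<bar> < r"
  shows "dif (\<lambda>y. infnorm (y - x0)) (x0 + fpt j (s * r) u) = (\<lambda>h. s * h $ j)"
proof (rule dif_eq)
  let ?S = "{y. \<bar>(y - x0) $ (j + 1)\<bar> < s * (y - x0) $ j} \<inter> {y. \<bar>(y - x0) $ (j + 2)\<bar> < s * (y - x0) $ j}"
  have "((\<lambda>y. s * y $ j) has_derivative (\<lambda>h. s * h $ j)) (at (x0 + fpt j (s * r) u))"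
    by (auto intro!: derivative_eq_intros has_derivative_nth)
  then have "((\<lambda>y. s * y $ j - s * x0 $ j) has_derivative (\<lambda>h. s * h $ j - 0)) (at (x0 + fpt j (s * r) u))"
    by (intro has_derivative_diff has_derivative_const)
  then have d: "((\<lambda>y. s * (y - x0) $ j) has_derivative (\<lambda>h. s * h $ j)) (at (x0 + fpt j (s * r) u))"
    by (simp add: right_diff_distrib)
  show "((\<lambda>y. infnorm (y - x0)) has_derivative (\<lambda>h. s * h $ j)) (at (x0 + fpt j (s * r) u))"
  proof (rule has_derivative_transform_within_open[OF d])
    show "open ?S" by (intro open_Int open_Collect_less continuous_intros)
    show "x0 + fpt j (s * r) u \<in> ?S" using u s by auto
    fix y assume y: "y \<in> ?S"
    have "\<forall>i. \<bar>(y - x0) $ i\<bar> \<le> s * (y - x0) $ j"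
      unfolding all_cyclic[of _ j] using y s by auto
    then show "s * (y - x0) $ j = infnorm (y - x0)" by (intro infnorm_eq_coord[OF s, symmetric]) blast
  qed
qed

lemma restr_density_face:
  assumes s: "s \<in> {-1, 1}" and u: "\<bar>fst u\<bar> < r" "\<bar>snd u\<bar> < r"
  shows "restr_density F x0 (x0 + fpt j (s * r) u) = s * form_vec F (x0 + fpt j (s * r) u) $ j"
proof -
  have "(\<Sum>i\<in>UNIV. v $ i * (s * axis i 1 $ j)) = s * v $ j" for v :: "real^3"
    unfolding sum_cyclic[of _ j] by (simp add: axis_def)
  then show ?thesis
    unfolding restr_density_def hodge3_wedge21 dif_infnorm_face[OF s u] by blast
qed

lemma face_pt_fpt: "face_pt r x0 j s q = x0 + fpt j (s * (r / 2)) q"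
  by (simp add: face_pt_def fpt_def)

text \<open>A null set meets almost every plane parallel to a face in a null set.\<close>

lemma AE_face:
  assumes ae: "AE x in lborel. P x" and s: "s \<in> {-1, 1::real}"
  shows "AE r in lborel. AE q in lborel. P (x0 + fpt j (s * (r / 2)) q)"
proof -
  obtain N where N: "{x\<in>space lborel. \<not> P x} \<subseteq> N" "emeasure lborel N = 0" "N \<in> sets lborel"
    using ae by (rule AE_E)
  have Nb [measurable]: "N \<in> sets borel" using N(3) by simp
  have "(\<integral>\<^sup>+z. \<integral>\<^sup>+q. indicator N (x0 + fpt j (s * z) q) \<partial>lborel \<partial>lborel) = (\<integral>\<^sup>+x. indicator N x \<partial>lborel)"
    by (rule nn_integral_fpt[OF _ s, symmetric]) simp
  also have "\<dots> = 0" using N by simp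
  finally have z: "(\<integral>\<^sup>+z. \<integral>\<^sup>+q. indicator N (x0 + fpt j (s * z) q) \<partial>lborel \<partial>lborel) = 0" .
  have m [measurable]: "(\<lambda>z. \<integral>\<^sup>+q. indicator N (x0 + fpt j (s * z) q) \<partial>lborel) \<in> borel_measurable borel"
    using lborel.borel_measurable_nn_integral[of "\<lambda>z q. indicator N (x0 + fpt j (s * z) q)" lborel] by simp
  have "AE z in lborel. (\<integral>\<^sup>+q. indicator N (x0 + fpt j (s * z) q) \<partial>lborel) = 0"
    using z by (subst (asm) nn_integral_0_iff_AE) auto
  then have "AE r in lborel. (\<integral>\<^sup>+q. indicator N (x0 + fpt j (s * (0 + 1/2 * r)) q) \<partial>lborel) = 0"
    by (rule AE_borel_affine[rotated 2]) auto
  then show ?thesis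
  proof eventually_elim
    case (elim r)
    have "(\<lambda>q. indicator N (x0 + fpt j (s * (0 + 1/2 * r)) q)) \<in> borel_measurable lborel" by measurable
    from nn_integral_0_iff_AE[OF this] elim
    have "AE q in lborel. indicator N (x0 + fpt j (s * (0 + 1/2 * r)) q) = (0::ennreal)" by simp
    then show ?case
    proof eventually_elim
      case (elim q)
      then have "x0 + fpt j (s * (r / 2)) q \<notin> N" by (auto simp: indicator_def split: if_splits)
      then show ?case using N(1) by auto
    qed
  qed
qed

lemma AE_off_lines: "AE u in lborel. fst u \<noteq> (a::real) \<and> snd u \<noteq> (b::real)"
proof -
  have 1: "negligible {u :: real \<times> real. (1, 0) \<bullet> u = a}" "negligible {u :: real \<times> real. (0, 1) \<bullet> u = b}"
    by (intro negligible_hyperplane, simp add: zero_prod_def)+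
  have "AE u :: real \<times> real in lebesgue. u \<notin> {u. (1, 0) \<bullet> u = a}" "AE u :: real \<times> real in lebesgue. u \<notin> {u. (0, 1) \<bullet> u = b}"
    using 1 by (auto simp only: negligible_iff_null_sets intro!: AE_not_in)
  then have "AE u :: real \<times> real in lebesgue. fst u \<noteq> a \<and> snd u \<noteq> b"
    by eventually_elim (auto simp: inner_prod_def)
  then show ?thesis by (simp add: AE_completion_iff)
qed

text \<open>On the open face the density of the restricted form is the normal component of the vector field. The
  half open face differs from the open one by a null set.\<close>

lemma face_integral_eq:
  assumes X [measurable]: "X \<in> borel_measurable borel" and s: "s \<in> {-1, 1}"
    and ae: "AE q in lborel. q \<in> face (r / 2) \<longrightarrow> X (x0 + fpt j (s * (r / 2)) q) = form_vec F (x0 + fpt j (s * (r / 2)) q)"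
  shows "set_lebesgue_integral lebesgue ({-r/2<..<r/2} \<times> {-r/2<..<r/2}) (\<lambda>q. restr_density F x0 (face_pt r x0 j s q))
    = s * (face_int (r / 2) (\<lambda>u. X (x0 + fpt j (s * (r / 2)) u) $ j))"
proof -
  let ?Q = "{-r/2<..<r/2} \<times> {-r/2<..<r/2}"
  let ?f = "\<lambda>q. indicator ?Q q *\<^sub>R restr_density F x0 (face_pt r x0 j s q)"
  let ?g = "\<lambda>u. s * (indicator (face (r / 2)) u * X (x0 + fpt j (s * (r / 2)) u) $ j)"
  have gm: "?g \<in> borel_measurable lborel" by measurable
  have "AE q in lborel. ?g q = ?f q"
    using ae AE_off_lines[of "- (r / 2)" "- (r / 2)"]
  proof eventually_elim
    case (elim q)
    show ?case
    proof (cases "q \<in> ?Q")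
      case True
      then have q: "\<bar>fst q\<bar> < r / 2" "\<bar>snd q\<bar> < r / 2" "q \<in> face (r / 2)" by (cases q; auto)+
      show ?thesis unfolding face_pt_fpt restr_density_face[OF s q(1,2)] using True elim q(3) by simp
    next
      case False
      then have "q \<notin> face (r / 2)" using elim by (cases q) auto
      then show ?thesis using False by simp
    qed
  qed
  then have ae': "AE q in lebesgue. ?g q = ?f q" by (simp add: AE_completion_iff)
  have gl: "?g \<in> borel_measurable lebesgue" using gm by (rule measurable_completion)
  have fl: "?f \<in> borel_measurable lebesgue" by (rule borel_measurable_AE[OF gl ae'])
  have "integral\<^sup>L lebesgue ?f = integral\<^sup>L lebesgue ?g"
    by (rule integral_cong_AE[OF fl gl]) (use ae' in \<open>auto simp: eq_commute\<close>)
  also have "\<dots> = integral\<^sup>L lborel ?g" by (rule integral_completion[OF gm])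
  finally show ?thesis by (simp add: set_lebesgue_integral_def)
qed

lemma cube_flux_eq:
  assumes X: "X \<in> borel_measurable borel"
    and ae: "AE x in lborel. norm x < 1 \<longrightarrow> X x = form_vec F x"
  shows "AE r in lborel. 0 < r \<and> r < 1 - norm x0 \<longrightarrow> cube_flux F x0 r = cube_outflow (r / 2) X x0 / (2 * pi)"
proof -
  have "AE r in lborel. \<forall>j\<in>UNIV. \<forall>s\<in>{-1, 1::real}. AE q in lborel. norm (x0 + fpt j (s * (r / 2)) q) < 1 \<longrightarrow> X (x0 + fpt j (s * (r / 2)) q) = form_vec F (x0 + fpt j (s * (r / 2)) q)"
    by (intro AE_finite_allI finite_UNIV AE_face[OF ae]) auto
  then show ?thesis
  proof eventually_elim
    case (elim r)
    show ?case
    proof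
      assume r: "0 < r \<and> r < 1 - norm x0"
      have "set_lebesgue_integral lebesgue ({-r/2<..<r/2} \<times> {-r/2<..<r/2}) (\<lambda>q. restr_density F x0 (face_pt r x0 j s q))
        = s * (face_int (r / 2) (\<lambda>u. X (x0 + fpt j (s * (r / 2)) u) $ j))" if s: "s \<in> {-1, 1}" for j s
      proof (rule face_integral_eq[OF X s])
        from elim s have "AE q in lborel. norm (x0 + fpt j (s * (r / 2)) q) < 1 \<longrightarrow> X (x0 + fpt j (s * (r / 2)) q) = form_vec F (x0 + fpt j (s * (r / 2)) q)" by blast
        then show "AE q in lborel. q \<in> face (r / 2) \<longrightarrow> X (x0 + fpt j (s * (r / 2)) q) = form_vec F (x0 + fpt j (s * (r / 2)) q)"
        proof eventually_elim
          case (elim q)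
          have "norm (x0 + fpt j (s * (r / 2)) q) < 1" if "q \<in> face (r / 2)"
          proof -
            have "norm (fpt j (s * (r / 2)) q) \<le> 2 * (r / 2)" using that s r by (intro norm_fpt_le) auto
            then show ?thesis using norm_triangle_ineq[of x0 "fpt j (s * (r / 2)) q"] r by linarith
          qed
          then show ?case using elim by blast
        qed
      qed
      then have "cube_surface_integral r x0 (restr_density F x0) = cube_outflow (r / 2) X x0"
        unfolding cube_surface_integral_def cube_outflow_def by (intro sum.cong refl) simp
      then show "cube_flux F x0 r = cube_outflow (r / 2) X x0 / (2 * pi)"
        by (simp add: cube_flux_def)
    qed
  qed
qed

lemma cube_outflow_borel:
  assumes X [measurable]: "X \<in> borel_measurable borel"
  shows "(\<lambda>p. cube_outflow (fst p) X (snd p)) \<in> borel_measurable (lborel \<Otimes>\<^sub>M lborel)"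
proof -
  have ind: "indicator (face r) u = (if - r \<le> fst u \<and> fst u < r \<and> - r \<le> snd u \<and> snd u < r then 1 else 0 :: real)" for r u
    by (cases u) (auto simp: indicator_def)
  have "(\<lambda>p. \<integral>u. indicator (face (fst p)) u * X (snd p + fpt j (s * fst p) u) $ j \<partial>lborel) \<in> borel_measurable (lborel \<Otimes>\<^sub>M lborel)" for j and s :: real
    unfolding ind by (rule lborel.borel_measurable_lebesgue_integral) measurable
  then show ?thesis unfolding cube_outflow_def by (intro borel_measurable_sum borel_measurable_times borel_measurable_const)
qed

text \<open>Integrating the flux over all sizes of the cube sweeps out space once for each of the six pyramids.\<close>

lemma cube_outflow_integrable:
  assumes X [measurable]: "X \<in> borel_measurable borel" and X1: "(\<integral>\<^sup>+x. ennreal (norm (X x)) \<partial>lborel) < \<infinity>"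
  shows "integrable lborel (\<lambda>r. cube_outflow r X c)"
proof (rule integrableI_bounded)
  have "(\<lambda>r. (\<lambda>p. cube_outflow (fst p) X (snd p)) (r, c)) \<in> borel_measurable lborel"
    by (rule measurable_compose[OF measurable_Pair2' cube_outflow_borel[OF X]]) (simp_all add: space_pair_measure)
  then show "(\<lambda>r. cube_outflow r X c) \<in> borel_measurable lborel" by simp
  let ?I = "\<lambda>j s r. \<integral>\<^sup>+u. ennreal (norm (X (c + fpt j (s * r) u))) \<partial>lborel"
  have I: "(\<integral>\<^sup>+r. ?I j s r \<partial>lborel) = (\<integral>\<^sup>+x. ennreal (norm (X x)) \<partial>lborel)" if "s \<in> {-1, 1}" for j s
    by (rule nn_integral_fpt[OF _ that, symmetric]) measurable
  have Im [measurable]: "?I j s \<in> borel_measurable borel" for j s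
    using lborel.borel_measurable_nn_integral[of "\<lambda>r u. ennreal (norm (X (c + fpt j (s * r) u)))" lborel] by simp
  have b: "ennreal (norm (cube_outflow r X c)) \<le> (face_sum (\<lambda>j s. ?I j s r))" for r
  proof -
    have 1: "ennreal \<bar>\<integral>u. indicator (face r) u * X (c + fpt j (s * r) u) $ j \<partial>lborel\<bar> \<le> ?I j s r" for j s
    proof (cases "integrable lborel (\<lambda>u. indicator (face r) u * X (c + fpt j (s * r) u) $ j)")
      case True
      have "ennreal (norm (face_int r (\<lambda>u. X (c + fpt j (s * r) u) $ j))) \<le> (\<integral>\<^sup>+u. ennreal (norm (indicator (face r) u * X (c + fpt j (s * r) u) $ j)) \<partial>lborel)"
        by (rule integral_norm_bound_ennreal[OF True])
      also have "\<dots> \<le> ?I j s r"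
        by (intro nn_integral_mono ennreal_leI) (auto simp: indicator_def component_le_norm_cart)
      finally show ?thesis by simp
    qed (simp add: not_integrable_integral_eq)
    have "ennreal \<bar>cube_outflow r X c\<bar> \<le> ennreal (face_sum (\<lambda>j s. \<bar>\<integral>u. indicator (face r) u * X (c + fpt j (s * r) u) $ j \<partial>lborel\<bar>))"
      unfolding cube_outflow_def by (intro ennreal_leI order_trans[OF sum_abs] sum_mono) (auto simp: abs_mult)
    also have "\<dots> = (face_sum (\<lambda>j s. ennreal \<bar>\<integral>u. indicator (face r) u * X (c + fpt j (s * r) u) $ j \<partial>lborel\<bar>))"
      by (simp only: sum_ennreal[symmetric] sum_nonneg abs_ge_zero)
    also have "\<dots> \<le> (face_sum (\<lambda>j s. ?I j s r))" by (intro sum_mono 1)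
    finally show ?thesis by simp
  qed
  have "(\<integral>\<^sup>+r. ennreal (norm (cube_outflow r X c)) \<partial>lborel) \<le> (\<integral>\<^sup>+r. (face_sum (\<lambda>j s. ?I j s r)) \<partial>lborel)"
    by (intro nn_integral_mono b)
  also have "\<dots> = (face_sum (\<lambda>j s. \<integral>\<^sup>+r. ?I j s r \<partial>lborel))"
    by (simp add: nn_integral_sum nn_integral_add)
  also have "\<dots> = (\<Sum>j\<in>(UNIV::3 set). \<Sum>s\<in>{-1, 1::real}. (\<integral>\<^sup>+x. ennreal (norm (X x)) \<partial>lborel))"
    by (intro sum.cong refl I)
  also have "\<dots> < \<infinity>" using X1 by (simp add: ennreal_mult_less_top sum_cyclic[of _ 1])
  finally show "(\<integral>\<^sup>+r. ennreal (norm (cube_outflow r X c)) \<partial>lborel) < \<infinity>" .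
qed

text \<open>The flux is an integrable function of the side length, so almost every side length is one of its
  Lebesgue points and is covered by the hypothesis on \<open>F\<close>. Multiplication with the indicator of the
  admissible range makes the flux globally integrable and does not affect Lebesgue points inside.\<close>

lemma integer_flux_AE:
  assumes F: "F \<in> Omega2_Z p" and X: "X \<in> borel_measurable borel" and X1: "(\<integral>\<^sup>+x. ennreal (norm (X x)) \<partial>lborel) < \<infinity>"
    and ae: "AE x in lborel. norm x < 1 \<longrightarrow> X x = form_vec F x" and x0: "norm x0 < 1"
  shows "AE r in lborel. 0 < r \<and> r < (1 - norm x0) / sqrt 3 \<longrightarrow> (\<exists>n::int. cube_outflow (r / 2) X x0 = 2 * pi * of_int n)"
proof -
  define R where "R = (1 - norm x0) / sqrt 3"
  have "sqrt 1 \<le> sqrt 3" by (subst real_sqrt_le_iff) simp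
  then have s3: "1 \<le> sqrt 3" by simp
  \<comment> \<open>The range of side lengths in the flux condition keeps the cubes inside the ball.\<close>
  have R1: "R \<le> 1 - norm x0" using x0 s3 unfolding R_def by (simp add: divide_le_eq mult_left_le)
  have inf: "1 - norm x0 \<le> infdist x0 (frontier unit_ball3)"
  proof -
    have ne: "sphere (0::real^3) 1 \<noteq> {}" by simp
    have "1 - norm x0 \<le> dist x0 y" if "y \<in> sphere 0 1" for y
      using that norm_triangle_ineq2[of y x0] by (simp add: dist_norm norm_minus_commute)
    then show ?thesis using ne unfolding frontier_ball[OF zero_less_one] infdist_notempty[OF ne] by (intro cINF_greatest) auto
  qed
  have range: "r \<in> {0<..<1 / sqrt 3 * infdist x0 (frontier unit_ball3)}" if "0 < r" "r < R" for r
  proof -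
    have "R \<le> 1 / sqrt 3 * infdist x0 (frontier unit_ball3)"
      using inf unfolding R_def by (simp add: divide_right_mono)
    then show ?thesis using that by simp
  qed
  have eq: "AE r in lborel. 0 < r \<and> r < R \<longrightarrow> cube_flux F x0 r = cube_outflow (r / 2) X x0 / (2 * pi)"
    using cube_flux_eq[OF X ae, of x0] by eventually_elim (use R1 in auto)
  let ?g = "\<lambda>r. indicator {0<..<R} r * (cube_outflow (r / 2) X x0 / (2 * pi))"
  let ?h = "\<lambda>r. indicator {0<..<R} r * cube_flux F x0 r"
  have gi: "integrable lborel ?g"
  proof -
    have "integrable lborel (\<lambda>r. cube_outflow (0 + 1/2 * r) X x0)"
      by (rule lborel_integrable_real_affine[OF cube_outflow_integrable[OF X X1]]) simp
    then have "integrable lborel (\<lambda>r. cube_outflow (r / 2) X x0 / (2 * pi))" by simp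
    from integrable_mult_indicator[OF _ this, of "{0<..<R}"] show ?thesis by simp
  qed
  have gm: "?g \<in> borel_measurable lborel" using gi by simp
  have gl: "?g \<in> borel_measurable lebesgue" using gm by (rule measurable_completion)
  have "AE r in lborel. ?g r = ?h r" using eq by eventually_elim (auto simp: indicator_def)
  then have gh: "AE r in lebesgue. ?g r = ?h r" by (simp add: AE_completion_iff)
  have hl: "?h \<in> borel_measurable lebesgue" by (rule borel_measurable_AE[OF gl gh])
  have "integrable lebesgue ?g" using gi integrable_completion[OF gm] by simp
  then have hi: "integrable lebesgue ?h" using integrable_cong_AE[OF gl hl gh] by simp
  have lp: "lebesgue_point (cube_flux F x0) r" if r: "0 < r" "r < R" and l: "lebesgue_point ?h r" for r
  proof -
    define d where "d = min r (R - r)"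
    have d: "d > 0" using r by (simp add: d_def)
    have hf: "?h t = cube_flux F x0 t" if "t \<in> {r-e..r+e}" "e < d" for t e
      using that r by (auto simp: d_def indicator_def)
    obtain e where e: "e > 0" "set_integrable lebesgue {r-e..r+e} ?h" using l by (auto simp: lebesgue_point_def)
    define e' where "e' = min e (d / 2)"
    have e': "e' > 0" "e' < d" "e' \<le> e" using e d by (auto simp: e'_def)
    have "set_integrable lebesgue {r-e'..r+e'} ?h"
      by (rule set_integrable_subset[OF e(2)]) (use e' in auto)
    then have "set_integrable lebesgue {r-e'..r+e'} (cube_flux F x0)"
      by (subst (asm) set_integrable_cong[OF refl refl, of _ ?h "cube_flux F x0"]) (use hf e' in auto)
    moreover have "((\<lambda>e. 1 / (2 * e) * set_lebesgue_integral lebesgue {r-e..r+e} (\<lambda>t. \<bar>cube_flux F x0 t - cube_flux F x0 r\<bar>)) \<longlongrightarrow> 0) (at_right 0)"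
    proof (rule Lim_transform_eventually)
      show "((\<lambda>e. 1 / (2 * e) * set_lebesgue_integral lebesgue {r-e..r+e} (\<lambda>t. \<bar>?h t - ?h r\<bar>)) \<longlongrightarrow> 0) (at_right 0)"
        using l by (simp only: lebesgue_point_def)
      have "eventually (\<lambda>e. e < d) (at_right 0)" using eventually_at_right_real[OF d] by eventually_elim simp
      then show "eventually (\<lambda>e. 1 / (2 * e) * set_lebesgue_integral lebesgue {r-e..r+e} (\<lambda>t. \<bar>?h t - ?h r\<bar>)
         = 1 / (2 * e) * set_lebesgue_integral lebesgue {r-e..r+e} (\<lambda>t. \<bar>cube_flux F x0 t - cube_flux F x0 r\<bar>)) (at_right 0)"
      proof eventually_elim
        case (elim e)
        have hr: "?h r = cube_flux F x0 r" using r by simp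
        have "set_lebesgue_integral lebesgue {r-e..r+e} (\<lambda>t. \<bar>?h t - ?h r\<bar>) = set_lebesgue_integral lebesgue {r-e..r+e} (\<lambda>t. \<bar>cube_flux F x0 t - cube_flux F x0 r\<bar>)"
        proof (intro set_lebesgue_integral_cong allI impI)
          fix t assume t: "t \<in> {r-e..r+e}"
          show "\<bar>?h t - ?h r\<bar> = \<bar>cube_flux F x0 t - cube_flux F x0 r\<bar>"
            unfolding hf[OF t elim] hr ..
        qed simp
        then show ?case by simp
      qed
    qed
    ultimately show ?thesis using e' unfolding lebesgue_point_def by blast
  qed
  have "AE r in lebesgue. r \<in> {0<..<1 / sqrt 3 * infdist x0 (frontier unit_ball3)} \<longrightarrow> lebesgue_point (cube_flux F x0) r \<longrightarrow> cube_flux F x0 r \<in> \<int>"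
    using F x0 by (auto simp: Omega2_Z_def)
  then have "AE r in lebesgue. 0 < r \<and> r < R \<longrightarrow> cube_flux F x0 r \<in> \<int>"
    using AE_lebesgue_point[OF hi] by eventually_elim (use lp range in blast)
  then have "AE r in lborel. 0 < r \<and> r < R \<longrightarrow> cube_flux F x0 r \<in> \<int>" by (simp add: AE_completion_iff)
  then show ?thesis using eq unfolding R_def[symmetric]
  proof eventually_elim
    case (elim r)
    show ?case
    proof
      assume r: "0 < r \<and> r < R"
      then have "cube_outflow (r / 2) X x0 / (2 * pi) \<in> \<int>" using elim by metis
      then obtain n :: int where "cube_outflow (r / 2) X x0 / (2 * pi) = of_int n" by (auto elim: Ints_cases)
      then have "cube_outflow (r / 2) X x0 = 2 * pi * of_int n" by (simp add: field_simps)
      then show "\<exists>n::int. cube_outflow (r / 2) X x0 = 2 * pi * of_int n" ..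
    qed
  qed
qed

text \<open>Exchange of the quantifiers \<open>every centre, almost every size\<close> and \<open>almost every size, almost every
  centre\<close> by Fubini's theorem.\<close>

lemma integral_flux_small:
  assumes F: "F \<in> Omega2_Z p" and X [measurable]: "X \<in> borel_measurable borel" and X1: "(\<integral>\<^sup>+x. ennreal (norm (X x)) \<partial>lborel) < \<infinity>"
    and ae: "AE x in lborel. norm x < 1 \<longrightarrow> X x = form_vec F x" and \<eta>: "\<eta> > 0"
  shows "\<exists>r>0. r < \<eta> \<and> integral_flux X r"
proof -
  note [measurable] = cube_outflow_borel[OF X]
  let ?P = "\<lambda>r c. 0 < r \<and> norm c < 1 - 4 * r \<longrightarrow> (\<exists>n::int. cube_outflow r X c = 2 * pi * of_int n)"
  have 1: "AE r in lborel. ?P r c" for c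
  proof (cases "norm c < 1")
    case True
    have s3: "sqrt 3 < 2" by (rule real_less_lsqrt) auto
    have "Measurable.pred borel (\<lambda>r. cube_outflow r X c = 2 * pi * of_int n)" for n :: int
    proof -
      have "(\<lambda>r. cube_outflow r X c) \<in> borel_measurable borel" using cube_outflow_integrable[OF X X1, of c] by simp
      then show ?thesis by measurable
    qed
    note [measurable] = this
    have "(\<lambda>r. cube_outflow r X c) \<in> borel_measurable borel" using cube_outflow_integrable[OF X X1, of c] by simp
    note [measurable] = this
    have "AE r in lborel. 0 < 0 + 2 * r \<and> 0 + 2 * r < (1 - norm c) / sqrt 3 \<longrightarrow> (\<exists>n::int. cube_outflow ((0 + 2 * r) / 2) X c = 2 * pi * of_int n)"
      by (rule AE_borel_affine[OF _ _ integer_flux_AE[OF F X X1 ae True]]) (simp, measurable)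
    then show ?thesis
    proof eventually_elim
      case (elim r)
      have "2 * r < (1 - norm c) / sqrt 3" if r: "0 < r" "norm c < 1 - 4 * r"
      proof -
        have "2 * r * sqrt 3 \<le> 2 * r * 2" using r s3 by (intro mult_left_mono) auto
        also have "\<dots> < 1 - norm c" using r by simp
        finally show ?thesis by (simp add: less_divide_eq)
      qed
      then show ?case using elim by simp
    qed
  next
    case False
    then show ?thesis by (intro AE_I2) auto
  qed
  have m: "{p \<in> space (lborel \<Otimes>\<^sub>M lborel). ?P (fst p) (snd p)} \<in> sets (lborel \<Otimes>\<^sub>M lborel)"
    by measurable
  have "AE c in lborel. AE r in lborel. ?P r c" using 1 by simp
  then have "AE r in lborel. AE c in lborel. ?P r c"
    by (subst lborel_pair.AE_commute[OF m])
  then have ae_r: "AE r in lborel. 0 < r \<longrightarrow> integral_flux X r"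
  proof eventually_elim
    case (elim r)
    show ?case
    proof
      assume "0 < r"
      then show "integral_flux X r" using elim unfolding integral_flux_def by simp
    qed
  qed
  show ?thesis
  proof (rule ccontr)
    assume no: "\<not> ?thesis"
    have ae0: "AE r in lborel. r \<notin> {0<..<\<eta>}" using ae_r by eventually_elim (use no in auto)
    have eq: "{x \<in> space lborel. \<not> x \<notin> {0<..<\<eta>}} = {0<..<\<eta>}" by auto
    have "emeasure lborel {0<..<\<eta>} = 0"
      by (rule AE_iff_measurable[OF _ eq, THEN iffD1, OF _ ae0]) simp
    then show False using \<eta> by simp
  qed
qed

section \<open>Forms and vector fields\<close>

definition vec_form :: "(real^3 \<Rightarrow> real^3) \<Rightarrow> form2" where
  "vec_form W x u v = W x \<bullet> cross3 u v"

lemma alternating2_vec_form: "alternating2 (vec_form W x)"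
  by (auto simp: alternating2_def vec_form_def[abs_def] bilinear_def cross_add_left cross_add_right
      cross_mult_left cross_mult_right inner_add_right intro!: linearI)

lemma cf_vec_form: "cf (vec_form W) i j = (\<lambda>x. \<Sum>k\<in>UNIV. (cross3 (axis i 1) (axis j 1)) $ k * W x $ k)"
  by (auto simp: cf_def vec_form_def inner_vec_def mult.commute)

lemma form_vec_vec_form: "form_vec (vec_form W) x = W x"
proof -
  have "cross3 (axis (j + 1) 1) (axis (j + 2) 1) = (axis j 1 :: real^3)" for j
    using exhaust_3[of j] by (auto simp: cross_basis numeral_wrap3)
  then show ?thesis unfolding form_vec_def vec_form_def by (simp only: inner_axis) (simp add: vec_eq_iff)
qed

lemma alternating2_antisym:
  assumes "alternating2 \<omega>" shows "\<omega> u v = - \<omega> v u"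
proof -
  have b: "bilinear \<omega>" and z: "\<And>v. \<omega> v v = 0" using assms by (auto simp: alternating2_def)
  have "\<omega> (u + v) (u + v) = 0" by (rule z)
  then show ?thesis using z[of u] z[of v] by (simp add: bilinear_ladd[OF b] bilinear_radd[OF b])
qed

text \<open>The components of a 2-form in the standard basis are, up to sign and order, those of its vector field.\<close>

lemma norm2_vec_form_diff:
  assumes "alternating2 (F x)" shows "norm2 (\<lambda>u v. vec_form W x u v - F x u v) = norm (W x - form_vec F x)"
proof -
  have w: "vec_form W x (axis 1 1) (axis 2 1) = W x $ 3" "vec_form W x (axis 1 1) (axis 3 1) = - W x $ 2" "vec_form W x (axis 2 1) (axis 3 1) = W x $ 1"
    by (simp_all add: vec_form_def cross_basis inner_axis)
  have f: "F x (axis 1 1) (axis 2 1) = form_vec F x $ 3" "F x (axis 1 1) (axis 3 1) = - form_vec F x $ 2" "F x (axis 2 1) (axis 3 1) = form_vec F x $ 1"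
    using alternating2_antisym[OF assms, of "axis 1 1" "axis 3 1"] by (simp_all add: form_vec_def numeral_wrap3)
  have "norm (W x - form_vec F x) = sqrt (\<Sum>i\<in>UNIV. ((W x - form_vec F x) $ i)\<^sup>2)"
    unfolding norm_vec_def L2_set_def by simp
  then show ?thesis
    unfolding norm2_def w f by (simp add: sum_3 power2_eq_square algebra_simps)
qed

lemma test_function_test_on:
  assumes "\<phi> \<in> test_functions unit_ball3"
  shows "test_on 1 \<phi> (\<lambda>x. \<chi> i. dif \<phi> x (axis i 1))"
proof -
  have c: "Ck_on k UNIV \<phi>" for k using assms by (auto simp: test_functions_def Cinf_on_def)
  have "(\<phi> has_derivative (\<lambda>h. (\<chi> i. dif \<phi> x (axis i 1)) \<bullet> h)) (at x)" for x
    by (rule Ck_on_gradient[OF c[of "Suc 0"]]) simp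
  moreover have "continuous_on UNIV (\<lambda>x. \<chi> i. dif \<phi> x (axis i 1))"
    using c[of "Suc 0"] unfolding Ck_on.simps by (intro continuous_on_vec_lambda) blast
  moreover have "\<phi> x = 0" if "1 \<le> norm x" for x
  proof (rule ccontr)
    assume "\<phi> x \<noteq> 0"
    then have "x \<in> {x. \<phi> x \<noteq> 0}" by simp
    then have "x \<in> closure {x. \<phi> x \<noteq> 0}" by (rule subsetD[OF closure_subset])
    moreover have "closure {x. \<phi> x \<noteq> 0} \<subseteq> unit_ball3" using assms unfolding test_functions_def by blast
    ultimately have "x \<in> unit_ball3" by (rule subsetD[rotated])
    then show False using that by simp
  qed
  ultimately show ?thesis by (simp add: test_on_def has_gradient_def)
qed

lemma integral_ball:
  fixes f :: "real^3 \<Rightarrow> real"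
  assumes f: "f \<in> borel_measurable borel"
  shows "(\<integral>x. f x \<partial>lebesgue_on unit_ball3) = (\<integral>x. indicator unit_ball3 x * f x \<partial>lborel)"
proof -
  note [measurable] = f
  have "(\<integral>x. f x \<partial>lebesgue_on unit_ball3) = (\<integral>x. indicator unit_ball3 x *\<^sub>R f x \<partial>lebesgue)"
    by (rule integral_restrict_space) simp
  also have "\<dots> = (\<integral>x. indicator unit_ball3 x *\<^sub>R f x \<partial>lborel)"
    by (rule integral_completion) measurable
  finally show ?thesis by simp
qed

lemma vec_form_Lp:
  assumes W: "W \<in> borel_measurable borel" and p: "1 \<le> p"
    and Wp: "(Lp_int_on unit_ball3 p W) < \<infinity>"
  shows "vec_form W \<in> Omega2_Lp p"
proof -
  note [measurable] = W
  have c [measurable]: "cf (vec_form W) i j \<in> borel_measurable borel" for i j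
    unfolding cf_vec_form by measurable
  have le: "\<bar>cf (vec_form W) i j x\<bar> \<le> norm (W x)" for i j x
  proof -
    have "norm (cross3 (axis i 1) (axis j 1)) \<le> 1"
      using exhaust_3[of i] exhaust_3[of j] by (auto simp: cross_basis norm_axis_1)
    then have "norm (W x) * norm (cross3 (axis i 1) (axis j 1)) \<le> norm (W x) * 1" by (intro mult_left_mono) auto
    then show ?thesis
      using Cauchy_Schwarz_ineq2[of "W x" "cross3 (axis i 1) (axis j 1)"] by (simp add: cf_def vec_form_def)
  qed
  have m: "cf (vec_form W) i j \<in> borel_measurable (lebesgue_on unit_ball3)" for i j
    by (rule measurable_restrict_space1[OF measurable_completion]) (simp add: c)
  have "integrable (lebesgue_on unit_ball3) (\<lambda>x. \<bar>cf (vec_form W) i j x\<bar> powr p)" for i j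
  proof -
    have "integrable lborel (\<lambda>x. indicator unit_ball3 x *\<^sub>R (\<bar>cf (vec_form W) i j x\<bar> powr p))"
    proof (rule integrableI_bounded)
      have "(\<integral>\<^sup>+x. ennreal (norm (indicator unit_ball3 x *\<^sub>R (\<bar>cf (vec_form W) i j x\<bar> powr p))) \<partial>lborel)
        \<le> (Lp_int_on unit_ball3 p W)"
        using le p by (intro nn_integral_mono) (auto simp: indicator_def intro!: ennreal_leI powr_mono2)
      also note Wp
      finally show "(\<integral>\<^sup>+x. ennreal (norm (indicator unit_ball3 x *\<^sub>R (\<bar>cf (vec_form W) i j x\<bar> powr p))) \<partial>lborel) < \<infinity>" .
    qed measurable
    then have "integrable lebesgue (\<lambda>x. indicator unit_ball3 x *\<^sub>R (\<bar>cf (vec_form W) i j x\<bar> powr p))"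
      by (subst integrable_completion) auto
    then show ?thesis by (subst integrable_restrict_space) auto
  qed
  then show ?thesis using m alternating2_vec_form by (auto simp: Omega2_Lp_def)
qed

lemma vec_form_Omega2_R:
  assumes W [measurable]: "W \<in> borel_measurable borel" and p: "1 \<le> p"
    and Wp: "(Lp_int_on unit_ball3 p W) < \<infinity>"
    and ch: "charged_on 1 W A n" and sm: "\<And>i k. Ck_on k (unit_ball3 - A) (\<lambda>x. W x $ i)"
  shows "vec_form W \<in> Omega2_R p"
proof -
  have A: "finite A" "A \<subseteq> unit_ball3" using ch by (auto simp: charged_on_def)
  have S: "open (unit_ball3 - A)" using A by (intro open_Diff finite_imp_closed) auto
  obtain x where x: "bij_betw x {1..card A} A" using ex_bij_betw_nat_finite_1[OF A(1)] by blast
  have img: "x ` {1..card A} = A" using x by (simp add: bij_betw_def)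
  have smooth: "Cinf_on (unit_ball3 - A) (cf (vec_form W) i j)" for i j
    unfolding Cinf_on_def cf_vec_form by (intro allI Ck_on_sum[OF S] Ck_on_mult[OF S] Ck_on_const[OF S] sm)
  have d: "dist_d (vec_form W) \<phi> = (\<Sum>j=1..card A. 2 * pi * of_int (n (x j)) * \<phi> (x j))" if \<phi>: "\<phi> \<in> test_functions unit_ball3" for \<phi>
  proof -
    let ?G = "\<lambda>x. \<chi> i. dif \<phi> x (axis i 1)"
    have t: "test_on 1 \<phi> ?G" by (rule test_function_test_on[OF \<phi>])
    have [measurable]: "?G \<in> borel_measurable borel" using t by (auto simp: test_on_def intro: has_gradient_borel)
    have h: "hodge3 (wedge21 (vec_form W x) (dif \<phi> x)) = W x \<bullet> ?G x" for x
      unfolding hodge3_wedge21 form_vec_vec_form by (simp add: inner_vec_def)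
    have "dist_d (vec_form W) \<phi> = - (\<integral>x. W x \<bullet> ?G x \<partial>lebesgue_on unit_ball3)"
      unfolding dist_d_def h ..
    also have "(\<integral>x. W x \<bullet> ?G x \<partial>lebesgue_on unit_ball3) = (\<integral>x. indicator unit_ball3 x * (W x \<bullet> ?G x) \<partial>lborel)"
      by (rule integral_ball) measurable
    also have "\<dots> = (pairing W ?G)"
    proof (rule integral_cong_AE)
      have "AE x in lborel. x \<notin> sphere (0::real^3) 1"
      proof -
        have "negligible (sphere (0::real^3) 1)" by (rule negligible_sphere)
        then have "AE x in lebesgue. x \<notin> sphere (0::real^3) 1" by (auto simp only: negligible_iff_null_sets intro!: AE_not_in)
        then show ?thesis by (simp add: AE_completion_iff)
      qed
      then show "AE x in lborel. indicator unit_ball3 x * (W x \<bullet> ?G x) = W x \<bullet> ?G x"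
      proof eventually_elim
        case (elim x)
        show ?case using test_on_gradient_zero[OF t, of x] elim by (cases "norm x < 1") (auto simp: indicator_def)
      qed
    qed measurable
    also have "\<dots> = - (\<Sum>c\<in>A. 2 * pi * of_int (n c) * \<phi> c)"
      using ch t unfolding charged_on_def by blast
    also have "(\<Sum>c\<in>A. 2 * pi * of_int (n c) * \<phi> c) = (\<Sum>j=1..card A. 2 * pi * of_int (n (x j)) * \<phi> (x j))"
      by (rule sum.reindex_bij_betw[OF x, symmetric])
    finally show ?thesis by simp
  qed
  have mem: "\<forall>j\<in>{1..card A}. x j \<in> unit_ball3" using img A(2) by blast
  show ?thesis
    unfolding Omega2_R_def mem_Collect_eq
    using vec_form_Lp[OF W p Wp] smooth d img mem
    by (intro conjI exI[of _ "card A"] exI[of _ x] exI[of _ "n \<circ> x"]) auto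
qed

text \<open>The coefficients of \<open>F\<close> are Lebesgue measurable and matter only up to null sets. A Borel
  representative has Borel restrictions to all faces, which Fubini's theorem needs.\<close>

lemma borel_representative:
  assumes F: "F \<in> Omega2_Lp p" and p: "1 \<le> p"
  shows "\<exists>X. X \<in> borel_measurable borel \<and> (\<forall>x. 1 \<le> norm x \<longrightarrow> X x = 0) \<and>
     (AE x in lborel. norm x < 1 \<longrightarrow> X x = form_vec F x) \<and> (Lp_int p X) < \<infinity>"
proof -
  have "\<exists>g. g \<in> borel_measurable borel \<and> (AE x in lborel. norm x < 1 \<longrightarrow> form_vec F x $ j = g x) \<and>
    (\<integral>\<^sup>+x. indicator unit_ball3 x * ennreal (\<bar>g x\<bar> powr p) \<partial>lborel) < \<infinity>" for j
  proof -
    let ?c = "cf F (j + 1) (j + 2)"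
    have m: "?c \<in> borel_measurable (lebesgue_on unit_ball3)" and i: "integrable (lebesgue_on unit_ball3) (\<lambda>x. \<bar>?c x\<bar> powr p)"
      using F by (auto simp: Omega2_Lp_def)
    have "(\<lambda>x. if x \<in> unit_ball3 then ?c x else 0) \<in> borel_measurable lebesgue"
      using m by (subst borel_measurable_if) auto
    then obtain g where g: "g \<in> borel_measurable lborel" and ae: "AE x in lborel. (if x \<in> unit_ball3 then ?c x else 0) = g x"
      using completion_ex_borel_measurable_real by blast
    have gb [measurable]: "g \<in> borel_measurable borel" using g by simp
    have ae': "AE x in lborel. norm x < 1 \<longrightarrow> form_vec F x $ j = g x"
      using ae by eventually_elim (auto simp: form_vec_def cf_def)
    have "integrable lebesgue (\<lambda>x. indicator unit_ball3 x *\<^sub>R (\<bar>?c x\<bar> powr p))"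
      using i by (subst (asm) integrable_restrict_space) auto
    then have fin: "(\<integral>\<^sup>+x. ennreal (norm (indicator unit_ball3 x *\<^sub>R (\<bar>?c x\<bar> powr p))) \<partial>lebesgue) < \<infinity>"
      by (simp only: integrable_iff_bounded)
    have "(\<integral>\<^sup>+x. indicator unit_ball3 x * ennreal (\<bar>g x\<bar> powr p) \<partial>lborel) = (\<integral>\<^sup>+x. ennreal (norm (indicator unit_ball3 x *\<^sub>R (\<bar>?c x\<bar> powr p))) \<partial>lborel)"
    proof (rule nn_integral_cong_AE)
      show "AE x in lborel. indicator unit_ball3 x * ennreal (\<bar>g x\<bar> powr p) = ennreal (norm (indicator unit_ball3 x *\<^sub>R (\<bar>?c x\<bar> powr p)))"
        using ae by eventually_elim (auto simp: indicator_def split: if_splits)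
    qed
    also have "\<dots> < \<infinity>" using fin by (simp only: nn_integral_completion)
    finally show ?thesis using gb ae' by blast
  qed
  then have "\<forall>j. \<exists>g. g \<in> borel_measurable borel \<and> (AE x in lborel. norm x < 1 \<longrightarrow> form_vec F x $ j = g x) \<and>
    (\<integral>\<^sup>+x. indicator unit_ball3 x * ennreal (\<bar>g x\<bar> powr p) \<partial>lborel) < \<infinity>" by blast
  from choice[OF this] obtain g where g: "\<forall>j::3. g j \<in> borel_measurable borel \<and> (AE x in lborel. norm x < 1 \<longrightarrow> form_vec F x $ j = g j x) \<and>
    (\<integral>\<^sup>+x. indicator unit_ball3 x * ennreal (\<bar>g j x\<bar> powr p) \<partial>lborel) < \<infinity>" by (elim exE)
  have gm [measurable]: "g j \<in> borel_measurable borel" for j using g by blast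
  define X where "X x = indicator unit_ball3 x *\<^sub>R (\<chi> j. g j x)" for x
  have Xm: "X \<in> borel_measurable borel"
  proof -
    have "(\<lambda>x. \<chi> j. g j x) = (\<lambda>x. \<Sum>j\<in>UNIV. g j x *\<^sub>R axis j 1)"
    proof
      fix x show "(\<chi> j. g j x) = (\<Sum>j\<in>UNIV. g j x *\<^sub>R axis j 1)"
        using basis_expansion[of "\<chi> j. g j x"] by (simp add: scalar_mult_eq_scaleR)
    qed
    then have "(\<lambda>x. \<chi> j. g j x) \<in> borel_measurable borel" by simp
    then show ?thesis unfolding X_def[abs_def] by measurable
  qed
  have ae: "AE x in lborel. norm x < 1 \<longrightarrow> X x = form_vec F x"
  proof -
    have "AE x in lborel. \<forall>j\<in>(UNIV::3 set). norm x < 1 \<longrightarrow> form_vec F x $ j = g j x"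
      using g by (intro AE_finite_allI) auto
    then show ?thesis by eventually_elim (auto simp: X_def vec_eq_iff)
  qed
  have "(Lp_int p X) \<le> (\<integral>\<^sup>+x. (\<Sum>j\<in>UNIV. ennreal (3 powr p) * (indicator unit_ball3 x * ennreal (\<bar>g j x\<bar> powr p))) \<partial>lborel)"
  proof (intro nn_integral_mono)
    fix x :: "real^3"
    show "ennreal (norm (X x) powr p) \<le> (\<Sum>j\<in>UNIV. ennreal (3 powr p) * (indicator unit_ball3 x * ennreal (\<bar>g j x\<bar> powr p)))"
    proof (cases "x \<in> unit_ball3")
      case True
      then have "norm (X x) \<le> (\<Sum>j\<in>UNIV. \<bar>g j x\<bar>)" using norm_le_l1_cart[of "X x"] by (simp add: X_def)
      then have "norm (X x) powr p \<le> (\<Sum>j\<in>UNIV. \<bar>g j x\<bar>) powr p" using p by (intro powr_mono2) auto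
      also have "\<dots> \<le> real CARD(3) powr p * (\<Sum>j\<in>UNIV. \<bar>g j x\<bar> powr p)" using p by (intro sum_powr_le) auto
      finally have "ennreal (norm (X x) powr p) \<le> ennreal (\<Sum>j\<in>UNIV. 3 powr p * \<bar>g j x\<bar> powr p)"
        by (intro ennreal_leI) (simp add: sum_distrib_left)
      also have "\<dots> = (\<Sum>j\<in>UNIV. ennreal (3 powr p) * ennreal (\<bar>g j x\<bar> powr p))"
        by (subst sum_ennreal[symmetric]) (simp_all add: ennreal_mult)
      finally show ?thesis using True by simp
    qed (use p in \<open>simp add: X_def\<close>)
  qed
  also have "\<dots> = (\<Sum>j\<in>UNIV. ennreal (3 powr p) * (\<integral>\<^sup>+x. indicator unit_ball3 x * ennreal (\<bar>g j x\<bar> powr p) \<partial>lborel))"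
  proof -
    have m: "(\<lambda>x. indicator unit_ball3 x * ennreal (\<bar>g j x\<bar> powr p)) \<in> borel_measurable lborel" for j by measurable
    show ?thesis by (subst nn_integral_sum) (use m in \<open>auto simp: nn_integral_cmult\<close>)
  qed
  also have "\<dots> < \<infinity>" using g by (simp add: sum_cyclic[of _ 1] ennreal_mult_less_top)
  finally show ?thesis using Xm ae by (intro exI[of _ X]) (auto simp: X_def)
qed

theorem theorem1p1:
  fixes p :: real and F :: form2
  assumes "1 \<le> p" and "F \<in> Omega2_Z p"
  shows "\<exists>Fk :: nat \<Rightarrow> form2. (\<forall>k. Fk k \<in> Omega2_R p) \<and>
           (\<lambda>k. Lp_norm2 p (\<lambda>x u v. Fk k x u v - F x u v)) \<longlonglongrightarrow> 0"
proof -
  note p = assms(1)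
  have FL: "F \<in> Omega2_Lp p" using assms(2) by (simp add: Omega2_Z_def)
  have alt: "alternating2 (F x)" if "x \<in> unit_ball3" for x using FL that by (auto simp: Omega2_Lp_def)
  obtain X where X [measurable]: "X \<in> borel_measurable borel" and supp: "\<And>x. 1 \<le> norm x \<Longrightarrow> X x = 0"
    and ae: "AE x in lborel. norm x < 1 \<longrightarrow> X x = form_vec F x" and Xp: "(Lp_int p X) < \<infinity>"
    using borel_representative[OF FL p] by blast
  have "(Lp_int 1 X) < \<infinity>"
    by (rule ball_Lp_mono[OF X _ _ Xp supp]) (use p in auto)
  then have X1: "(\<integral>\<^sup>+x. ennreal (norm (X x)) \<partial>lborel) < \<infinity>" by simp
  have flux: "\<exists>r>0. r < \<eta> \<and> integral_flux X r" if "\<eta> > 0" for \<eta>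
    by (rule integral_flux_small[OF assms(2) X X1 ae that])
  have step: "\<exists>H. H \<in> Omega2_R p \<and> Lp_norm2 p (\<lambda>x u v. H x u v - F x u v) \<le> \<delta> powr (1 / p)" if \<delta>: "\<delta> > 0" for \<delta>
  proof -
    obtain W A n where W [measurable]: "W \<in> borel_measurable borel" and ch: "charged_on 1 W A n" 
      and sm: "\<And>i k. Ck_on k (unit_ball3 - A) (\<lambda>x. W x $ i)"
      and err: "(Lp_int_on unit_ball3 p (\<lambda>x. W x - X x)) \<le> ennreal \<delta>"
      using charged_field_approximation[OF X p Xp supp flux \<delta>] by blast
    have Wp: "(Lp_int_on unit_ball3 p W) < \<infinity>"
    proof -
      have "(Lp_int_on unit_ball3 p W) \<le>
        (\<integral>\<^sup>+x. ennreal (2 powr p) * ((indicator unit_ball3 x * ennreal (norm (W x - X x) powr p) + ennreal (norm (X x) powr p)) + 0 * 0) \<partial>lborel)"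
      proof (intro nn_integral_mono)
        fix x :: "real^3"
        have "norm (W x) powr p \<le> 2 powr p * (norm (W x - X x) powr p + norm (X x) powr p)"
          using norm_add_powr_le[of p "W x - X x" "X x"] p by simp
        then have "ennreal (norm (W x) powr p) \<le> ennreal (2 powr p * (norm (W x - X x) powr p + norm (X x) powr p))" by (rule ennreal_leI)
        then show "indicator unit_ball3 x * ennreal (norm (W x) powr p) \<le> ennreal (2 powr p) * ((indicator unit_ball3 x * ennreal (norm (W x - X x) powr p) + ennreal (norm (X x) powr p)) + 0 * 0)"
          by (cases "x \<in> unit_ball3") (simp_all add: ennreal_mult)
      qed
      also have "\<dots> = ennreal (2 powr p) * (((Lp_int_on unit_ball3 p (\<lambda>x. W x - X x)) + (Lp_int p X)) + 0 * (\<integral>\<^sup>+x. 0 \<partial>(lborel :: (real^3) measure)))"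
        by (rule nn_integral_combination3) measurable
      also have "\<dots> < \<infinity>" using Xp order.strict_trans1[OF err, of \<infinity>] by (simp add: ennreal_mult_less_top)
      finally show ?thesis .
    qed
    have R: "vec_form W \<in> Omega2_R p" by (rule vec_form_Omega2_R[OF W p Wp ch sm])
    let ?e = "\<lambda>x. indicator unit_ball3 x * norm (W x - X x) powr p"
    have "(LINT x|lebesgue_on unit_ball3. norm2 (\<lambda>u v. vec_form W x u v - F x u v) powr p)
      = (\<integral>x. indicator unit_ball3 x *\<^sub>R (norm2 (\<lambda>u v. vec_form W x u v - F x u v) powr p) \<partial>lebesgue)"
      by (rule integral_restrict_space) simp
    also have "\<dots> = (\<integral>x. ?e x \<partial>lebesgue)"
    proof -
      have em: "?e \<in> borel_measurable lebesgue" by (rule measurable_completion) measurable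
      have "AE x in lborel. ?e x = indicator unit_ball3 x *\<^sub>R (norm2 (\<lambda>u v. vec_form W x u v - F x u v) powr p)"
        using ae
      proof eventually_elim
        case (elim x)
        show ?case
        proof (cases "x \<in> unit_ball3")
          case True
          show ?thesis unfolding norm2_vec_form_diff[where F = F, OF alt[OF True]] using elim True by simp
        qed simp
      qed
      then have ae': "AE x in lebesgue. ?e x = indicator unit_ball3 x *\<^sub>R (norm2 (\<lambda>u v. vec_form W x u v - F x u v) powr p)"
        by (simp add: AE_completion_iff)
      have ae'': "AE x in lebesgue. indicator unit_ball3 x *\<^sub>R (norm2 (\<lambda>u v. vec_form W x u v - F x u v) powr p) = ?e x"
        using ae' by eventually_elim (rule sym)
      show ?thesis
        by (rule integral_cong_AE[OF borel_measurable_AE[OF em ae'] em ae''])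
    qed
    also have "\<dots> = (\<integral>x. ?e x \<partial>lborel)" by (rule integral_completion) measurable
    finally have eq: "(LINT x|lebesgue_on unit_ball3. norm2 (\<lambda>u v. vec_form W x u v - F x u v) powr p) = (\<integral>x. ?e x \<partial>lborel)" .
    have "(\<integral>x. ?e x \<partial>lborel) = enn2real (\<integral>\<^sup>+x. ennreal (?e x) \<partial>lborel)"
    proof (rule integral_eq_nn_integral)
      show "?e \<in> borel_measurable lborel" by measurable
    qed (rule AE_I2, simp)
    also have "(\<integral>\<^sup>+x. ennreal (?e x) \<partial>lborel) = (Lp_int_on unit_ball3 p (\<lambda>x. W x - X x))"
      by (intro nn_integral_cong) (auto simp: indicator_def)
    also have "enn2real \<dots> \<le> \<delta>" using enn2real_mono[OF err] \<delta> by simp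
    finally have "(\<integral>x. ?e x \<partial>lborel) \<le> \<delta>" .
    moreover have "0 \<le> (\<integral>x. ?e x \<partial>lborel)" by (intro integral_nonneg_AE) auto
    ultimately have "Lp_norm2 p (\<lambda>x u v. vec_form W x u v - F x u v) \<le> \<delta> powr (1 / p)"
      unfolding Lp_norm2_def eq using p by (intro powr_mono2) auto
    with R show ?thesis by blast
  qed
  have "\<forall>k. \<exists>H. H \<in> Omega2_R p \<and> Lp_norm2 p (\<lambda>x u v. H x u v - F x u v) \<le> (1 / real (Suc k)) powr (1 / p)"
    using step by simp
  from choice[OF this] obtain Fk where Fk: "\<forall>k. Fk k \<in> Omega2_R p \<and> Lp_norm2 p (\<lambda>x u v. Fk k x u v - F x u v) \<le> (1 / real (Suc k)) powr (1 / p)"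
    by (elim exE)
  have "(\<lambda>k. 1 / real (Suc k)) \<longlonglongrightarrow> 0" using LIMSEQ_inverse_real_of_nat by (simp add: inverse_eq_divide)
  then have lim: "(\<lambda>k. (1 / real (Suc k)) powr (1 / p)) \<longlonglongrightarrow> 0"
    using p by (intro tendsto_zero_powrI) auto
  have "(\<lambda>k. Lp_norm2 p (\<lambda>x u v. Fk k x u v - F x u v)) \<longlonglongrightarrow> 0"
  proof (rule tendsto_sandwich[OF _ _ tendsto_const lim])
    show "eventually (\<lambda>k. 0 \<le> Lp_norm2 p (\<lambda>x u v. Fk k x u v - F x u v)) sequentially"
      by (simp add: Lp_norm2_def)
    show "eventually (\<lambda>k. Lp_norm2 p (\<lambda>x u v. Fk k x u v - F x u v) \<le> (1 / real (Suc k)) powr (1 / p)) sequentially"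
      using Fk by simp
  qed
  with Fk show ?thesis by blast
qed

end
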